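(* Let $w$ be a permutation avoiding the pattern $1423$. Then $c_w(\beta)=d_w(\beta)$; that is, $c_w(\beta)=\sum_{P\in\mathrm{CMRPD}(w)}\beta^{\mathrm{mbt}(P)}$. Moreover $\Upsilon_w(\beta)=\sum_{v\le w}d_{\mathrm{perm}(v)}(\beta)$, the sum over all subwords $v$ of $w$.
   Context: $\Upsilon_w(\beta)=\mathfrak{G}^{(\beta)}_w(1,\dots,1)$, where $\mathfrak{G}^{(\beta)}_w$ is the $\beta$-Grothendieck polynomial ($\mathfrak{G}^{(\beta)}_{w_0}=x_1^{n-1}\cdots x_{n-1}$ for $w_0=n\cdots21$; $\mathfrak{G}^{(\beta)}_w=\partial_i((1+\beta x_{i+1})\mathfrak{G}^{(\beta)}_{ws_i})$ when $w(i)<w(i+1)$, $\partial_if=(f-s_if)/(x_i-x_{i+1})$); $\Upsilon_\emptyset=1$. $c_w(\beta)=\sum_{\emptyset\le v\le w}(-1)^{|w|-|v|}\Upsilon_{\mathrm{perm}(v)}(\beta)$ over all subwords $v$ of $w$, $\mathrm{perm}(v)$ being the permutation order-isomorphic to $v$. For a permutation $\sigma\in S_m$: a pipe dream fills the staircase $\{(i,k):i+k\le m+1\}$ (row $i$ from top, column $k$ from left) with crossing tiles and bumping tiles (upper-left arc joining top/left edges, lower-right arc joining bottom/right edges), tiles $(i,m+1-i)$ being bumping; pipe $k$ enters at the top of column $k$, travels down/left to the left boundary. Reduced for $\sigma$: two pipes cross at most once and the pipe exiting row $i$ is $\sigma(i)$. A marked reduced pipe dream also marks some bumping tiles, a bumping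 tile in row $i$ being markable only if its two pipes cross at a crossing in a row strictly above $i$; $\mathrm{MRPD}(\sigma)$, $\mathrm{mbt}(P)$ = number of marked tiles. Pipe $j$ is removable if (i) column $j$ consists of crossings all traversed by pipe $j$ followed only by unmarked bumping tiles; (ii) for each crossing traversed by pipe $j$ the tile directly above (if any) is not an unmarked bumping tile; (iii) pipe $j$ traverses no marked bumping tile. $P$ is core if it has no removable pipe; $\mathrm{CMRPD}(\sigma)$ is the set of core elements and $d_\sigma(\beta)=\sum_{P\in\mathrm{CMRPD}(\sigma)}\beta^{\mathrm{mbt}(P)}$, $d_\emptyset=1$. *)

theory Defs
  imports Main "HOL-Library.Poly_Mapping"
begin

text \<open>A permutation w of [n] is the list [w(1),...,w(n)]; w(i) = w!(i-1).\<close>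
definition is_perm :: "nat list \<Rightarrow> bool" where
  "is_perm w \<longleftrightarrow> distinct w \<and> set w = {1..length w}"

definition std :: "nat list \<Rightarrow> nat list" where
  "std v = map (\<lambda>x. card {y \<in> set v. y \<le> x}) v"

definition avoids_1423 :: "nat list \<Rightarrow> bool" where
  "avoids_1423 w \<longleftrightarrow> \<not> (\<exists>a b c d. a < b \<and> b < c \<and> c < d \<and> d < length w \<and>
       w!a < w!c \<and> w!c < w!d \<and> w!d < w!b)"

type_synonym 'a mpoly = "(nat \<Rightarrow>\<^sub>0 nat) \<Rightarrow>\<^sub>0 'a"

definition X :: "nat \<Rightarrow> 'a::comm_ring_1 mpoly" where
  "X i = Poly_Mapping.single (Poly_Mapping.single i 1) 1"

definition const :: "'a::comm_ring_1 \<Rightarrow> 'a mpoly" where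
  "const c = Poly_Mapping.single 0 c"

definition swp :: "nat \<Rightarrow> nat \<Rightarrow> nat" where
  "swp i v = (if v = i then Suc i else if v = Suc i then i else v)"

definition swap_mono :: "nat \<Rightarrow> (nat \<Rightarrow>\<^sub>0 nat) \<Rightarrow> (nat \<Rightarrow>\<^sub>0 nat)" where
  "swap_mono i m = Abs_poly_mapping (\<lambda>v. Poly_Mapping.lookup m (swp i v))"

definition swap_poly :: "nat \<Rightarrow> 'a::comm_ring_1 mpoly \<Rightarrow> 'a mpoly" where
  "swap_poly i f = Abs_poly_mapping (\<lambda>m. Poly_Mapping.lookup f (swap_mono i m))"

definition ddiff :: "nat \<Rightarrow> 'a::comm_ring_1 mpoly \<Rightarrow> 'a mpoly" where
  "ddiff i f = (THE g. g * (X i - X (Suc i)) = f - swap_poly i f)"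

definition eval_ones :: "'a::comm_ring_1 mpoly \<Rightarrow> 'a" where
  "eval_ones p = (\<Sum>m\<in>Poly_Mapping.keys p. Poly_Mapping.lookup p m)"

definition w0 :: "nat \<Rightarrow> nat list" where
  "w0 n = rev [1..<Suc n]"

definition top_mono :: "nat \<Rightarrow> 'a::comm_ring_1 mpoly" where
  "top_mono n = (\<Prod>j\<in>{1..<n}. X j ^ (n - j))"

definition swap_adj :: "nat list \<Rightarrow> nat \<Rightarrow> nat list" where
  "swap_adj w i = w[i - 1 := w ! i, i := w ! (i - 1)]"

text \<open>Recursive computation from w0 downwards, using the smallest ascent i
  (the result does not depend on the choice); the first argument is fuel.\<close>
fun groth_aux :: "nat \<Rightarrow> 'a::comm_ring_1 \<Rightarrow> nat list \<Rightarrow> 'a mpoly" where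
  "groth_aux 0 \<beta> w = (if w = w0 (length w) then top_mono (length w) else 0)"
| "groth_aux (Suc k) \<beta> w = (if w = w0 (length w) then top_mono (length w) else
     (let i = (LEAST i. 1 \<le> i \<and> i < length w \<and> w ! (i - 1) < w ! i) in
       ddiff i ((1 + const \<beta> * X (Suc i)) * groth_aux k \<beta> (swap_adj w i))))"

definition groth :: "'a::comm_ring_1 \<Rightarrow> nat list \<Rightarrow> 'a mpoly" where
  "groth \<beta> w = groth_aux (length w * length w) \<beta> w"

definition Upsilon :: "'a::comm_ring_1 \<Rightarrow> nat list \<Rightarrow> 'a" where
  "Upsilon \<beta> w = (if w = [] then 1 else eval_ones (groth \<beta> w))"

definition c_coef :: "'a::comm_ring_1 \<Rightarrow> nat list \<Rightarrow> 'a" where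
  "c_coef \<beta> w = (\<Sum>v \<leftarrow> subseqs w. (-1) ^ (length w - length v) * Upsilon \<beta> (std v))"

text \<open>A pipe dream on the staircase of size m is given by its set C of crossing
  tiles (i,k) (row i, column k, 1-based); all other staircase tiles are bumping.
  A pipe state (i,k,t): the pipe is in tile (i,k), entering from the top (t) or
  from the right (\<not>t).\<close>
fun pd_step :: "(nat \<times> nat) set \<Rightarrow> nat \<times> nat \<times> bool \<Rightarrow> nat \<times> nat \<times> bool" where
  "pd_step C (i, k, t) =
     (if (i, k) \<in> C then (if t then (Suc i, k, True) else (i, k - 1, False))
      else (if t then (i, k - 1, False) else (Suc i, k, True)))"

definition pipe_path :: "(nat \<times> nat) set \<Rightarrow> nat \<Rightarrow> nat \<Rightarrow> (nat \<times> nat \<times> bool) list" where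
  "pipe_path C m j = takeWhile (\<lambda>(i, k, t). 0 < k)
      (map (\<lambda>s. (pd_step C ^^ s) (1, j, True)) [0..<2 * m + 2])"

definition exit_row :: "(nat \<times> nat) set \<Rightarrow> nat \<Rightarrow> nat \<Rightarrow> nat" where
  "exit_row C m j = fst ((pd_step C ^^ length (pipe_path C m j)) (1, j, True))"

definition traverses :: "(nat \<times> nat) set \<Rightarrow> nat \<Rightarrow> nat \<Rightarrow> nat \<times> nat \<Rightarrow> bool" where
  "traverses C m j p \<longleftrightarrow> (\<exists>t. (fst p, snd p, t) \<in> set (pipe_path C m j))"

definition staircase :: "nat \<Rightarrow> (nat \<times> nat) set" where
  "staircase m = {(i, k). 1 \<le> i \<and> 1 \<le> k \<and> i + k \<le> m + 1}"

definition reduced_pd :: "nat list \<Rightarrow> (nat \<times> nat) set \<Rightarrow> bool" where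
  "reduced_pd \<sigma> C \<longleftrightarrow> (let m = length \<sigma> in
     C \<subseteq> {(i, k). 1 \<le> i \<and> 1 \<le> k \<and> i + k \<le> m} \<and>
     (\<forall>a b. 1 \<le> a \<longrightarrow> a < b \<longrightarrow> b \<le> m \<longrightarrow>
        card {p \<in> C. traverses C m a p \<and> traverses C m b p} \<le> 1) \<and>
     (\<forall>i \<in> {1..m}. exit_row C m (\<sigma> ! (i - 1)) = i))"

definition markable :: "(nat \<times> nat) set \<Rightarrow> nat \<Rightarrow> nat \<times> nat \<Rightarrow> bool" where
  "markable C m p \<longleftrightarrow> p \<in> staircase m - C \<and>
     (\<exists>a b. 1 \<le> a \<and> a \<le> m \<and> 1 \<le> b \<and> b \<le> m \<and> a \<noteq> b \<and>
        traverses C m a p \<and> traverses C m b p \<and>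
        (\<exists>q \<in> C. fst q < fst p \<and> traverses C m a q \<and> traverses C m b q))"

definition MRPD :: "nat list \<Rightarrow> ((nat \<times> nat) set \<times> (nat \<times> nat) set) set" where
  "MRPD \<sigma> = {(C, M). reduced_pd \<sigma> C \<and> (\<forall>p \<in> M. markable C (length \<sigma>) p)}"

definition removable ::
  "(nat \<times> nat) set \<Rightarrow> (nat \<times> nat) set \<Rightarrow> nat \<Rightarrow> nat \<Rightarrow> bool" where
  "removable C M m j \<longleftrightarrow>
     (\<exists>r. (\<forall>i. 1 \<le> i \<and> i \<le> r \<longrightarrow> (i, j) \<in> C \<and> traverses C m j (i, j)) \<and>
          (\<forall>i. r < i \<and> i \<le> m + 1 - j \<longrightarrow> (i, j) \<notin> C \<and> (i, j) \<notin> M)) \<and>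
     (\<forall>p \<in> C. traverses C m j p \<longrightarrow> 1 < fst p \<longrightarrow>
          (fst p - 1, snd p) \<in> C \<or> (fst p - 1, snd p) \<in> M) \<and>
     (\<forall>p \<in> M. \<not> traverses C m j p)"

definition CMRPD :: "nat list \<Rightarrow> ((nat \<times> nat) set \<times> (nat \<times> nat) set) set" where
  "CMRPD \<sigma> = {(C, M) \<in> MRPD \<sigma>. \<not> (\<exists>j \<in> {1..length \<sigma>}. removable C M (length \<sigma>) j)}"

definition d_coef :: "'a::comm_ring_1 \<Rightarrow> nat list \<Rightarrow> 'a" where
  "d_coef \<beta> \<sigma> = (if \<sigma> = [] then 1 else (\<Sum>(C, M) \<in> CMRPD \<sigma>. \<beta> ^ card M))"

end

(* By Fomin and Kirillov, the Grothendieck polynomials are the coefficients of the product of the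
   factors 1 + x_i u_p over the staircase in the 0-Hecke algebra, taken row by row. At x = 1 the
   factors may be reordered column by column, and expanding the product gives Upsilon_w as the sum of
   beta^mbt over MRPD(w): a tile where the larger pipe comes from above is exactly one whose pipes
   have already crossed.

   Let j be a removable pipe of P in MRPD(w). Left of column j it runs weakly down, and deleting one
   tile in each of these columns together with column j removes it. Conversely, a dream of w without
   the letter j and the exit row of j determine the inserted pipe: followed backwards it must cross
   below a crossing or a marked bump and split a bump otherwise. The result could fail to be reduced
   only if some b > j crosses j twice, and then some c > b leaves above j and b leaves below it. If
   every pipe leaving above c were larger than j, the tiles above would all be crossings and b could
   not be there; so a pipe a < j leaves above c, and a, c, j, b form a 1423 pattern. Since deleting j
   does not change which larger pipes are removable, processing the labels one by one shows that
   Upsilon_w is the sum of the d_perm(v), and Moebius inversion over subwords yields c_w = d_w. *)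
theory Submission
  imports Defs
begin

section \<open>0-Hecke operators\<close>

text \<open>An element of the 0-Hecke algebra is kept as its coefficient function on lists, and
  right multiplication is an operator on such functions, so no algebra has to be built. The symmetry
  of the product is usually derived by inverting factors \<open>1 + x u\<close>; polynomials do not
  provide these inverses, so the Yang-Baxter step relates two functions instead, one for each order
  of the variables. The definitions follow pipes along whole paths, while expansion and insertion
  see one tile with its two incoming pipes. The bridge is a parity argument. On each diagonal of
  constant row minus column, pipes \<open>a < b\<close> have a vertical order; \<open>a\<close> is
  above \<open>b\<close> at first, and the order flips exactly at their common crossings. So the
  larger pipe enters a shared tile from above iff the number of earlier common crossings is odd.
  Subwords keep their letters: pipes are labelled by the letters of \<open>v\<close>, and
  \<open>std\<close> enters only at the very end, through an order-preserving relabelling.\<close>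

definition swapl :: "nat \<Rightarrow> nat list \<Rightarrow> nat list" where
  "swapl p v = v[p := v ! Suc p, Suc p := v ! p]"

text \<open>Coefficient form of right multiplication by \<open>u_p\<close>, which sends
  \<open>v\<close> to \<open>v s_p\<close> at an ascent and to \<beta> times \<open>v\<close> at a
  descent. Hence a list with a descent at \<open>p\<close> receives contributions from its swap and
  from itself, and any other list receives none.\<close>

definition hecke_u :: "'b::comm_ring_1 \<Rightarrow> nat \<Rightarrow> (nat list \<Rightarrow> 'b) \<Rightarrow> nat list \<Rightarrow> 'b" where
  "hecke_u \<beta> p F v =
     (if Suc p < length v \<and> v ! Suc p < v ! p then F (swapl p v) + \<beta> * F v else 0)"

definition hecke_h :: "'b::comm_ring_1 \<Rightarrow> nat \<Rightarrow> 'b \<Rightarrow> (nat list \<Rightarrow> 'b) \<Rightarrow> nat list \<Rightarrow> 'b" where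
  "hecke_h \<beta> p x F v = F v + x * hecke_u \<beta> p F v"

lemma hecke_u_add: "hecke_u \<beta> p (\<lambda>v. F v + G v) w = hecke_u \<beta> p F w + hecke_u \<beta> p G w"
  by (simp add: hecke_u_def algebra_simps)

lemma hecke_u_mult: "hecke_u \<beta> p (\<lambda>v. c * F v) w = c * hecke_u \<beta> p F w"
  by (simp add: hecke_u_def algebra_simps)

lemma hecke_u_sq: "hecke_u \<beta> p (hecke_u \<beta> p F) w = \<beta> * hecke_u \<beta> p F w"
  by (auto simp: hecke_u_def swapl_def)

lemma swapl_commute:
  assumes "Suc p < q" "Suc q < length v"
  shows "swapl p (swapl q v) = swapl q (swapl p v)"
  by (rule nth_equalityI)
     (use assms in \<open>auto simp: swapl_def nth_list_update\<close>)

lemma hecke_u_commute_aux: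
  assumes "Suc p < q"
  shows "hecke_u \<beta> p (hecke_u \<beta> q F) = hecke_u \<beta> q (hecke_u \<beta> p F)"
proof
  fix v
  have "length (swapl p v) = length v" "length (swapl q v) = length v"
    "swapl p v ! q = v ! q" "swapl p v ! Suc q = v ! Suc q"
    "swapl q v ! p = v ! p" "swapl q v ! Suc p = v ! Suc p"
    using assms by (auto simp: swapl_def)
  then show "hecke_u \<beta> p (hecke_u \<beta> q F) v = hecke_u \<beta> q (hecke_u \<beta> p F) v"
    using swapl_commute[OF assms, of v] by (auto simp: hecke_u_def algebra_simps)
qed

lemma hecke_h_commute:
  assumes "Suc p < q \<or> Suc q < p"
  shows "hecke_h \<beta> p x (hecke_h \<beta> q y F) = hecke_h \<beta> q y (hecke_h \<beta> p x F)"
proof -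
  have "hecke_u \<beta> p (hecke_u \<beta> q F) = hecke_u \<beta> q (hecke_u \<beta> p F)"
    using assms hecke_u_commute_aux[of p q] hecke_u_commute_aux[of q p] by metis
  then show ?thesis
    unfolding hecke_h_def[abs_def] by (simp add: hecke_u_add hecke_u_mult algebra_simps)
qed

lemma hecke_h_commute_same:
  "hecke_h \<beta> p x (hecke_h \<beta> p y F) = hecke_h \<beta> p y (hecke_h \<beta> p x F)"
  unfolding hecke_h_def[abs_def] by (simp add: hecke_u_add hecke_u_mult algebra_simps)

lemma hecke_u_append:
  "hecke_u \<beta> (length a) F (a @ x # y # b) =
     (if y < x then F (a @ y # x # b) + \<beta> * F (a @ x # y # b) else 0)"
  by (simp add: hecke_u_def swapl_def nth_append list_update_append)

lemma hecke_u_append_Suc: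
  "hecke_u \<beta> (Suc (length a)) F (a @ z # x # y # b) =
     (if y < x then F (a @ z # y # x # b) + \<beta> * F (a @ z # x # y # b) else 0)"
  using hecke_u_append[of \<beta> "a @ [z]" F x y b] by simp

lemma swapl_append: "swapl (length a) (a @ x # y # b) = a @ y # x # b"
  by (simp add: swapl_def list_update_append nth_append)

lemma list_split_two: "Suc p < length v \<Longrightarrow> \<exists>a b. v = a @ v ! p # v ! Suc p # b \<and> length a = p"
  by (rule exI[of _ "take p v"], rule exI[of _ "drop (Suc (Suc p)) v"]) (simp add: Cons_nth_drop_Suc)

lemma list_split_two_ex:
  assumes "Suc p < length v"
  obtains a x y b where "v = a @ x # y # b" "length a = p"
  using list_split_two[OF assms] that by auto

lemma hecke_u_short: "length v \<le> Suc p \<Longrightarrow> hecke_u \<beta> p F v = 0"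
  by (simp add: hecke_u_def)

lemma length_swapl [simp]: "length (swapl p v) = length v"
  by (simp add: swapl_def)

lemma hecke_u_braid:
  "hecke_u \<beta> p (hecke_u \<beta> (Suc p) (hecke_u \<beta> p F)) =
   hecke_u \<beta> (Suc p) (hecke_u \<beta> p (hecke_u \<beta> (Suc p) F))"
proof
  fix v
  show "hecke_u \<beta> p (hecke_u \<beta> (Suc p) (hecke_u \<beta> p F)) v =
   hecke_u \<beta> (Suc p) (hecke_u \<beta> p (hecke_u \<beta> (Suc p) F)) v"
  proof (cases "Suc (Suc p) < length v")
    case True
    define a where "a = take p v"
    have p: "p = length a" using True by (simp add: a_def)
    have v: "v = a @ v ! p # v ! Suc p # v ! Suc (Suc p) # drop (Suc (Suc (Suc p))) v"
      using True by (simp add: a_def Cons_nth_drop_Suc)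
    obtain x y z b where v: "v = a @ x # y # z # b" using v by blast
    show ?thesis
      unfolding v p by (auto simp: hecke_u_append hecke_u_append_Suc algebra_simps)
  next
    case False
    have "hecke_u \<beta> (Suc p) G u = 0" if "length u = length v" for G u
      using False that by (simp add: hecke_u_short)
    then show ?thesis
      by (simp add: hecke_u_def[of \<beta> p])
  qed
qed

text \<open>The Yang--Baxter relation in a form without inverses: if \<open>Z'\<close> is \<open>Z\<close> with \<open>x\<close> and \<open>y\<close>
  exchanged, then symmetry of \<open>Z h\<^sub>b(y)\<close> implies symmetry of \<open>Z h\<^sub>a(x) h\<^sub>b(y) h\<^sub>a(y)\<close>.\<close>
lemma hecke_yang_baxter:
  assumes "hecke_h \<beta> (Suc p) y Z = hecke_h \<beta> (Suc p) x Z'"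
  shows "hecke_h \<beta> p y (hecke_h \<beta> (Suc p) y (hecke_h \<beta> p x Z)) =
         hecke_h \<beta> p x (hecke_h \<beta> (Suc p) x (hecke_h \<beta> p y Z'))"
proof
  fix v
  define a where "a = hecke_u \<beta> p"
  define b where "b = hecke_u \<beta> (Suc p)"
  have lin: "a (\<lambda>v. F v + G v) w = a F w + a G w" "b (\<lambda>v. F v + G v) w = b F w + b G w"
    "a (\<lambda>v. c * F v) w = c * a F w" "b (\<lambda>v. c * F v) w = c * b F w" for F G c w
    by (simp_all add: a_def b_def hecke_u_add hecke_u_mult)
  have lin': "a (\<lambda>v. a F v + G v) w = a (a F) w + a G w" for F G w by (rule lin)
  have sq: "a (a F) w = \<beta> * a F w" "b (b F) w = \<beta> * b F w" for F w
    by (simp_all add: a_def b_def hecke_u_sq)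
  have braid: "a (b (a F)) = b (a (b F))" for F
    by (simp add: a_def b_def hecke_u_braid)
  have H: "(\<lambda>v. Z v + y * b Z v) = (\<lambda>v. Z' v + x * b Z' v)"
    using assms by (simp add: hecke_h_def[abs_def] b_def)
  have Ha: "a Z v + y * a (b Z) v = a Z' v + x * a (b Z') v"
    using arg_cong[OF H, of "\<lambda>F. a F v"] by (simp add: lin)
  \<comment> \<open>\<open>b\<close> applied to \<open>H\<close>, with \<open>b b\<close> equal to
    \<beta> \<open>b\<close>. The factors cannot be cancelled, so the relation keeps both of
    them.\<close>
  have Hb: "b Z v * (1 + \<beta> * y) = b Z' v * (1 + \<beta> * x)" for v
    using arg_cong[OF H, of "\<lambda>F. b F v"] by (simp add: lin sq algebra_simps)
  have "(\<lambda>v. (1 + \<beta> * y) * b Z v) = (\<lambda>v. (1 + \<beta> * x) * b Z' v)"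
    using Hb by (simp add: mult.commute)
  then have Hab: "(1 + \<beta> * y) * a (b Z) v = (1 + \<beta> * x) * a (b Z') v"
    using lin(3) by metis
  \<comment> \<open>\<open>b a\<close> applied to \<open>H\<close>; the braid relation rewrites
    \<open>b a b\<close> as \<open>a b a\<close>, the form that occurs in the expansion
    \<open>L\<close>.\<close>
  have "b (a (\<lambda>v. Z v + y * b Z v)) v = b (a (\<lambda>v. Z' v + x * b Z' v)) v"
    using H by simp
  then have Hba: "b (a Z) v + y * a (b (a Z)) v = b (a Z') v + x * a (b (a Z')) v"
    unfolding lin(1)[abs_def] lin(3)[abs_def] braid by (simp add: lin[abs_def] lin)
  have H0: "Z v + y * b Z v = Z' v + x * b Z' v" using H by metis
  \<comment> \<open>\<open>x + y + \<beta> * x * y\<close> is the parameter of the product of the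
    two factors with index \<open>p\<close>.\<close>
  have L: "hecke_h \<beta> p y (hecke_h \<beta> (Suc p) y (hecke_h \<beta> p x Z)) v =
     (Z v + y * b Z v) + (x + y + \<beta> * x * y) * a Z v + x * y * (b (a Z) v + y * a (b (a Z)) v) + y * y * a (b Z) v"
    for x y Z
    unfolding hecke_h_def[abs_def] a_def[symmetric] b_def[symmetric]
    unfolding lin lin[abs_def] sq sq[abs_def] by (simp add: algebra_simps)
  \<comment> \<open>Regrouped so that \<open>Z\<close> occurs only in the two combinations that
    \<open>Ha\<close> and \<open>Hab\<close> translate to \<open>Z'\<close>.\<close>
  have "(x + y + \<beta> * x * y) * a Z v + y * y * a (b Z) v =
        (x + y + \<beta> * x * y) * (a Z v + y * a (b Z) v) - x * y * ((1 + \<beta> * y) * a (b Z) v)"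
    by (simp add: algebra_simps)
  also have "\<dots> = (x + y + \<beta> * x * y) * (a Z' v + x * a (b Z') v) - x * y * ((1 + \<beta> * x) * a (b Z') v)"
    by (simp only: Ha Hab)
  also have "\<dots> = (y + x + \<beta> * y * x) * a Z' v + x * x * a (b Z') v"
    by (simp add: algebra_simps)
  finally have E: "(x + y + \<beta> * x * y) * a Z v + y * y * a (b Z) v = \<dots>" .
  show "hecke_h \<beta> p y (hecke_h \<beta> (Suc p) y (hecke_h \<beta> p x Z)) v =
         hecke_h \<beta> p x (hecke_h \<beta> (Suc p) x (hecke_h \<beta> p y Z')) v"
    unfolding L H0 Hba using E by (simp add: algebra_simps)
qed

text \<open>The variable \<open>x\<^sub>i\<close> belongs to the word \<open>s\<^sub>N\<dots>s\<^sub>i\<close>; operators act from the right, so the first letter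
  of the word is applied first.\<close>
definition hecke_row :: "nat \<Rightarrow> 'b::comm_ring_1 \<Rightarrow> nat \<Rightarrow> 'b \<Rightarrow> (nat list \<Rightarrow> 'b) \<Rightarrow> nat list \<Rightarrow> 'b" where
  "hecke_row N \<beta> i x F = fold (\<lambda>p. hecke_h \<beta> p x) (rev [i..<N]) F"

lemma hecke_row_empty: "N \<le> i \<Longrightarrow> hecke_row N \<beta> i x F = F"
  by (simp add: hecke_row_def)

lemma hecke_row_rec: "i < N \<Longrightarrow> hecke_row N \<beta> i x F = hecke_h \<beta> i x (hecke_row N \<beta> (Suc i) x F)"
  by (simp add: hecke_row_def upt_conv_Cons)

lemma hecke_h_row_commute:
  "Suc p < i \<Longrightarrow> hecke_h \<beta> p x (hecke_row N \<beta> i y F) = hecke_row N \<beta> i y (hecke_h \<beta> p x F)"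
proof (induction "N - i" arbitrary: i)
  case 0
  then show ?case by (simp add: hecke_row_empty)
next
  case (Suc k)
  then have "i < N" "k = N - Suc i" by auto
  then show ?case
    using Suc by (simp add: hecke_row_rec hecke_h_commute)
qed

text \<open>With \<open>A_i(x)\<close> for the row starting at \<open>i\<close>, the factor
  \<open>h_i(x)\<close> moves past \<open>A_(i+2)(y)\<close>, so that \<open>A_i(x) A_i(y)\<close>
  becomes \<open>Z h_i(x) h_(i+1)(y) h_i(y)\<close> with \<open>Z = A_(i+1)(x) A_(i+2)(y)\<close>.
  By the induction hypothesis \<open>Z h_(i+1)(y)\<close> is symmetric, which is the premise of
  \<open>hecke_yang_baxter\<close>.\<close>

lemma hecke_row_commute:
  "hecke_row N \<beta> i y (hecke_row N \<beta> i x F) = hecke_row N \<beta> i x (hecke_row N \<beta> i y F)"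
proof (induction "N - i" arbitrary: i)
  case 0
  then show ?case by (simp add: hecke_row_empty)
next
  case (Suc k)
  then have i: "i < N" by auto
  show ?case
  proof (cases "Suc i < N")
    case False
    then show ?thesis
      using i by (simp add: hecke_row_rec hecke_row_empty hecke_h_commute_same)
  next
    case True
    have IH: "hecke_row N \<beta> (Suc i) y (hecke_row N \<beta> (Suc i) x F) =
        hecke_row N \<beta> (Suc i) x (hecke_row N \<beta> (Suc i) y F)"
      using Suc by auto
    have *: "hecke_row N \<beta> i y (hecke_row N \<beta> i x F) = hecke_h \<beta> i y (hecke_h \<beta> (Suc i) y
        (hecke_h \<beta> i x (hecke_row N \<beta> (Suc (Suc i)) y (hecke_row N \<beta> (Suc i) x F))))" for x y
      using i True by (simp add: hecke_row_rec[of i] hecke_row_rec[of "Suc i" _ _ y] hecke_h_row_commute)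
    show ?thesis
      unfolding *[of x y] *[of y x]
      by (rule hecke_yang_baxter) (use IH True in \<open>simp add: hecke_row_rec[of "Suc i"]\<close>)
  qed
qed

text \<open>Row \<open>N\<close> is empty. Keeping it in the product lets \<open>x_N\<close> be
  exchanged with \<open>x_(N+1)\<close> like any other neighbouring pair.\<close>

definition hecke_groth :: "nat \<Rightarrow> 'b::comm_ring_1 \<Rightarrow> (nat \<Rightarrow> 'b) \<Rightarrow> nat list \<Rightarrow> 'b" where
  "hecke_groth N \<beta> xs =
     fold (\<lambda>i. hecke_row N \<beta> i (xs (Suc i))) [0..<Suc N] (\<lambda>v. if v = [1..<Suc (Suc N)] then 1 else 0)"

lemma hecke_h_rows_commute:
  "(\<forall>i\<in>set is. Suc p < i) \<Longrightarrow> hecke_h \<beta> p x (fold (\<lambda>i. hecke_row N \<beta> i (xs i)) is F) =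
     fold (\<lambda>i. hecke_row N \<beta> i (xs i)) is (hecke_h \<beta> p x F)"
  by (induction "is" arbitrary: F) (simp_all add: hecke_h_row_commute)

text \<open>With \<open>i = p + 1\<close>: the product \<open>G h\<^sub>i(x\<^sub>i\<^sub>+\<^sub>1)\<close> is symmetric in \<open>x\<^sub>i\<close> and \<open>x\<^sub>i\<^sub>+\<^sub>1\<close>; comparing coefficients
  gives the divided difference recursion.\<close>
lemma hecke_groth_exchange:
  assumes "p < N"
  shows "hecke_h \<beta> p (xs (Suc (Suc p))) (hecke_groth N \<beta> xs) =
         hecke_h \<beta> p (xs (Suc p)) (hecke_groth N \<beta> (xs \<circ> swp (Suc p)))"
proof -
  define D where "D = (\<lambda>v. if v = [1..<Suc (Suc N)] then 1 else 0 :: 'a)"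
  have upt: "[0..<Suc N] = [0..<p] @ [p, Suc p] @ [Suc (Suc p)..<Suc N]"
    using assms upt_add_eq_append[of 0 p "Suc N - p"] by (simp add: upt_conv_Cons del: upt_Suc)
  have split: "hecke_h \<beta> p z (hecke_groth N \<beta> ys) =
      fold (\<lambda>i. hecke_row N \<beta> i (ys (Suc i))) [Suc (Suc p)..<Suc N]
       (hecke_h \<beta> p z (hecke_row N \<beta> (Suc p) (ys (Suc (Suc p))) (hecke_row N \<beta> p (ys (Suc p))
         (fold (\<lambda>i. hecke_row N \<beta> i (ys (Suc i))) [0..<p] D))))" for ys :: "nat \<Rightarrow> 'a" and z
    unfolding hecke_groth_def upt D_def[symmetric]
    using hecke_h_rows_commute[of "[Suc (Suc p)..<Suc N]" p \<beta> z N "\<lambda>i. ys (Suc i)"]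
    by (simp del: upt_Suc)
  have 1: "fold (\<lambda>i. hecke_row N \<beta> i (xs (swp (Suc p) (Suc i)))) [0..<p] D =
      fold (\<lambda>i. hecke_row N \<beta> i (xs (Suc i))) [0..<p] D"
    by (rule fold_cong) (auto simp: swp_def)
  have 2: "fold (\<lambda>i. hecke_row N \<beta> i (xs (swp (Suc p) (Suc i)))) [Suc (Suc p)..<Suc N] F =
      fold (\<lambda>i. hecke_row N \<beta> i (xs (Suc i))) [Suc (Suc p)..<Suc N] F" for F
    by (rule fold_cong) (auto simp: swp_def)
  have 3: "hecke_h \<beta> p y (hecke_row N \<beta> (Suc p) y F) = hecke_row N \<beta> p y F" for y F
    using assms by (simp add: hecke_row_rec)
  show ?thesis
    unfolding split comp_def 1 2 by (simp add: swp_def 3 hecke_row_commute del: upt_Suc)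
qed

text \<open>Two coefficients of the exchange identity suffice. At \<open>v\<close>, which has an
  ascent, the operators contribute nothing and the two products agree; at \<open>swapl p v\<close>
  this common value occurs with the factors \<open>x_(p+2)\<close> and \<open>x_(p+1)\<close> and
  can be isolated.\<close>

lemma hecke_groth_rec:
  assumes "p < N" "Suc p < length v" "v ! p < v ! Suc p"
  shows "hecke_groth N \<beta> xs v * (xs (Suc p) - xs (Suc (Suc p))) =
    (1 + \<beta> * xs (Suc (Suc p))) * hecke_groth N \<beta> xs (swapl p v) -
    (1 + \<beta> * xs (Suc p)) * hecke_groth N \<beta> (xs \<circ> swp (Suc p)) (swapl p v)"
proof -
  let ?G = "hecke_groth N \<beta> xs" and ?G' = "hecke_groth N \<beta> (xs \<circ> swp (Suc p))"
  have sw: "swapl p (swapl p v) = v" "swapl p v ! p = v ! Suc p" "swapl p v ! Suc p = v ! p"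
    using assms by (auto simp: swapl_def nth_list_update intro!: nth_equalityI)
  have 1: "?G v = ?G' v"
    using fun_cong[OF hecke_groth_exchange[OF assms(1), of \<beta> xs], of v] assms
    by (simp add: hecke_h_def hecke_u_def)
  have "?G (swapl p v) + xs (Suc (Suc p)) * (?G v + \<beta> * ?G (swapl p v)) =
        ?G' (swapl p v) + xs (Suc p) * (?G' v + \<beta> * ?G' (swapl p v))"
    using fun_cong[OF hecke_groth_exchange[OF assms(1), of \<beta> xs], of "swapl p v"] assms
    by (simp add: hecke_h_def hecke_u_def sw)
  then show ?thesis
    unfolding 1[symmetric] by (simp add: algebra_simps)
qed

section \<open>Pipe dreams as lists of columns\<close>

text \<open>Crossing, unmarked bump, marked bump. Rows and columns of a dream \<open>g\<close> are counted from 0, and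
  \<open>g k i\<close> is the tile in column \<open>k\<close>, row \<open>i\<close>. In \<open>col_out p u f\<close> the column \<open>f\<close> is read downwards;
  \<open>p\<close> is the pipe entering from above, \<open>u\<close> lists the pipes entering from the right, and the result
  lists those leaving on the left; the last tile is a bump that is not part of \<open>u\<close>.\<close>
datatype tile = Cr | Bu | Mk

primrec col_out :: "nat \<Rightarrow> nat list \<Rightarrow> (nat \<Rightarrow> tile) \<Rightarrow> nat list" where
  "col_out p [] f = [p]"
| "col_out p (a # u) f =
     (if f 0 = Cr then a # col_out p u (f \<circ> Suc) else p # col_out a u (f \<circ> Suc))"

text \<open>The comparisons stand for global conditions: in a reduced dream the smaller pipe enters
  a crossing from above, and a bump is markable when the larger one does.
  \<open>crossings_ok_iff\<close> and \<open>markable_iff\<close> justify this.\<close>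

primrec col_valid :: "nat \<Rightarrow> nat list \<Rightarrow> (nat \<Rightarrow> tile) \<Rightarrow> bool" where
  "col_valid p [] f = True"
| "col_valid p (a # u) f =
     (if f 0 = Cr then p < a \<and> col_valid p u (f \<circ> Suc)
      else (f 0 = Mk \<longrightarrow> a < p) \<and> col_valid a u (f \<circ> Suc))"

primrec dream_out :: "nat list \<Rightarrow> (nat \<Rightarrow> nat \<Rightarrow> tile) \<Rightarrow> nat list" where
  "dream_out [] g = []"
| "dream_out (x # xs) g = col_out x (dream_out xs (g \<circ> Suc)) (g 0)"

primrec dream_valid :: "nat list \<Rightarrow> (nat \<Rightarrow> nat \<Rightarrow> tile) \<Rightarrow> bool" where
  "dream_valid [] g = True"
| "dream_valid (x # xs) g \<longleftrightarrow>
     dream_valid xs (g \<circ> Suc) \<and> col_valid x (dream_out xs (g \<circ> Suc)) (g 0)"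

text \<open>Padding with \<open>Bu\<close> makes equality of columns equality of functions and turns
  prefixing by \<open>case_nat\<close> into a bijection.\<close>

definition columns :: "nat \<Rightarrow> (nat \<Rightarrow> tile) set" where
  "columns n = {f. \<forall>i\<ge>n. f i = Bu}"

text \<open>Column \<open>k\<close> has \<open>n - 1 - k\<close> free tiles; the bumps on the
  antidiagonal \<open>k + i = n - 1\<close> already belong to the padding.\<close>

definition dreams :: "nat \<Rightarrow> (nat \<Rightarrow> nat \<Rightarrow> tile) set" where
  "dreams n = {g. \<forall>k i. n \<le> Suc (k + i) \<longrightarrow> g k i = Bu}"

definition col_marks :: "(nat \<Rightarrow> tile) \<Rightarrow> nat" where
  "col_marks f = card {i. f i = Mk}"

definition marks :: "(nat \<Rightarrow> nat \<Rightarrow> tile) \<Rightarrow> nat" where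
  "marks g = card {(k, i). g k i = Mk}"

lemma length_col_out [simp]: "length (col_out p u f) = Suc (length u)"
  by (induction u arbitrary: p f) auto

lemma length_dream_out [simp]: "length (dream_out xs g) = length xs"
  by (induction xs arbitrary: g) auto

lemma set_col_out: "set (col_out p u f) = insert p (set u)"
  by (induction u arbitrary: p f) auto

lemma set_dream_out: "set (dream_out xs g) = set xs"
  by (induction xs arbitrary: g) (auto simp: set_col_out)

lemma case_nat_comp_Suc [simp]: "case_nat a f \<circ> Suc = f"
  by (rule ext) simp

lemma case_nat_0_Suc [simp]: "case_nat (f 0) (f \<circ> Suc) = f"
  by (rule ext) (simp split: nat.split)

lemma UNIV_tile: "(UNIV :: tile set) = {Cr, Bu, Mk}"
  using tile.exhaust by auto

lemma sum_columns_0: "sum W (columns 0) = W (\<lambda>_. Bu)"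
proof -
  have "columns 0 = {\<lambda>_. Bu}" by (auto simp: columns_def)
  then show ?thesis by simp
qed

lemma bij_columns_Suc:
  "bij_betw (\<lambda>(t, f). case_nat t f) (UNIV \<times> columns n) (columns (Suc n))"
  by (rule bij_betw_byWitness[of _ "\<lambda>f. (f 0, f \<circ> Suc)"])
     (auto simp: columns_def split: nat.split)

lemma bij_dreams_Suc:
  "bij_betw (\<lambda>(f, g). case_nat f g) (columns n \<times> dreams n) (dreams (Suc n))"
  by (rule bij_betw_byWitness[of _ "\<lambda>g. (g 0, g \<circ> Suc)"])
     (auto simp: columns_def dreams_def split: nat.split)

lemma finite_columns: "finite (columns n)"
proof (induction n)
  case 0
  have "columns 0 = {\<lambda>_. Bu}" by (auto simp: columns_def)
  then show ?case by simp
next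
  case (Suc n)
  have "finite (UNIV :: tile set)" by (simp add: UNIV_tile)
  then show ?case using bij_betw_finite[OF bij_columns_Suc] Suc by blast
qed

lemma dreams_0: "dreams 0 = {\<lambda>_ _. Bu}"
  by (auto simp: dreams_def)

lemma finite_dreams: "finite (dreams n)"
proof (induction n)
  case (Suc n)
  then show ?case using bij_betw_finite[OF bij_dreams_Suc] finite_columns by blast
qed (simp add: dreams_0)

lemma sum_columns_Suc:
  "(\<Sum>f\<in>columns (Suc n). W f) = (\<Sum>f\<in>columns n. W (case_nat Cr f)) +
     (\<Sum>f\<in>columns n. W (case_nat Bu f)) + (\<Sum>f\<in>columns n. W (case_nat Mk f))"
  for W :: "(nat \<Rightarrow> tile) \<Rightarrow> 'b::comm_monoid_add"
proof -
  have "(\<Sum>f\<in>columns (Suc n). W f) = (\<Sum>(t, f)\<in>UNIV \<times> columns n. W (case_nat t f))"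
    by (subst sum.reindex_bij_betw[OF bij_columns_Suc, symmetric]) (simp add: case_prod_beta)
  also have "\<dots> = (\<Sum>t\<in>UNIV. \<Sum>f\<in>columns n. W (case_nat t f))"
    by (simp add: sum.cartesian_product)
  finally show ?thesis by (simp add: UNIV_tile add.assoc)
qed

lemma sum_dreams_Suc:
  "(\<Sum>g\<in>dreams (Suc n). W g) = (\<Sum>g\<in>dreams n. \<Sum>f\<in>columns n. W (case_nat f g))"
  for W :: "(nat \<Rightarrow> nat \<Rightarrow> tile) \<Rightarrow> 'b::comm_monoid_add"
proof -
  have "(\<Sum>g\<in>dreams (Suc n). W g) = (\<Sum>(f, g)\<in>columns n \<times> dreams n. W (case_nat f g))"
    by (subst sum.reindex_bij_betw[OF bij_dreams_Suc, symmetric]) (simp add: case_prod_beta)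
  also have "\<dots> = (\<Sum>f\<in>columns n. \<Sum>g\<in>dreams n. W (case_nat f g))"
    by (simp add: sum.cartesian_product)
  finally show ?thesis by (simp add: sum.swap[of _ "dreams n"])
qed

lemma finite_col_marks:
  assumes "f \<in> columns n"
  shows "finite {i. f i = Mk}"
proof (rule finite_subset)
  have "i < n" if "f i = Mk" for i
    using that assms by (cases "i < n") (auto simp: columns_def)
  then show "{i. f i = Mk} \<subseteq> {..<n}" by auto
qed simp

lemma col_marks_case:
  assumes "f \<in> columns n"
  shows "col_marks (case_nat t f) = (if t = Mk then 1 else 0) + col_marks f"
proof -
  note fin = finite_col_marks[OF assms]
  have "{i. case_nat t f i = Mk} = (if t = Mk then {0} else {}) \<union> Suc ` {i. f i = Mk}"
  proof (rule set_eqI)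
    fix i show "i \<in> {i. case_nat t f i = Mk} \<longleftrightarrow> i \<in> (if t = Mk then {0} else {}) \<union> Suc ` {i. f i = Mk}"
      by (cases i) auto
  qed
  then show ?thesis
    using fin by (simp add: col_marks_def card_image card_insert_if)
qed

lemma finite_marks:
  assumes "g \<in> dreams n"
  shows "finite {(k, i). g k i = Mk}"
proof (rule finite_subset)
  have "k < n \<and> i < n" if "g k i = Mk" for k i
    using that assms by (cases "n \<le> Suc (k + i)") (auto simp: dreams_def)
  then show "{(k, i). g k i = Mk} \<subseteq> {..<n} \<times> {..<n}" by auto
qed simp

lemma marks_case:
  assumes "f \<in> columns n" "g \<in> dreams n"
  shows "marks (case_nat f g) = col_marks f + marks g"
proof -
  note fin = finite_col_marks[OF assms(1)]
  have *: "{(k, i). case_nat f g k i = Mk} =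
      Pair 0 ` {i. f i = Mk} \<union> (\<lambda>(k, i). (Suc k, i)) ` {(k, i). g k i = Mk}"
    by (auto split: nat.splits simp: image_iff)
  have "inj_on (\<lambda>(k, i). (Suc k, i)) {(k, i). g k i = Mk}" by (auto simp: inj_on_def)
  then show ?thesis
    unfolding marks_def col_marks_def *
    using fin finite_marks[OF assms(2)]
    by (subst card_Un_disjoint) (auto simp: card_image inj_on_def)
qed

section \<open>Reordering the factors by columns at x = 1\<close>

definition hecke_word :: "'b::comm_ring_1 \<Rightarrow> nat list \<Rightarrow> (nat list \<Rightarrow> 'b) \<Rightarrow> nat list \<Rightarrow> 'b" where
  "hecke_word \<beta> ps F = fold (\<lambda>p. hecke_h \<beta> p 1) ps F"

lemma hecke_word_append: "hecke_word \<beta> (ps @ qs) F = hecke_word \<beta> qs (hecke_word \<beta> ps F)"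
  by (simp add: hecke_word_def)

lemma hecke_word_Nil [simp]: "hecke_word \<beta> [] F = F"
  by (simp add: hecke_word_def)

lemma hecke_word_Cons: "hecke_word \<beta> (p # ps) F = hecke_word \<beta> ps (hecke_h \<beta> p 1 F)"
  by (simp add: hecke_word_def)

lemma hecke_word_commute:
  "\<forall>q\<in>set qs. Suc p < q \<Longrightarrow> hecke_word \<beta> (p # qs) F = hecke_word \<beta> (qs @ [p]) F"
proof (induction qs arbitrary: F)
  case (Cons q qs)
  have "hecke_word \<beta> (p # q # qs) F = hecke_word \<beta> (p # qs) (hecke_h \<beta> q 1 F)"
    using Cons.prems by (simp add: hecke_word_Cons hecke_h_commute)
  then show ?case using Cons by (simp add: hecke_word_Cons hecke_word_append)
qed simp

lemma hecke_word_add: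
  "hecke_word \<beta> ps (\<lambda>v. F v + G v) w = hecke_word \<beta> ps F w + hecke_word \<beta> ps G w"
proof (induction ps arbitrary: F G)
  case (Cons p ps)
  have "hecke_h \<beta> p 1 (\<lambda>v. F v + G v) = (\<lambda>v. hecke_h \<beta> p 1 F v + hecke_h \<beta> p 1 G v)"
    by (rule ext) (simp add: hecke_h_def hecke_u_add algebra_simps)
  then show ?case using Cons by (simp add: hecke_word_Cons)
qed simp

lemma hecke_word_mult: "hecke_word \<beta> ps (\<lambda>v. c * F v) w = c * hecke_word \<beta> ps F w"
proof (induction ps arbitrary: F)
  case (Cons p ps)
  have "hecke_h \<beta> p 1 (\<lambda>v. c * F v) = (\<lambda>v. c * hecke_h \<beta> p 1 F v)"
    by (rule ext) (simp add: hecke_h_def hecke_u_mult algebra_simps)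
  then show ?case using Cons by (simp add: hecke_word_Cons)
qed simp

lemma hecke_word_zero: "hecke_word \<beta> ps (\<lambda>v. 0) w = 0"
  using hecke_word_mult[of \<beta> ps 0 "\<lambda>_. 0" w] by simp

lemma hecke_word_sum:
  "finite S \<Longrightarrow> hecke_word \<beta> ps (\<lambda>v. \<Sum>s\<in>S. F s v) w = (\<Sum>s\<in>S. hecke_word \<beta> ps (F s) w)"
  by (induction S rule: finite_induct) (simp_all add: hecke_word_add hecke_word_zero)

definition row_word :: "nat \<Rightarrow> nat \<Rightarrow> nat list" where
  "row_word N i = concat (map (\<lambda>i. rev [i..<N]) [i..<Suc N])"

definition col_word :: "nat \<Rightarrow> nat \<Rightarrow> nat list" where
  "col_word N i = concat (map (\<lambda>k. [k..<N]) (rev [i..<Suc N]))"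

lemma row_word_rec: "i \<le> N \<Longrightarrow> row_word N i = rev [i..<N] @ row_word N (Suc i)"
  by (simp add: row_word_def upt_conv_Cons del: upt_Suc)

lemma col_word_rec: "i \<le> N \<Longrightarrow> col_word N i = col_word N (Suc i) @ [i..<N]"
  by (simp add: col_word_def upt_conv_Cons del: upt_Suc)

lemma set_col_word: "q \<in> set (col_word N i) \<Longrightarrow> i \<le> q"
  by (auto simp: col_word_def)

text \<open>Only distant factors are exchanged: the letter \<open>i\<close> ending the first row
  commutes with \<open>col_word N (Suc (Suc i))\<close>, whose letters are at least
  \<open>i + 2\<close>, and then opens the last column. Rows are turned into columns and back for
  both \<open>i + 1\<close> and \<open>i + 2\<close>, hence the strong induction.\<close>

lemma hecke_row_word_eq_col_word: "hecke_word \<beta> (row_word N i) F = hecke_word \<beta> (col_word N i) F"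
proof (induction "Suc N - i" arbitrary: i F rule: less_induct)
  case less
  show ?case
  proof (cases "i < N")
    case False
    then show ?thesis by (cases "i = N") (simp_all add: row_word_def col_word_def)
  next
    case True
    have 1: "hecke_word \<beta> (row_word N (Suc i)) F = hecke_word \<beta> (col_word N (Suc i)) F" for F
      using True by (intro less) auto
    have 2: "hecke_word \<beta> (row_word N (Suc (Suc i))) F = hecke_word \<beta> (col_word N (Suc (Suc i))) F" for F
      using True by (intro less) auto
    have comm: "hecke_word \<beta> (i # col_word N (Suc (Suc i))) F =
        hecke_word \<beta> (col_word N (Suc (Suc i)) @ [i]) F" for F
      by (rule hecke_word_commute) (auto dest: set_col_word)
    have upt: "[i..<N] = i # [Suc i..<N]" using True by (simp add: upt_conv_Cons)
    have "hecke_word \<beta> (row_word N i) F = hecke_word \<beta> (rev [i..<N] @ col_word N (Suc i)) F"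
      using True by (simp add: row_word_rec[of i] hecke_word_append 1)
    also have "\<dots> = hecke_word \<beta> ((rev [Suc i..<N] @ (i # col_word N (Suc (Suc i)))) @ [Suc i..<N]) F"
      using True by (simp add: upt col_word_rec[of "Suc i"])
    also have "\<dots> = hecke_word \<beta> ((rev [Suc i..<N] @ col_word N (Suc (Suc i))) @ [i..<N]) F"
      unfolding hecke_word_append comm by (simp add: hecke_word_append hecke_word_Cons upt)
    also have "\<dots> = hecke_word \<beta> (row_word N (Suc i) @ [i..<N]) F"
      using True by (simp add: hecke_word_append row_word_rec[of "Suc i"] 2)
    also have "\<dots> = hecke_word \<beta> (col_word N i) F"
      using True by (simp add: hecke_word_append col_word_rec[of i] 1)
    finally show ?thesis .
  qed
qed

definition delta :: "nat list \<Rightarrow> nat list \<Rightarrow> 'b::comm_ring_1" where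
  "delta L v = (if v = L then 1 else 0)"

text \<open>The summands are the choices at one tile: an unmarked bump, a crossing if
  \<open>x < y\<close>, a marked bump if \<open>y < x\<close>. The bracketing separates the pipes
  that have left the column from the one now coming from above.\<close>

lemma hecke_h_delta:
  assumes "length a = p"
  shows "hecke_h \<beta> p 1 (delta (a @ x # y # u)) v = delta ((a @ [x]) @ y # u) v +
     (if x < y then delta ((a @ [y]) @ x # u) v
      else if y < x then \<beta> * delta ((a @ [x]) @ y # u) v else 0)"
proof (cases "Suc p < length v")
  case True
  then obtain c z z' b where v: "v = c @ z # z' # b" and c: "length c = p"
    by (rule list_split_two_ex)
  have u: "hecke_u \<beta> p F v = (if z' < z then F (c @ z' # z # b) + \<beta> * F v else 0)" for F
    unfolding v c[symmetric] by (rule hecke_u_append)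
  have eq: "c @ r = a @ s \<longleftrightarrow> c = a \<and> r = s" for r s :: "nat list"
    using assms c by simp
  show ?thesis
    unfolding hecke_h_def u unfolding v delta_def by (auto simp: eq)
next
  case False
  then have "v \<noteq> a @ z # z' # u" for z z'
    using assms by force
  moreover have "hecke_u \<beta> p F v = 0" for F :: "nat list \<Rightarrow> 'a"
    using False by (intro hecke_u_short) simp
  ultimately show ?thesis by (simp add: hecke_h_def delta_def)
qed

lemma hecke_column:
  assumes "length a = p"
  shows "hecke_word \<beta> [p..<p + length u] (delta (a @ x # u)) v =
    (\<Sum>f\<in>columns (length u). if col_valid x u f then \<beta> ^ col_marks f * delta (a @ col_out x u f) v else 0)"
  using assms
proof (induction u arbitrary: a p x)
  case Nil
  then show ?case by (simp add: sum_columns_0 col_marks_def)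
next
  case (Cons y u)
  let ?S = "\<lambda>a x v. \<Sum>f\<in>columns (length u). if col_valid x u f then \<beta> ^ col_marks f * delta (a @ col_out x u f) v else 0"
  have IH: "hecke_word \<beta> [Suc p..<p + length (y # u)] (delta ((a @ [z]) @ x # u)) v = ?S (a @ [z]) x v" for z x
    using Cons.IH[of "a @ [z]" "Suc p" x] Cons.prems by simp
  have "hecke_word \<beta> [p..<p + length (y # u)] (delta (a @ x # y # u)) v =
      hecke_word \<beta> [Suc p..<p + length (y # u)] (hecke_h \<beta> p 1 (delta (a @ x # y # u))) v"
    by (simp add: upt_conv_Cons hecke_word_Cons del: upt_Suc)
  also have "\<dots> = ?S (a @ [x]) y v + (if x < y then ?S (a @ [y]) x v else 0)
     + (if y < x then \<beta> * ?S (a @ [x]) y v else 0)"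
    using IH unfolding hecke_h_delta[OF Cons.prems, abs_def] hecke_word_add
    by (auto simp: hecke_word_mult hecke_word_zero)
  also have "\<dots> = (\<Sum>f\<in>columns (length (y # u)). if col_valid x (y # u) f
       then \<beta> ^ col_marks f * delta (a @ col_out x (y # u) f) v else 0)"
    by (simp add: sum_columns_Suc col_marks_case sum_distrib_left if_distrib mult.assoc cong: if_cong)
  finally show ?case .
qed

text \<open>Columns are read from right to left. The pipes \<open>1, ..., i\<close>, which start
  further left, are still an untouched prefix, so in the column now added the factor at position
  \<open>i + r\<close> acts on row \<open>r\<close>.\<close>

lemma col_word_dreams:
  assumes "i \<le> N"
  shows "hecke_word \<beta> (col_word N i) (delta [1..<Suc (Suc N)]) v =
    (\<Sum>g\<in>dreams (Suc N - i). if dream_valid [Suc i..<Suc (Suc N)] g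
       then \<beta> ^ marks g * delta ([1..<Suc i] @ dream_out [Suc i..<Suc (Suc N)] g) v else 0)"
  using assms
proof (induction "N - i" arbitrary: i v)
  case 0
  have "dreams (Suc 0) = {\<lambda>_ _. Bu}" by (auto simp: dreams_def)
  then show ?case using 0 by (simp add: col_word_def marks_def)
next
  case (Suc m)
  define xs where "xs = [Suc (Suc i)..<Suc (Suc N)]"
  have len: "length xs = N - i" "Suc N - Suc i = N - i" "Suc N - i = Suc (N - i)"
    using Suc by (auto simp: xs_def)
  have i: "i + (N - i) = N" using Suc by simp
  have upt: "[Suc i..<Suc (Suc N)] = Suc i # xs"
    using Suc by (simp add: xs_def upt_conv_Cons del: upt_Suc)
  have upt': "[1..<Suc (Suc i)] = [1..<Suc i] @ [Suc i]" by simp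
  have IH: "hecke_word \<beta> (col_word N (Suc i)) (delta [1..<Suc (Suc N)]) =
      (\<lambda>v. \<Sum>g\<in>dreams (N - i). if dream_valid xs g
         then \<beta> ^ marks g * delta ([1..<Suc i] @ Suc i # dream_out xs g) v else 0)"
    using Suc.hyps(1)[of "Suc i"] Suc.hyps(2) Suc.prems unfolding len(2) xs_def[symmetric] upt'
    by (simp add: fun_eq_iff cong: if_cong del: upt_Suc)
  have "hecke_word \<beta> (col_word N i) (delta [1..<Suc (Suc N)]) v =
      (\<Sum>g\<in>dreams (N - i). if dream_valid xs g then \<beta> ^ marks g *
        hecke_word \<beta> [i..<N] (delta ([1..<Suc i] @ Suc i # dream_out xs g)) v else 0)"
    unfolding col_word_rec[OF Suc.prems] hecke_word_append IH
    by (subst hecke_word_sum[OF finite_dreams])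
       (intro sum.cong refl, simp add: hecke_word_mult hecke_word_zero)
  also have "\<dots> = (\<Sum>g\<in>dreams (N - i). if dream_valid xs g then \<beta> ^ marks g *
       (\<Sum>f\<in>columns (N - i). if col_valid (Suc i) (dream_out xs g) f
          then \<beta> ^ col_marks f * delta ([1..<Suc i] @ col_out (Suc i) (dream_out xs g) f) v else 0) else 0)"
  proof -
    have "hecke_word \<beta> [i..<N] (delta ([1..<Suc i] @ Suc i # dream_out xs g)) v =
       (\<Sum>f\<in>columns (N - i). if col_valid (Suc i) (dream_out xs g) f
          then \<beta> ^ col_marks f * delta ([1..<Suc i] @ col_out (Suc i) (dream_out xs g) f) v else 0)" for g
      using hecke_column[of "[1..<Suc i]" i \<beta> "dream_out xs g" "Suc i" v]
      unfolding length_dream_out len(1) i by (simp only: length_upt diff_Suc_1)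
    then show ?thesis by (simp only:)
  qed
  also have "\<dots> = (\<Sum>g\<in>dreams (Suc (N - i)). if dream_valid (Suc i # xs) g
       then \<beta> ^ marks g * delta ([1..<Suc i] @ dream_out (Suc i # xs) g) v else 0)"
    unfolding sum_dreams_Suc
    by (intro sum.cong refl) (auto simp: marks_case sum_distrib_left power_add mult_ac intro!: sum.cong)
  finally show ?case unfolding upt len .
qed

lemma hecke_groth_ones:
  "hecke_groth N \<beta> (\<lambda>_. 1) w =
    (\<Sum>g | g \<in> dreams (Suc N) \<and> dream_valid [1..<Suc (Suc N)] g \<and> dream_out [1..<Suc (Suc N)] g = w. \<beta> ^ marks g)"
proof -
  have "fold (\<lambda>i. hecke_row N \<beta> i 1) is F = hecke_word \<beta> (concat (map (\<lambda>i. rev [i..<N]) is)) F" for "is" F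
    by (induction "is" arbitrary: F) (simp_all add: hecke_row_def hecke_word_append, simp add: hecke_word_def)
  then have "hecke_groth N \<beta> (\<lambda>_. 1) w = hecke_word \<beta> (col_word N 0) (delta [1..<Suc (Suc N)]) w"
    unfolding hecke_row_word_eq_col_word[symmetric] hecke_groth_def row_word_def
    by (simp add: delta_def[abs_def] del: upt_Suc)
  also have "\<dots> = (\<Sum>g\<in>dreams (Suc N). if dream_valid [1..<Suc (Suc N)] g
       then \<beta> ^ marks g * delta (dream_out [1..<Suc (Suc N)] g) w else 0)"
  proof -
    have "[1..<Suc 0] = []" by simp
    then show ?thesis using col_word_dreams[of 0 N \<beta> w] unfolding One_nat_def
      by (simp cong: if_cong del: upt_Suc)
  qed
  also have "\<dots> = (\<Sum>g\<in>dreams (Suc N). if dream_valid [1..<Suc (Suc N)] g \<and> dream_out [1..<Suc (Suc N)] g = w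
       then \<beta> ^ marks g else 0)"
    by (intro sum.cong refl) (auto simp: delta_def)
  finally show ?thesis by (simp add: sum.If_cases finite_dreams Int_def del: upt_Suc)
qed

section \<open>Grothendieck polynomials\<close>

lemma mpoly_induct [case_names single add]:
  fixes f :: "'k \<Rightarrow>\<^sub>0 'b::comm_monoid_add"
  assumes "\<And>m c. P (Poly_Mapping.single m c)"
    and "\<And>f g. P f \<Longrightarrow> P g \<Longrightarrow> P (f + g)"
  shows "P f"
proof (induction f rule: update_induct)
  case const
  then show ?case using assms(1)[of undefined 0] by simp
next
  case (update f a b)
  have "Poly_Mapping.update a b f = f + Poly_Mapping.single a b"
    using update(1) by (intro poly_mapping_eqI)
      (auto simp: lookup_update lookup_add lookup_single when_def in_keys_iff)
  then show ?case using assms update by simp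
qed

lemma lookup_mult_single_shift:
  fixes f :: "'a::comm_ring_1 mpoly"
  shows "Poly_Mapping.lookup (f * Poly_Mapping.single e c) (m + e) = Poly_Mapping.lookup f m * c"
proof (induction f rule: mpoly_induct)
  case (single m' d)
  then show ?case by (simp add: mult_single lookup_single when_def)
next
  case (add f g)
  then show ?case by (simp add: lookup_add algebra_simps)
qed

lemma lookup_mult_single_zero:
  fixes f :: "'a::comm_ring_1 mpoly"
  assumes "\<And>m'. m \<noteq> m' + e"
  shows "Poly_Mapping.lookup (f * Poly_Mapping.single e c) m = 0"
proof (induction f rule: mpoly_induct)
  case (single m' d)
  then show ?case using assms[of m'] by (simp add: mult_single lookup_single when_def)
next
  case (add f g)
  then show ?case by (simp add: lookup_add algebra_simps)
qed

text \<open>The ring may have zero divisors, so coefficients are compared: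
  \<open>f x_i = f x_(i+1)\<close> equates the coefficient at \<open>m\<close> with the one at
  \<open>m x_i / x_(i+1)\<close>. Each shift lowers the exponent of \<open>x_(i+1)\<close>, and at
  exponent 0 the coefficient vanishes. This makes the description in \<open>ddiff\<close>
  unique.\<close>

lemma X_diff_not_zero_divisor:
  fixes f :: "'a::comm_ring_1 mpoly"
  assumes "f * (X i - X (Suc i)) = 0"
  shows "f = 0"
proof -
  define e :: "nat \<Rightarrow>\<^sub>0 nat" where "e = Poly_Mapping.single i 1"
  define e' :: "nat \<Rightarrow>\<^sub>0 nat" where "e' = Poly_Mapping.single (Suc i) 1"
  have eq: "f * Poly_Mapping.single e 1 = f * Poly_Mapping.single e' 1"
    using assms by (simp add: X_def e_def e'_def algebra_simps)
  have "Poly_Mapping.lookup f m = 0" for m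
  proof (induction "Poly_Mapping.lookup m (Suc i)" arbitrary: m)
    case 0
    have "m + e \<noteq> m' + e'" for m'
    proof
      assume "m + e = m' + e'"
      then have "Poly_Mapping.lookup (m + e) (Suc i) = Poly_Mapping.lookup (m' + e') (Suc i)" by simp
      then show False using 0 by (simp add: lookup_add e_def e'_def lookup_single)
    qed
    then have "Poly_Mapping.lookup (f * Poly_Mapping.single e' 1) (m + e) = 0"
      by (rule lookup_mult_single_zero)
    then show ?case
      using lookup_mult_single_shift[of f e 1 m] eq by simp
  next
    case (Suc k)
    define m' where "m' = m - e' + e"
    have "m + e = m' + e'"
      using Suc(2) by (intro poly_mapping_eqI)
        (auto simp: m'_def e_def e'_def lookup_add lookup_minus lookup_single when_def)
    moreover have "k = Poly_Mapping.lookup m' (Suc i)"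
      using Suc(2) by (simp add: m'_def e_def e'_def lookup_add lookup_minus lookup_single when_def)
    ultimately show ?case
      using Suc(1)[of m'] lookup_mult_single_shift[of f e 1 m] lookup_mult_single_shift[of f e' 1 m'] eq
      by simp
  qed
  then show ?thesis by (intro poly_mapping_eqI) simp
qed

lemma ddiff_eqI:
  assumes "g * (X i - X (Suc i)) = f - swap_poly i f"
  shows "ddiff i f = g"
  unfolding ddiff_def
proof (rule the_equality)
  show "g * (X i - X (Suc i)) = f - swap_poly i f" by (rule assms)
next
  fix h assume "h * (X i - X (Suc i)) = f - swap_poly i f"
  then have "(h - g) * (X i - X (Suc i)) = 0"
    using assms by (simp add: left_diff_distrib)
  then show "h = g" using X_diff_not_zero_divisor by force
qed

lemma swp_swp [simp]: "swp i (swp i v) = v"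
  by (auto simp: swp_def)

lemma inj_swp: "inj (swp i)"
  by (metis injI swp_swp)

lemma swap_mono_map_key: "swap_mono i = Poly_Mapping.map_key (swp i)"
  by (rule ext) (simp add: swap_mono_def Poly_Mapping.map_key_def[OF inj_swp] comp_def)

lemma swap_mono_swap_mono [simp]: "swap_mono i (swap_mono i m) = m"
  by (simp add: swap_mono_map_key Poly_Mapping.map_key_compose[OF inj_swp inj_swp] comp_def Poly_Mapping.map_key_id)

lemma inj_swap_mono: "inj (swap_mono i)"
  by (metis injI swap_mono_swap_mono)

lemma swap_poly_map_key: "swap_poly i = Poly_Mapping.map_key (swap_mono i)"
  by (rule ext) (simp add: swap_poly_def Poly_Mapping.map_key_def[OF inj_swap_mono] comp_def)

lemma swap_poly_single: "swap_poly i (Poly_Mapping.single m c) = Poly_Mapping.single (swap_mono i m) c"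
  using Poly_Mapping.map_key_single[OF inj_swap_mono, of i "swap_mono i m" c]
  by (simp add: swap_poly_map_key)

lemma swap_mono_add: "swap_mono i (m + m') = swap_mono i m + swap_mono i m'"
  by (simp add: swap_mono_map_key Poly_Mapping.map_key_plus[OF inj_swp])

lemma swap_mono_single: "swap_mono i (Poly_Mapping.single v c) = Poly_Mapping.single (swp i v) c"
  using Poly_Mapping.map_key_single[OF inj_swp, of i "swp i v" c] by (simp add: swap_mono_map_key)

section \<open>Transport along ring homomorphisms\<close>

definition ring_hom :: "('b::comm_ring_1 \<Rightarrow> 'c::comm_ring_1) \<Rightarrow> bool" where
  "ring_hom \<phi> \<longleftrightarrow> \<phi> 1 = 1 \<and> (\<forall>x y. \<phi> (x + y) = \<phi> x + \<phi> y) \<and> (\<forall>x y. \<phi> (x * y) = \<phi> x * \<phi> y)"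

lemma ring_hom_zero: "ring_hom \<phi> \<Longrightarrow> \<phi> 0 = 0"
  unfolding ring_hom_def by (metis add_cancel_right_right add_0)

lemma ring_hom_mpolyI:
  fixes \<phi> :: "'a::comm_ring_1 mpoly \<Rightarrow> 'b::comm_ring_1"
  assumes "\<phi> 1 = 1" and add: "\<And>f g. \<phi> (f + g) = \<phi> f + \<phi> g"
    and single: "\<And>m m' c c'. \<phi> (Poly_Mapping.single (m + m') (c * c')) =
      \<phi> (Poly_Mapping.single m c) * \<phi> (Poly_Mapping.single m' c')"
  shows "ring_hom \<phi>"
proof -
  have "\<phi> (f * g) = \<phi> f * \<phi> g" for f g
  proof (induction f rule: mpoly_induct)
    case (single m c)
    show ?case
      by (induction g rule: mpoly_induct) (simp_all add: mult_single assms distrib_left)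
  qed (simp add: add distrib_right)
  then show ?thesis using assms by (simp add: ring_hom_def)
qed

lemma ring_hom_swap_poly: "ring_hom (swap_poly i :: 'a::comm_ring_1 mpoly \<Rightarrow> _)"
proof (rule ring_hom_mpolyI)
  have "swap_mono i 0 = 0" by (simp add: swap_mono_map_key inj_swp)
  then show "swap_poly i 1 = (1 :: 'a mpoly)"
    using swap_poly_single[of i 0 "1::'a"] by simp
qed (simp_all add: swap_poly_single swap_mono_add mult_single,
     simp add: swap_poly_map_key Poly_Mapping.map_key_plus[OF inj_swap_mono])

lemma eval_ones_superset:
  "finite A \<Longrightarrow> Poly_Mapping.keys p \<subseteq> A \<Longrightarrow> eval_ones p = (\<Sum>m\<in>A. Poly_Mapping.lookup p m)"
  unfolding eval_ones_def by (rule sum.mono_neutral_left) (auto simp: in_keys_iff)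

lemma eval_ones_single: "eval_ones (Poly_Mapping.single m c) = c"
  by (simp add: eval_ones_superset[of "{m}"])

lemma ring_hom_eval_ones: "ring_hom (eval_ones :: 'a::comm_ring_1 mpoly \<Rightarrow> 'a)"
proof (rule ring_hom_mpolyI)
  show "eval_ones 1 = (1::'a)" using eval_ones_single[of 0 "1::'a"] by simp
  fix f g :: "'a mpoly"
  let ?A = "Poly_Mapping.keys f \<union> Poly_Mapping.keys g"
  have "eval_ones (f + g) = (\<Sum>m\<in>?A. Poly_Mapping.lookup (f + g) m)"
    by (rule eval_ones_superset) (auto simp: keys_add)
  then show "eval_ones (f + g) = eval_ones f + eval_ones g"
    by (simp add: eval_ones_superset[of ?A] lookup_add sum.distrib)
qed (simp add: eval_ones_single)

lemma hecke_row_hom: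
  assumes "ring_hom \<phi>" "\<And>v. \<phi> (F v) = F' v"
  shows "\<phi> (hecke_row N \<beta> i x F v) = hecke_row N (\<phi> \<beta>) i (\<phi> x) F' v"
proof -
  have "\<phi> (fold (\<lambda>p. hecke_h \<beta> p x) ps F v) = fold (\<lambda>p. hecke_h (\<phi> \<beta>) p (\<phi> x)) ps F' v" for ps
    using assms(2)
  proof (induction ps arbitrary: F F')
    case (Cons p ps)
    have "\<phi> (hecke_h \<beta> p x F v) = hecke_h (\<phi> \<beta>) p (\<phi> x) F' v" for v
      using assms(1) ring_hom_zero[OF assms(1)] Cons.prems
      by (simp add: hecke_h_def hecke_u_def ring_hom_def)
    then show ?case using Cons.IH by simp
  qed simp
  then show ?thesis by (simp add: hecke_row_def)
qed

text \<open>Needed for two homomorphisms: \<open>swap_poly i\<close>, which exchanges two variables,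
  and \<open>eval_ones\<close>, which sets all of them to 1.\<close>

lemma hecke_groth_hom:
  assumes "ring_hom \<phi>"
  shows "\<phi> (hecke_groth N \<beta> xs v) = hecke_groth N (\<phi> \<beta>) (\<phi> \<circ> xs) v"
proof -
  have 1: "\<phi> (fold (\<lambda>i. hecke_row N \<beta> i (xs (Suc i))) is F v) =
     fold (\<lambda>i. hecke_row N (\<phi> \<beta>) i ((\<phi> \<circ> xs) (Suc i))) is F' v"
    if "\<And>v. \<phi> (F v) = F' v" for "is" F F'
    using that
  proof (induction "is" arbitrary: F F')
    case (Cons i "is")
    show ?case using Cons.IH hecke_row_hom[OF assms Cons.prems] by simp
  qed simp
  have 2: "\<phi> (if v = [1..<Suc (Suc N)] then 1 else 0) = (if v = [1..<Suc (Suc N)] then 1 else 0)" for v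
    using assms ring_hom_zero[OF assms] by (simp add: ring_hom_def)
  show ?thesis unfolding hecke_groth_def by (rule 1) (rule 2)
qed

section \<open>Inversions and the coefficient of the longest permutation\<close>

primrec pair_count :: "('c \<Rightarrow> 'c \<Rightarrow> bool) \<Rightarrow> 'c list \<Rightarrow> nat" where
  "pair_count R [] = 0"
| "pair_count R (x # xs) = length (filter (R x) xs) + pair_count R xs"

lemma pair_count_swap:
  assumes "R x y" "\<not> R y x"
  shows "pair_count R (a @ x # y # b) = Suc (pair_count R (a @ y # x # b))"
  by (induction a) (use assms in auto)

lemma pair_count_le: "pair_count R w \<le> length w * length w"
proof (induction w)
  case (Cons x w)
  show ?case using Cons length_filter_le[of "R x" w] by (simp del: length_filter_le)
qed simp

lemma pair_count_swapl:
  assumes "Suc p < length v" "R (v ! p) (v ! Suc p)" "\<not> R (v ! Suc p) (v ! p)"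
  shows "pair_count R v = Suc (pair_count R (swapl p v))"
proof -
  obtain a b where v: "v = a @ v ! p # v ! Suc p # b" "length a = p"
    using list_split_two[OF assms(1)] by blast
  have "swapl p v = a @ v ! Suc p # v ! p # b"
    using swapl_append[of a "v ! p" "v ! Suc p" b] v by metis
  then show ?thesis using pair_count_swap[of R, OF assms(2,3), of a b] v by metis
qed

abbreviation "inversions \<equiv> pair_count (\<lambda>x y::nat. y < x)"

lemma hecke_h_support:
  assumes "\<And>v. t < inversions v \<Longrightarrow> F v = 0" "Suc t < inversions v"
  shows "hecke_h \<beta> p x F v = 0"
proof (cases "Suc p < length v \<and> v ! Suc p < v ! p")
  case True
  then have "inversions v = Suc (inversions (swapl p v))"
    by (intro pair_count_swapl) auto
  then show ?thesis using assms by (simp add: hecke_h_def hecke_u_def)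
qed (use assms in \<open>auto simp: hecke_h_def hecke_u_def\<close>)

lemma hecke_row_support:
  assumes "\<And>v. t < inversions v \<Longrightarrow> F v = 0" "t + (N - i) < inversions v"
  shows "hecke_row N \<beta> i x F v = 0"
  using assms(2)
proof (induction "N - i" arbitrary: i v)
  case 0
  then show ?case using assms(1) by (simp add: hecke_row_empty)
next
  case (Suc k)
  then have i: "i < N" "k = N - Suc i" by auto
  have "hecke_h \<beta> i x (hecke_row N \<beta> (Suc i) x F) v = 0"
  proof (rule hecke_h_support)
    show "hecke_row N \<beta> (Suc i) x F v = 0" if "t + k < inversions v" for v
      using Suc.hyps(1)[of "Suc i" v] i that by simp
    show "Suc (t + k) < inversions v" using Suc.prems Suc.hyps(2) by simp
  qed
  then show ?case using i by (simp add: hecke_row_rec)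
qed

text \<open>A factor adds at most one inversion, so the extreme count \<open>t + (N - i)\<close> is
  reached only if every factor of the row acts through its swap. Together they carry
  \<open>z\<close> from the end to position \<open>i\<close>, each contributing one
  \<open>x\<close>; all other terms vanish by \<open>hecke_row_support\<close>.\<close>

lemma hecke_row_top:
  assumes "\<And>v. t < inversions v \<Longrightarrow> F v = 0"
    and "length a = i" "length ys = N - i" "i \<le> N" "\<forall>y\<in>set ys. y < z"
    and "inversions (a @ z # ys) = t + (N - i)"
  shows "hecke_row N \<beta> i x F (a @ z # ys) = x ^ (N - i) * F (a @ ys @ [z])"
  using assms(2-)
proof (induction ys arbitrary: a i)
  case Nil
  then show ?case by (simp add: hecke_row_empty)
next
  case (Cons y ys)
  let ?G = "hecke_row N \<beta> (Suc i) x F"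
  have i: "i < N" using Cons.prems by auto
  have inv: "inversions (a @ z # y # ys) = Suc (inversions (a @ y # z # ys))"
    using Cons.prems by (intro pair_count_swap) auto
  have "hecke_row N \<beta> i x F (a @ z # y # ys) = x * ?G (a @ y # z # ys)"
    using Cons.prems i hecke_row_support[of t F N "Suc i" "a @ z # y # ys" \<beta> x] assms(1)
    by (simp add: hecke_row_rec hecke_h_def hecke_u_append[of \<beta> a] flip: Cons.prems(1))
  also have "?G (a @ y # z # ys) = x ^ (N - Suc i) * F ((a @ [y]) @ ys @ [z])"
    using Cons.IH[of "a @ [y]" "Suc i"] Cons.prems i inv by simp
  finally show ?case
    using i by (simp add: mult.assoc Suc_diff_Suc[symmetric] del: Suc_diff_Suc)
qed

lemma inversions_move:
  "\<forall>y\<in>set ys. y < z \<Longrightarrow> inversions (a @ z # ys) = inversions (a @ ys @ [z]) + length ys"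
proof (induction ys arbitrary: a)
  case (Cons y ys)
  have "inversions (a @ z # y # ys) = Suc (inversions ((a @ [y]) @ z # ys))"
    using Cons.prems pair_count_swap[of "\<lambda>x y. y < x" z y a ys] by simp
  also have "inversions ((a @ [y]) @ z # ys) = inversions ((a @ [y]) @ ys @ [z]) + length ys"
    using Cons.prems by (intro Cons.IH) simp
  finally show ?case by simp
qed simp

lemma inversions_sorted: "sorted v \<Longrightarrow> inversions v = 0"
  by (induction v) (auto simp: filter_empty_conv)

lemma hecke_groth_top:
  "hecke_groth N \<beta> xs (w0 (Suc N)) = (\<Prod>j\<in>{1..<Suc N}. xs j ^ (Suc N - j))"
proof -
  define D where "D = (\<lambda>v. if v = [1..<Suc (Suc N)] then 1 else 0 :: 'a)"
  define G where "G i = fold (\<lambda>i. hecke_row N \<beta> i (xs (Suc i))) [0..<i] D" for i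
  \<comment> \<open>\<open>t i\<close> is the number of factors in the first \<open>i\<close> rows,
    thus the most inversions they can create; \<open>u i\<close> lists the \<open>i\<close> largest
    values in decreasing order.\<close>
  define t where "t i = (\<Sum>k<i. N - k)" for i
  define u where "u i = rev [Suc (Suc N) - i..<Suc (Suc N)]" for i
  have G_Suc: "G (Suc i) = hecke_row N \<beta> i (xs (Suc i)) (G i)" for i
    by (simp add: G_def)
  have supp: "t i < inversions v \<Longrightarrow> G i v = 0" for i v
  proof (induction i arbitrary: v)
    case 0
    then show ?case using inversions_sorted[of "[1..<Suc (Suc N)]"]
      by (auto simp: G_def D_def simp del: upt_Suc)
  next
    case (Suc i)
    then show ?case using hecke_row_support[of "t i" "G i" N i v] by (simp add: G_Suc t_def)
  qed
  have "inversions (u i @ [1..<Suc (Suc N) - i]) = t i \<and>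
        G i (u i @ [1..<Suc (Suc N) - i]) = (\<Prod>k<i. xs (Suc k) ^ (N - k))" if "i \<le> Suc N" for i
    using that
  proof (induction i)
    case 0
    then show ?case using inversions_sorted[of "[1..<Suc (Suc N)]"]
      by (simp add: G_def D_def t_def u_def del: upt_Suc)
  next
    case (Suc i)
    define z where "z = Suc N - i"
    have z: "Suc (Suc N) - i = Suc z" "Suc (Suc N) - Suc i = z" "1 \<le> z"
      using Suc.prems by (auto simp: z_def)
    have u: "u (Suc i) @ [1..<Suc (Suc N) - Suc i] = u i @ z # [1..<z]"
      using Suc.prems unfolding u_def z by (subst upt_conv_Cons) (auto simp: z_def)
    have u': "u i @ [1..<Suc (Suc N) - i] = u i @ [1..<z] @ [z]"
      unfolding z using z(3) by simp
    have inv: "inversions (u i @ z # [1..<z]) = t i + (N - i)"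
      using inversions_move[of "[1..<z]" z "u i"] Suc unfolding u'
      by (simp add: z_def t_def)
    have "G (Suc i) (u i @ z # [1..<z]) = xs (Suc i) ^ (N - i) * G i (u i @ [1..<z] @ [z])"
      unfolding G_Suc using Suc.prems inv supp[of i]
      by (intro hecke_row_top) (auto simp: u_def z_def simp del: upt_Suc)
    then show ?case
      using Suc inv unfolding u u' by (simp add: t_def mult.commute)
  qed
  from this[of "Suc N"] have "hecke_groth N \<beta> xs (w0 (Suc N)) = (\<Prod>k<Suc N. xs (Suc k) ^ (N - k))"
    by (simp add: hecke_groth_def G_def D_def u_def w0_def del: upt_Suc)
  also have "\<dots> = (\<Prod>k<N. xs (Suc k) ^ (N - k))" by simp
  also have "\<dots> = (\<Prod>j\<in>{1..<Suc N}. xs j ^ (Suc N - j))"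
    by (rule prod.reindex_bij_witness[of _ "\<lambda>j. j - 1" Suc]) auto
  finally show ?thesis .
qed

section \<open>Matching the two recursions\<close>

lemma no_ascent_w0:
  assumes "is_perm w" "\<And>i. Suc i < length w \<Longrightarrow> \<not> w ! i < w ! Suc i"
  shows "w = w0 (length w)"
proof -
  have "sorted_wrt (>) w"
    using assms by (subst sorted_wrt_iff_nth_Suc_transp)
      (auto simp: is_perm_def nth_eq_iff_index_eq, metis Suc_lessD linorder_neqE_nat n_not_Suc_n nth_eq_iff_index_eq)
  then have "sorted_wrt (<) (rev w)" by (simp add: sorted_wrt_rev)
  then have "sorted (rev w)" "distinct (rev w)" by (simp_all add: strict_sorted_iff)
  moreover have "set (rev w) = set [1..<Suc (length w)]" using assms by (auto simp: is_perm_def)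
  ultimately have "rev w = [1..<Suc (length w)]"
    by (intro sorted_distinct_set_unique) (simp_all del: upt_Suc)
  then show ?thesis unfolding w0_def by (metis rev_rev_ident)
qed

lemma is_perm_swapl: "is_perm w \<Longrightarrow> Suc p < length w \<Longrightarrow> is_perm (swapl p w)"
  by (simp add: is_perm_def swapl_def)

lemma const_hom: "swap_poly i (const c) = const c"
proof -
  have "swap_mono i 0 = 0" by (simp add: swap_mono_map_key inj_swp)
  then show ?thesis by (simp add: const_def swap_poly_single)
qed

lemma swap_poly_X: "swap_poly i (X j) = X (swp i j)"
  by (simp add: X_def swap_poly_single swap_mono_single)

text \<open>The fuel has to bound the number of non-inversions: each call turns one of them into an
  inversion, and when none is left \<open>w\<close> has no ascent and equals \<open>w0\<close>. The
  least ascent is as good as any other, because \<open>hecke_groth_rec\<close> holds at each of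
  them.\<close>

lemma groth_aux_eq_hecke:
  assumes "is_perm w" "length w = Suc N" "pair_count (<) w \<le> k"
  shows "groth_aux k \<beta> w = hecke_groth N (const \<beta>) X w"
proof -
  have top: "top_mono (length w) = hecke_groth N (const \<beta>) X w"
    if "w = w0 (length w)" "length w = Suc N" for w
    using hecke_groth_top[of N "const \<beta>" X] that by (metis top_mono_def)
  show ?thesis
  using assms
proof (induction k arbitrary: w)
  case 0
  note top = top[OF _ 0(2)]
  have "w = w0 (length w)"
  proof (rule no_ascent_w0[OF 0(1)])
    fix i assume i: "Suc i < length w"
    show "\<not> w ! i < w ! Suc i"
    proof
      assume less: "w ! i < w ! Suc i"
      show False using 0(3) pair_count_swapl[of i w "(<)"] i less by simp
    qed
  qed
  then show ?case unfolding groth_aux.simps(1) by (subst if_P) (assumption, rule top)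
next
  case (Suc k)
  note top = top[OF _ Suc(3)]
  show ?case
  proof (cases "w = w0 (length w)")
    case True
    then show ?thesis unfolding groth_aux.simps(2) by (subst if_P) (assumption, rule top)
  next
    case False
    define i where "i = (LEAST i. 1 \<le> i \<and> i < length w \<and> w ! (i - 1) < w ! i)"
    obtain j where "Suc j < length w" "w ! j < w ! Suc j"
      using no_ascent_w0[OF Suc(2)] False by blast
    then have "\<exists>i. 1 \<le> i \<and> i < length w \<and> w ! (i - 1) < w ! i"
      by (intro exI[of _ "Suc j"]) simp
    from LeastI_ex[OF this] have "1 \<le> i \<and> i < length w \<and> w ! (i - 1) < w ! i"
      by (simp only: i_def)
    then obtain p where p: "i = Suc p" "Suc p < length w" "w ! p < w ! Suc p"
      by (cases i) auto
    have "pair_count (<) w = Suc (pair_count (<) (swapl p w))"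
      using p by (intro pair_count_swapl) auto
    then have IH: "groth_aux k \<beta> (swapl p w) = hecke_groth N (const \<beta>) X (swapl p w)"
      using Suc is_perm_swapl[OF Suc(2) p(2)] by simp
    have sw: "swap_adj w i = swapl p w" by (simp add: swap_adj_def swapl_def p(1))
    have "groth_aux (Suc k) \<beta> w =
        ddiff i ((1 + const \<beta> * X (Suc i)) * hecke_groth N (const \<beta>) X (swapl p w))"
      unfolding groth_aux.simps(2) i_def[symmetric] Let_def sw IH by (rule if_not_P[OF False])
    also have "\<dots> = hecke_groth N (const \<beta>) X w"
    proof (rule ddiff_eqI)
      have mult: "swap_poly i (f * g) = swap_poly i f * swap_poly i g"
        and lin: "swap_poly i (1 + const \<beta> * X (Suc i)) = 1 + const \<beta> * X i" for f g :: "'a mpoly"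
        using ring_hom_swap_poly[of i, where 'a = 'a]
        by (simp_all add: ring_hom_def const_hom swap_poly_X swp_def)
      \<comment> \<open>Exchanging two variables in a coefficient amounts to forming the product
        with \<open>X \<circ> swp i\<close>, as in \<open>hecke_groth_rec\<close>.\<close>
      have "swap_poly i (hecke_groth N (const \<beta>) X v) = hecke_groth N (const \<beta>) (X \<circ> swp i) v" for v
        unfolding hecke_groth_hom[OF ring_hom_swap_poly] comp_def swap_poly_X const_hom ..
      then show "hecke_groth N (const \<beta>) X w * (X i - X (Suc i)) =
         (1 + const \<beta> * X (Suc i)) * hecke_groth N (const \<beta>) X (swapl p w) -
         swap_poly i ((1 + const \<beta> * X (Suc i)) * hecke_groth N (const \<beta>) X (swapl p w))"
        unfolding mult lin using hecke_groth_rec[of p N w "const \<beta>" X] p Suc(3) by simp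
    qed
    finally show ?thesis .
  qed
qed
qed

lemma Upsilon_eq_hecke:
  assumes "is_perm w" "length w = Suc N"
  shows "Upsilon \<beta> w = hecke_groth N \<beta> (\<lambda>_. 1) w"
proof -
  have "eval_ones \<circ> X = (\<lambda>_. 1 :: 'a)" by (rule ext) (simp add: X_def eval_ones_single)
  moreover have "eval_ones (const \<beta>) = \<beta>" by (simp add: const_def eval_ones_single)
  moreover have "groth \<beta> w = hecke_groth N (const \<beta>) X w"
    unfolding groth_def using assms pair_count_le by (rule groth_aux_eq_hecke)
  moreover have "w \<noteq> []" using assms by auto
  ultimately show ?thesis
    using hecke_groth_hom[OF ring_hom_eval_ones, of N "const \<beta>" X w] by (simp add: Upsilon_def)
qed

section \<open>Inserting and deleting a removable pipe\<close>

text \<open>The row in which a removable pipe entering a column from the right in row \<open>i\<close> leaves it. It either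
  crosses, under a tile that is not an unmarked bump, or descends through two unmarked bumps. In both
  cases the column without the pipe is obtained by deleting tile \<open>i\<close>, and conversely the entry row is
  determined by the exit row.\<close>
definition col_exit :: "(nat \<Rightarrow> tile) \<Rightarrow> nat \<Rightarrow> nat option" where
  "col_exit f i =
     (if f i = Cr \<and> (i = 0 \<or> f (i - 1) \<noteq> Bu) then Some i
      else if f i = Bu \<and> f (Suc i) = Bu then Some (Suc i) else None)"

definition col_delete :: "nat \<Rightarrow> (nat \<Rightarrow> tile) \<Rightarrow> nat \<Rightarrow> tile" where
  "col_delete i f = (\<lambda>n. if n < i then f n else f (Suc n))"

text \<open>Tile \<open>q - 1\<close> of the shortened column lies directly above the exit row.
  Under an unmarked bump a crossing would violate removability, so there the pipe must split the
  bump and enters one row higher.\<close>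

definition col_entry :: "(nat \<Rightarrow> tile) \<Rightarrow> nat \<Rightarrow> nat" where
  "col_entry f q = (if q = 0 \<or> f (q - 1) \<noteq> Bu then q else q - 1)"

definition col_insert :: "(nat \<Rightarrow> tile) \<Rightarrow> nat \<Rightarrow> nat \<Rightarrow> tile" where
  "col_insert f q = (\<lambda>n. if n < col_entry f q then f n
      else if n = col_entry f q then (if n = q then Cr else Bu) else f (n - 1))"

definition drop_col :: "nat \<Rightarrow> nat \<Rightarrow> tile" where
  "drop_col r = (\<lambda>i. if i < r then Cr else Bu)"

text \<open>The recursion peels off the leftmost column, so \<open>g \<circ> Suc\<close> carries the
  earlier part of the path. Columns to the right of column \<open>j\<close> are never met by the
  pipe.\<close>

primrec removable_exit :: "nat \<Rightarrow> (nat \<Rightarrow> nat \<Rightarrow> tile) \<Rightarrow> nat option" where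
  "removable_exit 0 g = (if \<exists>r. g 0 = drop_col r then Some (THE r. g 0 = drop_col r) else None)"
| "removable_exit (Suc j) g = Option.bind (removable_exit j (g \<circ> Suc)) (col_exit (g 0))"

primrec delete_pipe :: "nat \<Rightarrow> (nat \<Rightarrow> nat \<Rightarrow> tile) \<Rightarrow> nat \<Rightarrow> nat \<Rightarrow> tile" where
  "delete_pipe 0 g = g \<circ> Suc"
| "delete_pipe (Suc j) g =
     case_nat (col_delete (the (removable_exit j (g \<circ> Suc))) (g 0)) (delete_pipe j (g \<circ> Suc))"

primrec insert_pipe :: "nat \<Rightarrow> nat \<Rightarrow> (nat \<Rightarrow> nat \<Rightarrow> tile) \<Rightarrow> nat \<Rightarrow> nat \<Rightarrow> tile" where
  "insert_pipe 0 q g = case_nat (drop_col q) g"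
| "insert_pipe (Suc j) q g =
     case_nat (col_insert (g 0) q) (insert_pipe j (col_entry (g 0) q) (g \<circ> Suc))"

lemma drop_col_inj [simp]: "drop_col r = drop_col s \<longleftrightarrow> r = s"
proof
  assume *: "drop_col r = drop_col s"
  have "drop_col r i = drop_col s i" for i using * by simp
  from this[of r] this[of s] show "r = s" by (auto simp: drop_col_def split: if_splits)
qed simp

lemma removable_exit_0: "removable_exit 0 g = Some q \<longleftrightarrow> g 0 = drop_col q"
proof -
  have "(THE r. drop_col q = drop_col r) = q" by (rule the_equality) auto
  then show ?thesis by auto
qed

lemma col_exit_insert:
  "col_exit (col_insert f q) (col_entry f q) = Some q"
  by (cases q) (auto simp: col_exit_def col_insert_def col_entry_def)

lemma col_delete_insert: "col_delete (col_entry f q) (col_insert f q) = f"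
  by (rule ext) (auto simp: col_delete_def col_insert_def)

lemma col_insert_delete:
  assumes "col_exit f i = Some q"
  shows "col_entry (col_delete i f) q = i" "col_insert (col_delete i f) q = f"
proof -
  show 1: "col_entry (col_delete i f) q = i"
    using assms by (cases i) (auto simp: col_exit_def col_delete_def col_entry_def split: if_splits)
  show "col_insert (col_delete i f) q = f"
    unfolding col_insert_def 1
    using assms by (intro ext) (auto simp: col_exit_def col_delete_def split: if_splits)
qed

lemma removable_exit_insert: "removable_exit j (insert_pipe j q g) = Some q"
proof (induction j arbitrary: q g)
  case 0
  then show ?case by (simp only: removable_exit_0) simp
next
  case (Suc j)
  then show ?case by (simp add: col_exit_insert)
qed

lemma delete_insert_pipe: "delete_pipe j (insert_pipe j q g) = g"
  by (induction j arbitrary: q g) (simp_all add: removable_exit_insert col_delete_insert)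

lemma insert_delete_pipe: "removable_exit j g = Some q \<Longrightarrow> insert_pipe j q (delete_pipe j g) = g"
proof (induction j arbitrary: q g)
  case 0
  then have "g 0 = drop_col q" by (simp only: removable_exit_0)
  then show ?case by (metis case_nat_0_Suc delete_pipe.simps(1) insert_pipe.simps(1))
next
  case (Suc j)
  then obtain i where i: "removable_exit j (g \<circ> Suc) = Some i" "col_exit (g 0) i = Some q"
    by (auto simp: bind_eq_Some_conv)
  show ?case
    unfolding insert_pipe.simps delete_pipe.simps nat.case case_nat_comp_Suc i(1) option.sel
      col_insert_delete[OF i(2)] Suc.IH[OF i(1)] by (rule case_nat_0_Suc)
qed

lemma dreams_Suc_iff: "g \<in> dreams (Suc n) \<longleftrightarrow> g 0 \<in> columns n \<and> g \<circ> Suc \<in> dreams n"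
proof
  assume "g \<in> dreams (Suc n)"
  then show "g 0 \<in> columns n \<and> g \<circ> Suc \<in> dreams n" by (auto simp: dreams_def columns_def)
next
  assume "g 0 \<in> columns n \<and> g \<circ> Suc \<in> dreams n"
  then have "g k i = Bu" if "n \<le> k + i" for k i
    using that by (cases k) (auto simp: dreams_def columns_def)
  then show "g \<in> dreams (Suc n)" by (auto simp: dreams_def)
qed

lemma columns_insert:
  assumes "f \<in> columns n" "q \<le> Suc n"
  shows "col_insert f q \<in> columns (Suc n)" "col_entry f q \<le> n"
  using assms by (auto simp: columns_def col_insert_def col_entry_def le_Suc_eq)

lemma columns_delete:
  assumes "f \<in> columns (Suc n)" "col_exit f i = Some q" "i \<le> n"
  shows "col_delete i f \<in> columns n" "q \<le> Suc n"
  using assms by (auto simp: columns_def col_delete_def col_exit_def split: if_splits)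

lemma insert_pipe_dreams:
  "g \<in> dreams n \<Longrightarrow> j \<le> n \<Longrightarrow> q \<le> n \<Longrightarrow> insert_pipe j q g \<in> dreams (Suc n)"
proof (induction j arbitrary: q g n)
  case 0
  then show ?case by (auto simp: dreams_Suc_iff columns_def drop_col_def)
next
  case (Suc j)
  then obtain m where n: "n = Suc m" by (cases n) auto
  have g: "g 0 \<in> columns m" "g \<circ> Suc \<in> dreams m" using Suc.prems n by (simp_all add: dreams_Suc_iff)
  then show ?case
    using Suc.IH[of "g \<circ> Suc" m "col_entry (g 0) q"] Suc.prems columns_insert[OF g(1), of q]
    by (simp add: dreams_Suc_iff[of _ n]) (simp add: n comp_def)
qed

lemma delete_pipe_dreams:
  "g \<in> dreams (Suc n) \<Longrightarrow> j \<le> n \<Longrightarrow> removable_exit j g = Some q \<Longrightarrow> delete_pipe j g \<in> dreams n \<and> q \<le> n"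
proof (induction j arbitrary: q g n)
  case 0
  have "g 0 = drop_col q" using 0(3) by (simp only: removable_exit_0)
  moreover have "g 0 n = Bu" using 0(1) by (auto simp: dreams_def)
  ultimately show ?case
    using 0(1) by (auto simp: dreams_Suc_iff drop_col_def comp_def split: if_splits)
next
  case (Suc j)
  then obtain m where n: "n = Suc m" by (cases n) auto
  obtain i where i: "removable_exit j (g \<circ> Suc) = Some i" "col_exit (g 0) i = Some q"
    using Suc.prems by (auto simp: bind_eq_Some_conv)
  have g: "g 0 \<in> columns (Suc m)" "g \<circ> Suc \<in> dreams (Suc m)"
    using Suc.prems n by (simp_all add: dreams_Suc_iff)
  have IH: "delete_pipe j (g \<circ> Suc) \<in> dreams m" "i \<le> m"
    using Suc.IH[of "g \<circ> Suc" m i] g(2) i(1) Suc.prems n by (auto simp: comp_def)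
  show ?case
    using IH(1) columns_delete[OF g(1) i(2) IH(2)] unfolding n dreams_Suc_iff[of _ m] 
    by (simp add: i(1)[unfolded comp_def] comp_def)
qed

text \<open>The inserted tile is unmarked and the others at most shift by one row.\<close>

lemma col_marks_insert: "col_marks (col_insert f q) = col_marks f"
proof -
  let ?e = "col_entry f q"
  have "bij_betw (\<lambda>n. if n < ?e then n else Suc n) {n. f n = Mk} {n. col_insert f q n = Mk}"
  proof (rule bij_betw_byWitness[of _ "\<lambda>n. if n < ?e then n else n - 1"])
    have ne: "col_insert f q ?e \<noteq> Mk" by (simp add: col_insert_def)
    have lt: "n < ?e \<Longrightarrow> col_insert f q n = f n" for n by (simp add: col_insert_def)
    have ge: "\<not> n < ?e \<Longrightarrow> col_insert f q (Suc n) = f n" for n by (simp add: col_insert_def)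
    have S: "\<exists>m. n = Suc m \<and> \<not> m < ?e" if "col_insert f q n = Mk" "\<not> n < ?e" for n
    proof (cases n)
      case 0
      then have "n = ?e" using that(2) by simp
      then show ?thesis using that(1) ne by metis
    next
      case (Suc m)
      have "n \<noteq> ?e" using that(1) ne by metis
      then show ?thesis using that(2) Suc by simp
    qed
    show "\<forall>n\<in>{n. f n = Mk}. (if (if n < ?e then n else Suc n) < ?e then (if n < ?e then n else Suc n)
        else (if n < ?e then n else Suc n) - 1) = n" by simp
    show "(\<lambda>n. if n < ?e then n else Suc n) ` {n. f n = Mk} \<subseteq> {n. col_insert f q n = Mk}"
      by (rule image_subsetI) (simp add: lt ge)
    show "\<forall>n\<in>{n. col_insert f q n = Mk}. (if (if n < ?e then n else n - 1) < ?e
        then (if n < ?e then n else n - 1) else Suc (if n < ?e then n else n - 1)) = n"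
    proof
      fix n assume "n \<in> {n. col_insert f q n = Mk}"
      then have "n < ?e \<or> (\<exists>m. n = Suc m \<and> \<not> m < ?e)" using S[of n] by blast
      then show "(if (if n < ?e then n else n - 1) < ?e then (if n < ?e then n else n - 1)
          else Suc (if n < ?e then n else n - 1)) = n"
        by (elim disjE exE conjE) simp_all
    qed
    show "(\<lambda>n. if n < ?e then n else n - 1) ` {n. col_insert f q n = Mk} \<subseteq> {n. f n = Mk}"
    proof (rule image_subsetI)
      fix n assume n: "n \<in> {n. col_insert f q n = Mk}"
      show "(if n < ?e then n else n - 1) \<in> {n. f n = Mk}"
      proof (cases "n < ?e")
        case True
        then show ?thesis using n lt[of n] by simp
      next
        case False
        then obtain m where "n = Suc m" "\<not> m < ?e" using S[of n] n by blast
        then show ?thesis using n ge[of m] by simp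
      qed
    qed
  qed
  from bij_betw_same_card[OF this] show ?thesis by (simp add: col_marks_def)
qed

lemma marks_insert_pipe:
  "g \<in> dreams n \<Longrightarrow> j \<le> n \<Longrightarrow> q \<le> n \<Longrightarrow> marks (insert_pipe j q g) = marks g"
proof (induction j arbitrary: q g n)
  case 0
  have "drop_col q \<in> columns n" using 0 by (auto simp: columns_def drop_col_def)
  moreover have "{i. drop_col q i = Mk} = {}" by (auto simp: drop_col_def)
  ultimately show ?case using marks_case[of "drop_col q" n g] 0 by (simp add: col_marks_def)
next
  case (Suc j)
  then obtain m where n: "n = Suc m" by (cases n) auto
  have g: "g 0 \<in> columns m" "g \<circ> Suc \<in> dreams m" using Suc.prems n by (simp_all add: dreams_Suc_iff)
  have q: "col_insert (g 0) q \<in> columns n" "col_entry (g 0) q \<le> m"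
    using columns_insert[OF g(1), of q] Suc.prems n by simp_all
  have "marks (insert_pipe (Suc j) q g) = col_marks (g 0) + marks (g \<circ> Suc)"
    using marks_case[OF q(1), of "insert_pipe j (col_entry (g 0) q) (g \<circ> Suc)"]
      insert_pipe_dreams[of "g \<circ> Suc" m j "col_entry (g 0) q"]
      Suc.IH[of "g \<circ> Suc" m "col_entry (g 0) q"] g q(2) Suc.prems n
    by (simp add: col_marks_insert comp_def)
  also have "\<dots> = marks g" using marks_case[OF g] by simp
  finally show ?case .
qed

section \<open>Effect of an insertion on exit order and validity\<close>

definition list_insert :: "nat \<Rightarrow> 'c \<Rightarrow> 'c list \<Rightarrow> 'c list" where
  "list_insert q y u = take q u @ y # drop q u"

lemma list_insert_simps [simp]:
  "list_insert 0 y u = y # u" "list_insert (Suc q) y (a # u) = a # list_insert q y u"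
  "list_insert (Suc q) y [] = [y]"
  by (simp_all add: list_insert_def)

lemma Bu_comp_Suc [simp]: "(\<lambda>_. Bu) \<circ> Suc = (\<lambda>_. Bu)"
  by (simp add: comp_def)

lemma col_out_Bu: "col_out p u (\<lambda>_. Bu) = p # u"
  by (induction u arbitrary: p) simp_all

lemma col_valid_Bu: "col_valid p u (\<lambda>_. Bu)"
  by (induction u arbitrary: p) simp_all

lemma drop_col_simps: "drop_col 0 = (\<lambda>_. Bu)" "drop_col (Suc q) \<circ> Suc = drop_col q" "drop_col (Suc q) 0 = Cr"
  by (auto simp: drop_col_def)

lemma col_out_drop_col: "q \<le> length u \<Longrightarrow> col_out y u (drop_col q) = list_insert q y u"
proof (induction u arbitrary: q)
  case (Cons a u)
  then show ?case by (cases q) (simp_all add: drop_col_simps col_out_Bu)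
qed simp

lemma col_valid_drop_col:
  "q \<le> length u \<Longrightarrow> (\<forall>a\<in>set u. y < a) \<Longrightarrow> col_valid y u (drop_col q)"
proof (induction u arbitrary: q)
  case (Cons a u)
  then show ?case by (cases q) (simp_all add: drop_col_simps col_valid_Bu)
qed simp

lemma col_insert_0: "col_insert f 0 = case_nat Cr f" "col_entry f 0 = 0"
  by (auto simp: col_insert_def col_entry_def split: nat.split)

lemma col_insert_Suc:
  assumes "q > 0 \<or> f 0 \<noteq> Bu"
  shows "col_insert f (Suc q) = case_nat (f 0) (col_insert (f \<circ> Suc) q)"
    "col_entry f (Suc q) = Suc (col_entry (f \<circ> Suc) q)"
proof -
  show 1: "col_entry f (Suc q) = Suc (col_entry (f \<circ> Suc) q)"
    using assms by (cases q) (auto simp: col_entry_def)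
  show "col_insert f (Suc q) = case_nat (f 0) (col_insert (f \<circ> Suc) q)"
  proof
    fix n show "col_insert f (Suc q) n = case_nat (f 0) (col_insert (f \<circ> Suc) q) n"
      unfolding col_insert_def 1 by (cases n; cases "n - 1") auto
  qed
qed

lemma col_insert_split:
  assumes "f 0 = Bu"
  shows "col_insert f (Suc 0) = case_nat Bu f" "col_entry f (Suc 0) = 0"
  using assms by (auto simp: col_insert_def col_entry_def split: nat.split)

lemma columns_Suc_comp: "f \<in> columns (Suc n) \<Longrightarrow> f \<circ> Suc \<in> columns n"
  by (auto simp: columns_def)

text \<open>Induction down the column: a crossing is inserted on top, or the top bump is split, or
  the first tile stays and the insertion happens below it. In the first two cases \<open>y\<close>
  leaves in row \<open>q\<close> and hands on the pipe that the old column would have handed on, so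
  the rest is unchanged.\<close>

lemma col_out_insert:
  assumes "f \<in> columns (length u)" "q \<le> Suc (length u)"
  shows "col_out p (list_insert (col_entry f q) y u) (col_insert f q) = list_insert q y (col_out p u f)"
  using assms
proof (induction u arbitrary: p f q)
  case Nil
  then have "f 0 = Bu" by (simp add: columns_def)
  with Nil show ?case
    by (cases q) (auto simp: col_insert_0 col_insert_split)
next
  case (Cons a u)
  have f: "f \<circ> Suc \<in> columns (length u)" using Cons.prems columns_Suc_comp by simp
  consider "q = 0" | "q = Suc 0" "f 0 = Bu" | r where "q = Suc r" "r > 0 \<or> f 0 \<noteq> Bu"
    by (cases q) auto
  then show ?case
  proof cases
    case 3
    then show ?thesis using Cons.IH[OF f, of r] Cons.prems by (simp add: col_insert_Suc comp_def)
  qed (simp_all add: col_insert_0 col_insert_split)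
qed

text \<open>Old tiles meet the same two pipes as before, except for a split bump, which is unmarked
  and thus carries no condition.\<close>

lemma col_valid_insertD:
  assumes "f \<in> columns (length u)" "q \<le> Suc (length u)"
    "col_valid p (list_insert (col_entry f q) y u) (col_insert f q)"
  shows "col_valid p u f"
  using assms
proof (induction u arbitrary: p f q)
  case (Cons a u)
  have f: "f \<circ> Suc \<in> columns (length u)" using Cons.prems columns_Suc_comp by simp
  consider "q = 0" | "q = Suc 0" "f 0 = Bu" | r where "q = Suc r" "r > 0 \<or> f 0 \<noteq> Bu"
    by (cases q) auto
  then show ?case
  proof cases
    case 3
    then show ?thesis
      using Cons.IH[OF f, of r] Cons.prems by (auto simp: col_insert_Suc comp_def split: if_splits)
  qed (use Cons.prems in \<open>auto simp: col_insert_0 col_insert_split split: if_splits\<close>)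
qed simp

definition remove_nth :: "nat \<Rightarrow> 'c list \<Rightarrow> 'c list" where
  "remove_nth j xs = take j xs @ drop (Suc j) xs"

lemma remove_nth_simps [simp]:
  "remove_nth 0 (x # xs) = xs" "remove_nth (Suc j) (x # xs) = x # remove_nth j xs"
  by (simp_all add: remove_nth_def)

lemma length_remove_nth [simp]: "j < length xs \<Longrightarrow> length (remove_nth j xs) = length xs - 1"
  by (simp add: remove_nth_def)

lemma dream_insert_pipe:
  assumes "g \<in> dreams (length xs - 1)" "j < length xs" "q < length xs"
  shows "dream_out xs (insert_pipe j q g) = list_insert q (xs ! j) (dream_out (remove_nth j xs) g)"
    and "dream_valid xs (insert_pipe j q g) \<Longrightarrow> dream_valid (remove_nth j xs) g"
  using assms
proof (induction j arbitrary: xs q g)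
  case 0
  {
    case 1
    then show ?case by (cases xs) (simp_all add: col_out_drop_col)
  next
    case 2
    then show ?case by (cases xs) simp_all
  }
next
  case (Suc j)
  {
    case 1
    then obtain x xs' n where xs: "xs = x # xs'" "length xs' = Suc n"
      by (cases xs; cases "tl xs") auto
    have g: "g 0 \<in> columns n" "g \<circ> Suc \<in> dreams n" using 1 xs by (simp_all add: dreams_Suc_iff)
    have q: "q \<le> Suc n" "col_entry (g 0) q \<le> n" using 1 xs columns_insert(2)[OF g(1), of q] by auto
    show ?case
      using Suc.IH(1)[of "g \<circ> Suc" xs' "col_entry (g 0) q"] g q 1 xs
        col_out_insert[of "g 0" "dream_out (remove_nth j xs') (g \<circ> Suc)" q x "xs' ! j"]
      by (simp add: comp_def)
  next
    case 2
    then obtain x xs' n where xs: "xs = x # xs'" "length xs' = Suc n"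
      by (cases xs; cases "tl xs") auto
    have g: "g 0 \<in> columns n" "g \<circ> Suc \<in> dreams n" using 2 xs by (simp_all add: dreams_Suc_iff)
    have q: "q \<le> Suc n" "col_entry (g 0) q \<le> n" using 2 xs columns_insert(2)[OF g(1), of q] by auto
    show ?case
      using Suc.IH(1)[of "g \<circ> Suc" xs' "col_entry (g 0) q"]
        Suc.IH(2)[of xs' "col_entry (g 0) q" "g \<circ> Suc"] g q 2 xs
        col_valid_insertD[of "g 0" "dream_out (remove_nth j xs') (g \<circ> Suc)" q x "xs' ! j"]
      by (simp add: comp_def)
  }
qed

text \<open>In the columns where both pipes are present they run horizontally, so neither disturbs the other.\<close>
lemma removable_exit_delete:
  assumes "removable_exit j g = Some q" "j \<le> l"
  shows "removable_exit (Suc l) g =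
    map_option (\<lambda>z. if z < q then z else Suc z) (removable_exit l (delete_pipe j g))"
  using assms
proof (induction j arbitrary: q g l)
  case 0
  have g0: "g 0 = drop_col q" using 0(1) by (simp only: removable_exit_0)
  \<comment> \<open>A larger pipe entering above row \<open>q\<close> goes straight through the
    crossings; from row \<open>q\<close> on it meets two unmarked bumps and descends by one
    row.\<close>
  have "col_exit (drop_col q) z = Some (if z < q then z else Suc z)" for z
    by (auto simp: col_exit_def drop_col_def)
  then show ?case by (cases "removable_exit l (g \<circ> Suc)") (simp_all add: g0 comp_def)
next
  case (Suc j)
  obtain i where i: "removable_exit j (g \<circ> Suc) = Some i" "col_exit (g 0) i = Some q"
    using Suc.prems by (auto simp: bind_eq_Some_conv)
  obtain l' where l: "l = Suc l'" "j \<le> l'" using Suc.prems by (cases l) auto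
  have "col_exit f (if z < i then z else Suc z) =
      map_option (\<lambda>z. if z < q then z else Suc z) (col_exit (col_delete i f) z)"
    if exit: "col_exit f i = Some q" for f z
  proof -
    consider "f i = Cr" "q = i" "i = 0 \<or> f (i - 1) \<noteq> Bu" | "f i = Bu" "f (Suc i) = Bu" "q = Suc i"
      using exit by (auto simp: col_exit_def split: if_splits)
    then show ?thesis
    proof cases
      case 1
      consider "Suc z < i" | "Suc z = i" | "z = i" | k where "z = Suc (i + k)"
        by (metis less_imp_Suc_add linorder_neqE_nat Suc_lessI add_Suc_right)
      then show ?thesis
        by cases (use 1 in \<open>auto simp: col_exit_def col_delete_def\<close>)
    next
      case 2
      consider "Suc z < i" | "Suc z = i" | "z = i" | "z = Suc i" | k where "z = Suc (Suc (i + k))"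
        by (metis less_imp_Suc_add linorder_neqE_nat Suc_lessI add_Suc_right)
      then show ?thesis
        by cases (use 2 in \<open>auto simp: col_exit_def col_delete_def\<close>)
    qed
  qed
  from this[OF i(2)] show ?case
    using Suc.IH[OF i(1) l(2)] by (cases "removable_exit l' (delete_pipe j (g \<circ> Suc))") (simp_all add: l(1) i(1)[unfolded comp_def] comp_def)
qed

text \<open>Below the all-crossing rows: if no larger pipe leaving above \<open>y\<close> exceeds a pipe \<open>b > y\<close> leaving
  below it, then the inserted pipe \<open>y\<close> only crosses smaller pipes in this column, and the
  hypothesis is inherited by the inputs of the column.\<close>
lemma col_insert_valid_aux:
  assumes "col_valid p u f" "f \<in> columns (length u)" "q \<le> length u" "y \<noteq> p" "y \<notin> set u"
    and "\<forall>c\<in>set (take (Suc q) (col_out p u f)). \<forall>b\<in>set (drop (Suc q) (col_out p u f)). \<not> (y < b \<and> b < c)"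
  shows "col_valid p (list_insert (col_entry f (Suc q)) y u) (col_insert f (Suc q)) \<and>
    set (p # take (col_entry f (Suc q)) u) \<subseteq> set (take (Suc q) (col_out p u f)) \<union> {..<y} \<and>
    set (drop (col_entry f (Suc q)) u) \<subseteq> set (drop (Suc q) (col_out p u f))"
  using assms
proof (induction u arbitrary: p f q)
  case Nil
  then have "f 0 = Bu" "q = 0" by (auto simp: columns_def)
  then show ?case by (simp add: col_insert_split)
next
  case (Cons a u)
  have f: "f \<circ> Suc \<in> columns (length u)" using Cons.prems columns_Suc_comp by simp
  show ?case
  proof (cases q)
    case 0
    show ?thesis
    proof (cases "f 0")
      case Bu
      then show ?thesis
        using Cons.prems 0 by (auto simp: col_insert_split set_col_out)
    next
      case Cr
      \<comment> \<open>Here \<open>p < a\<close> cross, \<open>a\<close> leaves above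
        \<open>y\<close> and \<open>p\<close> below it, so \<open>p > y\<close> would contradict the
        hypothesis. The inserted tile is the crossing of \<open>p\<close> and \<open>y\<close> just
        below.\<close>
      then have "p < y" using Cons.prems 0 by (auto simp: set_col_out)
      then show ?thesis
        using Cons.prems 0 Cr by (auto simp: col_insert_Suc col_insert_0 set_col_out)
    next
      case Mk
      \<comment> \<open>At the mark \<open>a < p\<close>, and \<open>p\<close> leaves above
        \<open>y\<close> while \<open>a\<close> leaves below it; now \<open>a\<close> is the pipe
        that \<open>y\<close> crosses in the next row.\<close>
      then have "a < y" using Cons.prems 0 by (auto simp: set_col_out)
      then show ?thesis
        using Cons.prems 0 Mk by (auto simp: col_insert_Suc col_insert_0 set_col_out)
    qed
  next
    case (Suc r)
    note ins = col_insert_Suc[of "Suc r" f, OF disjI1[OF zero_less_Suc]]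
    show ?thesis
    proof (cases "f 0 = Cr")
      case True
      have "col_valid p (list_insert (col_entry (f \<circ> Suc) (Suc r)) y u) (col_insert (f \<circ> Suc) (Suc r)) \<and>
        set (p # take (col_entry (f \<circ> Suc) (Suc r)) u) \<subseteq> set (take (Suc r) (col_out p u (f \<circ> Suc))) \<union> {..<y} \<and>
        set (drop (col_entry (f \<circ> Suc) (Suc r)) u) \<subseteq> set (drop (Suc r) (col_out p u (f \<circ> Suc)))"
        by (rule Cons.IH) (use Cons.prems f True Suc in \<open>auto simp: comp_def\<close>)
      then show ?thesis using True Cons.prems(1) by (auto simp: Suc ins)
    next
      case False
      have "col_valid a (list_insert (col_entry (f \<circ> Suc) (Suc r)) y u) (col_insert (f \<circ> Suc) (Suc r)) \<and>
        set (a # take (col_entry (f \<circ> Suc) (Suc r)) u) \<subseteq> set (take (Suc r) (col_out a u (f \<circ> Suc))) \<union> {..<y} \<and>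
        set (drop (col_entry (f \<circ> Suc) (Suc r)) u) \<subseteq> set (drop (Suc r) (col_out a u (f \<circ> Suc)))"
        by (rule Cons.IH) (use Cons.prems f False Suc in \<open>auto simp: comp_def\<close>)
      then show ?thesis using False Cons.prems(1) by (auto simp: Suc ins)
    qed
  qed
qed

text \<open>Meant for the pipes \<open>A\<close> above and \<open>B\<close> below the inserted pipe
  \<open>y\<close>; an excluded pair is what could make \<open>b\<close> cross \<open>y\<close>
  twice.\<close>

definition separated :: "nat \<Rightarrow> nat set \<Rightarrow> nat set \<Rightarrow> bool" where
  "separated y A B \<longleftrightarrow> (\<forall>c\<in>A. \<forall>b\<in>B. \<not> (y < b \<and> b < c))"

lemma separated_empty [simp]: "separated y {} B"
  by (simp add: separated_def)

text \<open>At the first tile that is not a crossing \<open>p\<close> itself leaves, and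
  \<open>p\<close> is not larger than \<open>y\<close>. So the top \<open>s\<close> tiles are
  crossings and are passed straight through.\<close>

lemma take_col_out:
  assumes "p < y" "\<forall>z\<in>set (take s (col_out p u f)). y < z"
  shows "take s (col_out p u f) = take s u"
  using assms(2)
proof (induction u arbitrary: s f)
  case Nil
  then show ?case using assms(1) by (cases s) auto
next
  case (Cons a u)
  then show ?case using assms(1) by (cases s) (auto split: if_splits)
qed

text \<open>\<open>s\<close> counts leading pipes larger than \<open>y\<close>; the pipe \<open>p < y\<close> starting in this column has to
  cross all of them, so the top \<open>s\<close> tiles are crossings.\<close>
lemma col_insert_valid:
  assumes "col_valid p u f" "f \<in> columns (length u)" "q \<le> Suc (length u)" "p < y" "y \<notin> set u"
    and "\<forall>z\<in>set (take s (col_out p u f)). y < z"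
    and "separated y (set (drop s (take q (col_out p u f)))) (set (drop q (col_out p u f)))"
  shows "col_valid p (list_insert (col_entry f q) y u) (col_insert f q) \<and>
    separated y (set (drop s (take (col_entry f q) u))) (set (drop (col_entry f q) u))"
  using assms
proof (induction s arbitrary: u f q)
  case 0
  show ?case
  proof (cases q)
    case 0
    then show ?thesis using \<open>col_valid p u f\<close> \<open>p < y\<close> by (simp add: col_insert_0)
  next
    case (Suc r)
    have clear: "\<forall>c\<in>set (take (Suc r) (col_out p u f)). \<forall>b\<in>set (drop (Suc r) (col_out p u f)). \<not> (y < b \<and> b < c)"
      using 0(7) by (simp only: Suc drop0 separated_def)
    have *: "col_valid p (list_insert (col_entry f (Suc r)) y u) (col_insert f (Suc r)) \<and>
      set (p # take (col_entry f (Suc r)) u) \<subseteq> set (take (Suc r) (col_out p u f)) \<union> {..<y} \<and>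
      set (drop (col_entry f (Suc r)) u) \<subseteq> set (drop (Suc r) (col_out p u f))"
      by (rule col_insert_valid_aux[OF 0(1,2) _ _ 0(5) clear]) (use 0(3,4) Suc in simp_all)
    have "\<not> (y < b \<and> b < c)"
      if "c \<in> set (take (col_entry f (Suc r)) u)" "b \<in> set (drop (col_entry f (Suc r)) u)" for b c
    proof -
      have "b \<in> set (drop (Suc r) (col_out p u f))" using * that(2) by blast
      moreover have "c \<in> set (take (Suc r) (col_out p u f)) \<or> c < y" using * that(1) by auto
      ultimately show ?thesis using clear by (meson less_trans order.asym)
    qed
    then have "separated y (set (take (col_entry f (Suc r)) u)) (set (drop (col_entry f (Suc r)) u))"
      unfolding separated_def by blast
    then show ?thesis using * unfolding Suc drop0 by blast
  qed
next
  case (Suc s)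
  obtain a u' where u: "u = a # u'"
    using Suc.prems by (cases u) auto
  have Cr: "f 0 = Cr"
    using Suc.prems by (auto simp: u split: if_splits)
  have f: "f \<circ> Suc \<in> columns (length u')" using Suc.prems columns_Suc_comp by (simp add: u)
  show ?case
  proof (cases q)
    case 0
    then show ?thesis using Suc.prems(1,4) Cr by (simp add: col_insert_0 u)
  next
    case (Suc r)
    have "col_valid p (list_insert (col_entry (f \<circ> Suc) r) y u') (col_insert (f \<circ> Suc) r) \<and>
      separated y (set (drop s (take (col_entry (f \<circ> Suc) r) u'))) (set (drop (col_entry (f \<circ> Suc) r) u'))"
    proof (rule Suc.IH[OF _ f])
      show "col_valid p u' (f \<circ> Suc)" using Suc.prems(1) Cr by (simp add: u)
      show "r \<le> Suc (length u')" using Suc.prems(3) Suc by (simp add: u)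
      show "p < y" by (rule Suc.prems(4))
      show "y \<notin> set u'" using Suc.prems(5) by (simp add: u)
      show "\<forall>z\<in>set (take s (col_out p u' (f \<circ> Suc))). y < z"
        using Suc.prems(6) Cr by (simp add: u)
      show "separated y (set (drop s (take r (col_out p u' (f \<circ> Suc))))) (set (drop r (col_out p u' (f \<circ> Suc))))"
        using Suc.prems(7) Cr by (simp add: u Suc)
    qed
    then show ?thesis using Suc.prems(1,4) Cr unfolding Suc u by (simp add: col_insert_Suc)
  qed
qed

lemma length_list_insert [simp]: "length (list_insert q y u) = Suc (length u)"
  by (simp add: list_insert_def)

text \<open>The two conditions on the leading \<open>s\<close> pipes and on the rest pass from the
  pipes leaving a column to those entering it, by \<open>take_col_out\<close> and
  \<open>col_insert_valid\<close>. In its own column \<open>y\<close> is smaller than all entering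
  pipes, so its crossings are valid.\<close>

lemma dream_valid_insert:
  assumes "sorted_wrt (<) xs" "j < length xs" "g \<in> dreams (length xs - 1)"
    and "dream_valid (remove_nth j xs) g" "q < length xs"
    and "\<forall>z\<in>set (take s (dream_out (remove_nth j xs) g)). xs ! j < z"
    and "separated (xs ! j) (set (drop s (take q (dream_out (remove_nth j xs) g)))) (set (drop q (dream_out (remove_nth j xs) g)))"
  shows "dream_valid xs (insert_pipe j q g)"
  using assms
proof (induction j arbitrary: xs q g)
  case 0
  then obtain x xs' where "xs = x # xs'" by (cases xs) auto
  then show ?case
    using 0 by (auto simp: set_dream_out intro!: col_valid_drop_col)
next
  case (Suc j)
  then obtain x xs' n where xs: "xs = x # xs'" "length xs' = Suc n"
    by (cases xs; cases "tl xs") auto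
  define u where "u = dream_out (remove_nth j xs') (g \<circ> Suc)"
  have j: "j < length xs'" "x < xs' ! j" using Suc.prems xs by auto
  have g: "g 0 \<in> columns (length u)" "g \<circ> Suc \<in> dreams n"
    using Suc.prems xs j by (simp_all add: dreams_Suc_iff u_def)
  have len: "length u = n" using j xs by (simp add: u_def)
  have dist: "distinct xs'" using Suc.prems xs strict_sorted_iff by auto
  have "xs' ! j \<notin> set (remove_nth j xs')"
    using dist j(1) by (auto simp: remove_nth_def in_set_conv_nth nth_eq_iff_index_eq)
  then have y: "xs' ! j \<notin> set u" by (simp add: u_def set_dream_out)
  have q: "q \<le> Suc (length u)" "col_entry (g 0) q \<le> n"
    using columns_insert(2)[OF g(1), of q] Suc.prems xs len by simp_all
  have 1: "col_valid x (list_insert (col_entry (g 0) q) (xs' ! j) u) (col_insert (g 0) q) \<and>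
    separated (xs' ! j) (set (drop s (take (col_entry (g 0) q) u))) (set (drop (col_entry (g 0) q) u))"
    by (rule col_insert_valid) (use Suc.prems xs g q j y in \<open>simp_all add: u_def comp_def\<close>)
  have t: "take s u = take s (col_out x u (g 0))"
    by (rule take_col_out[symmetric, OF j(2)]) (use Suc.prems(6) xs in \<open>simp add: u_def\<close>)
  have out: "dream_out xs' (insert_pipe j (col_entry (g 0) q) (g \<circ> Suc)) =
      list_insert (col_entry (g 0) q) (xs' ! j) u"
    unfolding u_def using g q j(1) xs(2) by (intro dream_insert_pipe) auto
  have "dream_valid xs' (insert_pipe j (col_entry (g 0) q) (g \<circ> Suc))"
    by (rule Suc.IH) (use Suc.prems xs g q j 1 t in \<open>auto simp: u_def comp_def\<close>)
  then show ?case using 1 out by (simp add: xs comp_def)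
qed

text \<open>The prefix length \<open>s\<close> is chosen maximal, so the next pipe
  \<open>v ! s\<close>, if there is one, is smaller than \<open>y\<close>. It supplies the 1 of the
  pattern; a pair violating \<open>separated\<close> supplies the 4 and the 3, and \<open>y\<close>
  the 2.\<close>

lemma dream_valid_insert_avoids:
  assumes "sorted_wrt (<) xs" "j < length xs" "g \<in> dreams (length xs - 1)"
    and "dream_valid (remove_nth j xs) g" "q < length xs"
    and "avoids_1423 (list_insert q (xs ! j) (dream_out (remove_nth j xs) g))"
  shows "dream_valid xs (insert_pipe j q g)"
proof -
  define v where "v = dream_out (remove_nth j xs) g"
  define y where "y = xs ! j"
  define s where "s = length (takeWhile (\<lambda>z. y < z) v)"
  have dist: "distinct xs" using assms(1) strict_sorted_iff by auto
  have "y \<notin> set (remove_nth j xs)"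
    using dist assms(2) by (auto simp: y_def remove_nth_def in_set_conv_nth nth_eq_iff_index_eq)
  then have y: "y \<notin> set v" by (simp add: v_def set_dream_out)
  have len: "length v = length xs - 1" using assms(2) by (simp add: v_def)
  have nth: "list_insert q y v ! n = (if n < q then v ! n else if n = q then y else v ! (n - 1))"
    if "n < length xs" for n
    using that assms(5) len by (auto simp: list_insert_def nth_append nth_Cons' min_def)
  have clear: False
    if c: "c \<in> set (drop s (take q v))" and b: "b \<in> set (drop q v)" and yb: "y < b" "b < c" for b c
  proof -
    obtain m where "m < length (drop s (take q v))" "c = drop s (take q v) ! m"
      using c by (metis in_set_conv_nth)
    moreover from this(1) have "s + m < q" "s + m < length v" "s \<le> length (take q v)" by auto
    ultimately have m: "s + m < q" "s + m < length v" "c = v ! (s + m)" by simp_all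
    obtain r where "r < length (drop q v)" "b = drop q v ! r"
      using b by (metis in_set_conv_nth)
    then have r: "q + r < length v" "b = v ! (q + r)" by simp_all
    have "s < length v" using m by simp
    then have "\<not> y < v ! s" unfolding s_def by (rule nth_length_takeWhile)
    moreover have "v ! s \<noteq> y" using \<open>s < length v\<close> y nth_mem by metis
    ultimately have vs: "v ! s < y" by simp
    then have "m \<noteq> 0" using m yb by (cases m) auto
    \<comment> \<open>Inserting \<open>y\<close> shifts the entries from position \<open>q\<close>
      on, hence \<open>Suc (q + r)\<close> for \<open>b\<close>.\<close>
    then have "s < s + m \<and> s + m < q \<and> q < Suc (q + r) \<and> Suc (q + r) < length (list_insert q y v) \<and>
      list_insert q y v ! s < list_insert q y v ! q \<and>
      list_insert q y v ! q < list_insert q y v ! Suc (q + r) \<and>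
      list_insert q y v ! Suc (q + r) < list_insert q y v ! (s + m)"
      using m r vs yb len assms(2,5) by (auto simp: nth)
    then show False using assms(6) unfolding avoids_1423_def v_def[symmetric] y_def[symmetric] by blast
  qed
  show ?thesis
  proof (rule dream_valid_insert[OF assms(1-5), of s])
    show "\<forall>z\<in>set (take s (dream_out (remove_nth j xs) g)). xs ! j < z"
      using set_takeWhileD[of _ "\<lambda>z. y < z" v]
      unfolding s_def v_def[symmetric] y_def[symmetric] takeWhile_eq_take[symmetric] by blast
  qed (use clear in \<open>auto simp: separated_def v_def y_def\<close>)
qed

section \<open>Counting by sets of removable pipes\<close>

lemma subseqs_nth:
  assumes "v \<in> set (subseqs w)"
  obtains h where "strict_mono h" "\<And>i. i < length v \<Longrightarrow> h i < length w \<and> v ! i = w ! h i"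
proof -
  have "\<exists>h::nat \<Rightarrow> nat. strict_mono h \<and> (\<forall>i<length v. h i < length w \<and> v ! i = w ! h i)"
    using assms
  proof (induction w arbitrary: v)
    case Nil
    then show ?case by (auto intro: exI[of _ id] simp: strict_mono_def)
  next
    case (Cons x w)
    then consider v' where "v = x # v'" "v' \<in> set (subseqs w)" | "v \<in> set (subseqs w)"
      by (auto simp: Let_def)
    then show ?case
    proof cases
      case 1
      then obtain h :: "nat \<Rightarrow> nat"
        where h: "strict_mono h" "\<And>i. i < length v' \<Longrightarrow> h i < length w \<and> v' ! i = w ! h i"
        using Cons.IH by blast
      have "strict_mono (case_nat 0 (Suc \<circ> h))"
        using h(1) by (auto simp: strict_mono_Suc_iff split: nat.split)
      moreover have "case_nat 0 (Suc \<circ> h) i < length (x # w) \<and> v ! i = (x # w) ! case_nat 0 (Suc \<circ> h) i"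
        if "i < length v" for i
        using that h(2) 1(1) by (cases i) auto
      ultimately show ?thesis by blast
    next
      case 2
      then obtain h :: "nat \<Rightarrow> nat"
        where h: "strict_mono h" "\<And>i. i < length v \<Longrightarrow> h i < length w \<and> v ! i = w ! h i"
        using Cons.IH by blast
      then show ?thesis by (intro exI[of _ "Suc \<circ> h"]) (auto simp: strict_mono_def)
    qed
  qed
  then show ?thesis using that by blast
qed

lemma length_subseqs: "v \<in> set (subseqs w) \<Longrightarrow> length v \<le> length w"
  by (induction w arbitrary: v) (force simp: Let_def)+

lemma avoids_1423_subseqs:
  assumes "avoids_1423 w" "v \<in> set (subseqs w)"
  shows "avoids_1423 v"
  unfolding avoids_1423_def
proof (safe)
  fix a b c d
  assume *: "a < b" "b < c" "c < d" "d < length v" "v ! a < v ! c" "v ! c < v ! d" "v ! d < v ! b"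
  obtain h where h: "strict_mono h" "\<And>i. i < length v \<Longrightarrow> h i < length w \<and> v ! i = w ! h i"
    using subseqs_nth[OF assms(2)] by blast
  have "h a < h b" "h b < h c" "h c < h d" using h(1) * by (simp_all add: strict_mono_def)
  moreover have "h d < length w" "w ! h a < w ! h c" "w ! h c < w ! h d" "w ! h d < w ! h b"
    using * h(2)[of a] h(2)[of b] h(2)[of c] h(2)[of d] by auto
  ultimately show False using assms(1) unfolding avoids_1423_def by blast
qed

lemma filter_in_subseqs: "filter P v \<in> set (subseqs v)"
  by (induction v) (auto simp: Let_def)

lemma distinct_subseqs: "distinct w \<Longrightarrow> v \<in> set (subseqs w) \<Longrightarrow> distinct v"
  using subseqs_distinctD by blast

text \<open>Columns are labelled by the sorted letters of \<open>v\<close> rather than by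
  \<open>1, ..., length v\<close>, so that deleting a letter leaves the other labels alone.\<close>

definition dreams_of :: "nat list \<Rightarrow> (nat \<Rightarrow> nat \<Rightarrow> tile) set" where
  "dreams_of v = {g \<in> dreams (length v). dream_valid (sort v) g \<and> dream_out (sort v) g = v}"

text \<open>The threshold interpolates between all dreams of \<open>v\<close>, for \<open>k\<close>
  above every letter, and the core ones, for \<open>k = 0\<close>.\<close>

definition core_from :: "nat \<Rightarrow> nat list \<Rightarrow> (nat \<Rightarrow> nat \<Rightarrow> tile) set" where
  "core_from k v = {g \<in> dreams_of v. \<forall>j<length v. k \<le> sort v ! j \<longrightarrow> removable_exit j g = None}"

lemma finite_dreams_of: "finite (dreams_of v)"
  unfolding dreams_of_def using finite_dreams by simp

lemma finite_core_from: "finite (core_from k v)"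
  unfolding core_from_def using finite_dreams_of by simp

lemma remove_nth_list_insert: "q \<le> length u \<Longrightarrow> remove_nth q (list_insert q y u) = u"
  by (simp add: remove_nth_def list_insert_def)

lemma list_insert_remove_nth: "q < length v \<Longrightarrow> list_insert q (v ! q) (remove_nth q v) = v"
  by (simp add: remove_nth_def list_insert_def id_take_nth_drop[symmetric] min_def)

lemma nth_list_insert: "q \<le> length u \<Longrightarrow> list_insert q y u ! q = y"
  by (simp add: list_insert_def nth_append)

lemma filter_eq_remove_nth:
  assumes "distinct v" "q < length v"
  shows "filter (\<lambda>z. z \<noteq> v ! q) v = remove_nth q v"
proof -
  have v: "v = take q v @ v ! q # drop (Suc q) v" by (rule id_take_nth_drop[OF assms(2)])
  then have "distinct (take q v @ v ! q # drop (Suc q) v)" using assms(1) by metis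
  then have "v ! q \<notin> set (take q v) \<and> v ! q \<notin> set (drop (Suc q) v)" by simp
  then have "filter (\<lambda>z. z \<noteq> v ! q) (take q v) = take q v"
    "filter (\<lambda>z. z \<noteq> v ! q) (drop (Suc q) v) = drop (Suc q) v"
    by (metis (mono_tags, lifting) filter_True)+
  then have "filter (\<lambda>z. z \<noteq> v ! q) (take q v @ v ! q # drop (Suc q) v) = take q v @ drop (Suc q) v"
    by simp
  then show ?thesis using v unfolding remove_nth_def by metis
qed

lemma strict_sorted_sort: "distinct v \<Longrightarrow> sorted_wrt (<) (sort v)"
  by (simp add: strict_sorted_iff)

lemma sort_filter: "sort (filter P v) = filter P (sort v)"
  by (simp add: filter_sort)

lemma strict_sorted_le_nth:
  fixes xs :: "nat list"
  assumes "sorted_wrt (<) xs" "j < length xs" "l < length xs"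
  shows "xs ! j \<le> xs ! l \<longleftrightarrow> Suc (xs ! j) \<le> xs ! l \<or> l = j"
proof -
  have "xs ! l = xs ! j \<longleftrightarrow> l = j"
    using assms by (intro nth_eq_iff_index_eq) (simp_all add: strict_sorted_iff)
  then show ?thesis by linarith
qed

text \<open>The difference consists of the dreams in which \<open>y\<close> is removable but no
  larger pipe is. Deleting \<open>y\<close> matches them with the dreams of the shorter word that
  have no removable pipe above \<open>y\<close>: \<open>removable_exit_delete\<close> transfers the
  condition on larger pipes, and avoidance of 1423 makes every insertion valid.\<close>

lemma core_from_bij:
  assumes "distinct v" "avoids_1423 v" "y \<in> set v"
  obtains h where "bij_betw h (core_from y (filter (\<lambda>z. z \<noteq> y) v)) (core_from (Suc y) v - core_from y v)"
    and "\<And>g. g \<in> core_from y (filter (\<lambda>z. z \<noteq> y) v) \<Longrightarrow> marks (h g) = marks g"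
proof -
  define xs where "xs = sort v"
  obtain j where j: "j < length xs" "xs ! j = y" using assms(3) unfolding xs_def by (metis in_set_conv_nth set_sort)
  obtain q where q: "q < length v" "v ! q = y" using assms(3) by (metis in_set_conv_nth)
  have xs: "sorted_wrt (<) xs" "distinct xs" "length xs = length v"
    using assms(1) strict_sorted_sort by (auto simp: xs_def)
  have v': "filter (\<lambda>z. z \<noteq> y) v = remove_nth q v"
    using filter_eq_remove_nth[OF assms(1) q(1)] q(2) by simp
  have xs': "sort (remove_nth q v) = remove_nth j xs"
    using filter_eq_remove_nth[OF xs(2) j(1)] j(2) unfolding v'[symmetric] sort_filter xs_def by simp
  define n where "n = length v - 1"
  have n: "length v = Suc n" "length xs = Suc n" "length (remove_nth q v) = n" "j \<le> n" "q \<le> n"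
    using q j xs by (auto simp: n_def)
  have mem': "g \<in> dreams_of (remove_nth q v) \<longleftrightarrow> g \<in> dreams n \<and>
      dream_valid (remove_nth j xs) g \<and> dream_out (remove_nth j xs) g = remove_nth q v" for g
    by (simp add: dreams_of_def xs' n)
  have mem: "g \<in> dreams_of v \<longleftrightarrow> g \<in> dreams (Suc n) \<and> dream_valid xs g \<and> dream_out xs g = v" for g
    by (simp add: dreams_of_def xs_def n)
  have insert: "insert_pipe j q g \<in> dreams_of v" if "g \<in> dreams_of (remove_nth q v)" for g
  proof -
    have g: "g \<in> dreams n" "dream_valid (remove_nth j xs) g" "dream_out (remove_nth j xs) g = remove_nth q v"
      using that mem' by auto
    have "list_insert q (xs ! j) (dream_out (remove_nth j xs) g) = v"
      using list_insert_remove_nth[OF q(1)] by (simp add: g(3) q(2) j(2))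
    then show ?thesis
      unfolding mem
      using dream_valid_insert_avoids[OF xs(1) j(1), of g q] dream_insert_pipe(1)[of g xs j q]
        insert_pipe_dreams[of g n j q] g n assms(2) j(1)
      by simp
  qed
  have delete: "delete_pipe j g \<in> dreams_of (remove_nth q v) \<and> r = q"
    if g: "g \<in> dreams_of v" and r: "removable_exit j g = Some r" for g r
  proof -
    have d: "delete_pipe j g \<in> dreams n" "r \<le> n"
      using delete_pipe_dreams[of g n j r] g mem n r by auto
    have g_eq: "g = insert_pipe j r (delete_pipe j g)" using insert_delete_pipe[OF r] by simp
    have out: "v = list_insert r y (dream_out (remove_nth j xs) (delete_pipe j g))"
    proof -
      have "dream_out xs (insert_pipe j r (delete_pipe j g)) =
          list_insert r (xs ! j) (dream_out (remove_nth j xs) (delete_pipe j g))"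
        by (rule dream_insert_pipe(1)) (use d n j in simp_all)
      then show ?thesis using g mem j insert_delete_pipe[OF r] by simp
    qed
    have "length (dream_out (remove_nth j xs) (delete_pipe j g)) = n" using n j by simp
    then have "v ! r = y" using out nth_list_insert d(2) by metis
    \<comment> \<open>The exit row of a removable \<open>y\<close> is its position in
      \<open>v\<close>, so each dream of the shorter word has only one preimage to offer.\<close>
    then have rq: "r = q" using q assms(1) d(2) n(1) nth_eq_iff_index_eq[OF assms(1), of r q] by simp
    have "dream_valid (remove_nth j xs) (delete_pipe j g)"
      using dream_insert_pipe(2)[of "delete_pipe j g" xs j r] d n g mem g_eq j by simp
    moreover have "dream_out (remove_nth j xs) (delete_pipe j g) = remove_nth q v"
      using out rq remove_nth_list_insert n d(2) \<open>length (dream_out _ _) = n\<close> by metis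
    ultimately show ?thesis using d(1) rq mem' by simp
  qed
  have larger: "y < xs ! l \<longleftrightarrow> j < l" if "l < length xs" for l
    using that xs(1) j sorted_wrt_nth_less[OF xs(1)] by (metis not_less_iff_gr_or_eq)
  have nth': "remove_nth j xs ! l = (if l < j then xs ! l else xs ! Suc l)" if "l < n" for l
    using that j(1) n by (auto simp: remove_nth_def nth_append min_def)
  have large': "y \<le> remove_nth j xs ! l \<longleftrightarrow> j \<le> l" if "l < n" for l
    using that larger[of l] larger[of "Suc l"] n j sorted_wrt_nth_less[OF xs(1), of l j]
    by (auto simp: nth' not_le)
  \<comment> \<open>The index drops from \<open>Suc l\<close> to \<open>l\<close> because column
    \<open>j\<close> disappears.\<close>
  have none: "removable_exit (Suc l) (insert_pipe j q g) = None \<longleftrightarrow> removable_exit l g = None"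
    if "j \<le> l" for l g
    using removable_exit_delete[OF removable_exit_insert that, of q g] by (simp add: delete_insert_pipe)
  have core: "g \<in> core_from (Suc y) v - core_from y v \<longleftrightarrow> g \<in> dreams_of v \<and>
      removable_exit j g \<noteq> None \<and> (\<forall>l<n. j \<le> l \<longrightarrow> removable_exit (Suc l) g = None)" for g
  proof -
    have larger_iff: "(\<forall>l<length v. Suc y \<le> xs ! l \<longrightarrow> removable_exit l g = None) \<longleftrightarrow>
        (\<forall>l<n. j \<le> l \<longrightarrow> removable_exit (Suc l) g = None)"
    proof (intro iffI allI impI)
      fix l assume *: "\<forall>l<length v. Suc y \<le> xs ! l \<longrightarrow> removable_exit l g = None" "l < n" "j \<le> l"
      then show "removable_exit (Suc l) g = None" using larger[of "Suc l"] n by auto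
    next
      fix l assume *: "\<forall>l<n. j \<le> l \<longrightarrow> removable_exit (Suc l) g = None" "l < length v" "Suc y \<le> xs ! l"
      then have "j < l" using larger[of l] n by simp
      then show "removable_exit l g = None" using * n by (cases l) auto
    qed
    have eq: "y \<le> xs ! l \<longleftrightarrow> Suc y \<le> xs ! l \<or> l = j" if "l < length v" for l
      using strict_sorted_le_nth[OF xs(1) j(1), of l] that unfolding j(2) xs(3) by blast
    have from_iff: "(\<forall>l<length v. y \<le> xs ! l \<longrightarrow> removable_exit l g = None) \<longleftrightarrow>
        (\<forall>l<length v. Suc y \<le> xs ! l \<longrightarrow> removable_exit l g = None) \<and> removable_exit j g = None"
    proof (intro iffI conjI allI impI)
      fix l assume h: "\<forall>l<length v. y \<le> xs ! l \<longrightarrow> removable_exit l g = None"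
        and l: "l < length v" "Suc y \<le> xs ! l"
      show "removable_exit l g = None" by (rule h[rule_format, OF l(1) Suc_leD[OF l(2)]])
    next
      assume h: "\<forall>l<length v. y \<le> xs ! l \<longrightarrow> removable_exit l g = None"
      show "removable_exit j g = None"
        by (rule h[rule_format]) (simp_all only: j(2) order.refl j(1)[unfolded xs(3)])
    next
      fix l assume h: "(\<forall>l<length v. Suc y \<le> xs ! l \<longrightarrow> removable_exit l g = None) \<and> removable_exit j g = None"
        and l: "l < length v" "y \<le> xs ! l"
      from eq[OF l(1)] l(2) consider "Suc y \<le> xs ! l" | "l = j" by metis
      then show "removable_exit l g = None"
      proof cases
        case 1
        then show ?thesis by (rule conjunct1[OF h, rule_format, OF l(1)])
      next
        case 2
        then show ?thesis by (simp only: conjunct2[OF h])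
      qed
    qed
    have taut: "(D \<and> Q) \<and> \<not> (D \<and> Q \<and> R) \<longleftrightarrow> D \<and> \<not> R \<and> Q" for D Q R by blast
    show ?thesis
      unfolding core_from_def xs_def[symmetric] Diff_iff mem_Collect_eq from_iff larger_iff by (rule taut)
  qed
  have core': "g \<in> core_from y (remove_nth q v) \<longleftrightarrow> g \<in> dreams_of (remove_nth q v) \<and>
      (\<forall>l<n. j \<le> l \<longrightarrow> removable_exit l g = None)" for g
    unfolding core_from_def xs' n(3) using large' by auto
  show ?thesis
  proof (rule that, unfold v')
    show "bij_betw (insert_pipe j q) (core_from y (remove_nth q v)) (core_from (Suc y) v - core_from y v)"
    proof (rule bij_betw_byWitness[of _ "delete_pipe j"])
      show "\<forall>g\<in>core_from y (remove_nth q v). delete_pipe j (insert_pipe j q g) = g"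
        by (simp add: delete_insert_pipe)
      show "\<forall>g\<in>core_from (Suc y) v - core_from y v. insert_pipe j q (delete_pipe j g) = g"
      proof
        fix g assume "g \<in> core_from (Suc y) v - core_from y v"
        then obtain r where "g \<in> dreams_of v" "removable_exit j g = Some r" unfolding core by blast
        then show "insert_pipe j q (delete_pipe j g) = g" using delete insert_delete_pipe by blast
      qed
      show "insert_pipe j q ` core_from y (remove_nth q v) \<subseteq> core_from (Suc y) v - core_from y v"
      proof (rule image_subsetI)
        fix g assume "g \<in> core_from y (remove_nth q v)"
        then show "insert_pipe j q g \<in> core_from (Suc y) v - core_from y v"
          unfolding core core' using insert
          by (simp add: none removable_exit_insert del: removable_exit.simps)
      qed
      show "delete_pipe j ` (core_from (Suc y) v - core_from y v) \<subseteq> core_from y (remove_nth q v)"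
      proof (rule image_subsetI)
        fix g assume g: "g \<in> core_from (Suc y) v - core_from y v"
        then obtain r where r: "g \<in> dreams_of v" "removable_exit j g = Some r" unfolding core by blast
        have "removable_exit l (delete_pipe j g) = None" if "l < n" "j \<le> l" for l
          using g that removable_exit_delete[OF r(2) that(2)] unfolding core
          by (simp del: removable_exit.simps)
        then show "delete_pipe j g \<in> core_from y (remove_nth q v)"
          unfolding core' using delete[OF r] by blast
      qed
    qed
    show "marks (insert_pipe j q g) = marks g" if "g \<in> core_from y (remove_nth q v)" for g
      using that marks_insert_pipe[of g n j q] n unfolding core' mem' by simp
  qed
qed

definition weight_sum :: "'b::comm_ring_1 \<Rightarrow> (nat \<Rightarrow> nat \<Rightarrow> tile) set \<Rightarrow> 'b" where
  "weight_sum \<beta> A = (\<Sum>g\<in>A. \<beta> ^ marks g)"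

lemma core_from_absent:
  assumes "y \<notin> set v"
  shows "core_from (Suc y) v = core_from y v"
proof -
  have "y \<le> sort v ! l \<longleftrightarrow> Suc y \<le> sort v ! l" if "l < length v" for l
  proof -
    have "sort v ! l \<noteq> y" using assms that nth_mem[of l "sort v"] by auto
    then show ?thesis by linarith
  qed
  then show ?thesis unfolding core_from_def by blast
qed

lemma core_from_Suc:
  assumes "distinct v" "avoids_1423 v" "y \<in> set v"
  shows "weight_sum \<beta> (core_from (Suc y) v) =
    weight_sum \<beta> (core_from y v) + weight_sum \<beta> (core_from (Suc y) (filter (\<lambda>z. z \<noteq> y) v))"
proof -
  let ?v = "filter (\<lambda>z. z \<noteq> y) v"
  obtain h where h: "bij_betw h (core_from y ?v) (core_from (Suc y) v - core_from y v)"
    "\<And>g. g \<in> core_from y ?v \<Longrightarrow> marks (h g) = marks g"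
    using core_from_bij[OF assms] by blast
  have sub: "core_from y v \<subseteq> core_from (Suc y) v" unfolding core_from_def by auto
  have "core_from (Suc y) ?v = core_from y ?v" by (rule core_from_absent) simp
  moreover have "weight_sum \<beta> (core_from (Suc y) v - core_from y v) = weight_sum \<beta> (core_from y ?v)"
    unfolding weight_sum_def by (subst sum.reindex_bij_betw[OF h(1), symmetric]) (simp add: h(2))
  moreover have "weight_sum \<beta> (core_from (Suc y) v) =
      weight_sum \<beta> (core_from y v) + weight_sum \<beta> (core_from (Suc y) v - core_from y v)"
    unfolding weight_sum_def by (subst add.commute, rule sum.subset_diff[OF sub finite_core_from])
  ultimately show ?thesis by simp
qed

text \<open>Repeated use of \<open>core_from_Suc\<close> decides for each label below
  \<open>k\<close> whether its pipe stays or is deleted; \<open>S\<close> records the deleted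
  ones.\<close>

lemma weight_sum_core_from:
  assumes "distinct v" "avoids_1423 v"
  shows "weight_sum \<beta> (core_from k v) =
    (\<Sum>S\<in>Pow {x \<in> set v. x < k}. weight_sum \<beta> (core_from 0 (filter (\<lambda>x. x \<notin> S) v)))"
  using assms
proof (induction k arbitrary: v)
  case (Suc k)
  show ?case
  proof (cases "k \<in> set v")
    case False
    then have "{x \<in> set v. x < Suc k} = {x \<in> set v. x < k}" by (auto simp: less_Suc_eq)
    then show ?thesis using Suc False by (simp add: core_from_absent)
  next
    case True
    let ?A = "{x \<in> set v. x < k}" and ?v = "filter (\<lambda>z. z \<noteq> k) v"
    have A: "{x \<in> set v. x < Suc k} = insert k ?A" using True by (auto simp: less_Suc_eq)
    have "avoids_1423 ?v" using avoids_1423_subseqs[OF Suc.prems(2) filter_in_subseqs] .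
    then have IH: "weight_sum \<beta> (core_from k ?v) =
        (\<Sum>S\<in>Pow {x \<in> set ?v. x < k}. weight_sum \<beta> (core_from 0 (filter (\<lambda>x. x \<notin> S) ?v)))"
      using Suc.prems(1) by (intro Suc.IH) simp_all
    have "{x \<in> set ?v. x < k} = ?A" by auto
    moreover have "filter (\<lambda>x. x \<notin> S) ?v = filter (\<lambda>x. x \<notin> insert k S) v" for S
      by (simp add: conj_commute)
    ultimately have IH': "weight_sum \<beta> (core_from k ?v) =
        (\<Sum>S\<in>Pow ?A. weight_sum \<beta> (core_from 0 (filter (\<lambda>x. x \<notin> insert k S) v)))"
      using IH by simp
    have inj: "inj_on (insert k) (Pow ?A)" by (auto simp: inj_on_def)
    have "(\<Sum>S\<in>Pow (insert k ?A). weight_sum \<beta> (core_from 0 (filter (\<lambda>x. x \<notin> S) v))) =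
        (\<Sum>S\<in>Pow ?A. weight_sum \<beta> (core_from 0 (filter (\<lambda>x. x \<notin> S) v))) +
        (\<Sum>S\<in>insert k ` Pow ?A. weight_sum \<beta> (core_from 0 (filter (\<lambda>x. x \<notin> S) v)))"
      unfolding Pow_insert by (rule sum.union_disjoint) auto
    also have "\<dots> = weight_sum \<beta> (core_from k v) + weight_sum \<beta> (core_from k ?v)"
      unfolding IH' using Suc by (simp add: sum.reindex[OF inj])
    finally show ?thesis
      using core_from_Suc[OF Suc.prems True, of \<beta>] by (simp add: A core_from_absent)
  qed
qed simp

section \<open>Sums over subwords and their inversion\<close>

lemma sum_subseqs_Pow:
  "distinct v \<Longrightarrow> (\<Sum>u\<leftarrow>subseqs v. F u) = (\<Sum>S\<in>Pow (set v). F (filter (\<lambda>x. x \<notin> S) v))"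
  for F :: "'c list \<Rightarrow> 'b::comm_monoid_add"
proof (induction v arbitrary: F)
  case (Cons x v)
  have inj: "inj_on (insert x) (Pow (set v))" using Cons.prems by (auto simp: inj_on_def)
  have 1: "(\<Sum>S\<in>Pow (set v). F (filter (\<lambda>y. y \<notin> S) (x # v))) = (\<Sum>S\<in>Pow (set v). F (x # filter (\<lambda>y. y \<notin> S) v))"
    using Cons.prems by (intro sum.cong refl) auto
  have 2: "(\<Sum>S\<in>insert x ` Pow (set v). F (filter (\<lambda>y. y \<notin> S) (x # v))) = (\<Sum>S\<in>Pow (set v). F (filter (\<lambda>y. y \<notin> S) v))"
  proof -
    have "filter (\<lambda>y. y \<notin> insert x S) (x # v) = filter (\<lambda>y. y \<notin> S) v" for S
      using Cons.prems by (auto intro!: filter_cong)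
    then show ?thesis by (simp add: sum.reindex[OF inj])
  qed
  have "(\<Sum>S\<in>Pow (set (x # v)). F (filter (\<lambda>y. y \<notin> S) (x # v))) =
      (\<Sum>S\<in>Pow (set v). F (filter (\<lambda>y. y \<notin> S) (x # v))) +
      (\<Sum>S\<in>insert x ` Pow (set v). F (filter (\<lambda>y. y \<notin> S) (x # v)))"
    unfolding list.set(2) Pow_insert using Cons.prems by (intro sum.union_disjoint) auto
  then show ?case
    unfolding 1 2 using Cons.IH[of F] Cons.IH[of "\<lambda>u. F (x # u)"] Cons.prems
    by (simp add: Let_def comp_def)
qed simp

lemma weight_sum_dreams_of:
  assumes "distinct v" "avoids_1423 v"
  shows "weight_sum \<beta> (dreams_of v) = (\<Sum>u\<leftarrow>subseqs v. weight_sum \<beta> (core_from 0 u))"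
proof -
  \<comment> \<open>\<open>insert 0\<close> keeps \<open>Max\<close> meaningful for the empty
    word.\<close>
  define k where "k = Suc (Max (insert 0 (set v)))"
  have k: "x < k" if "x \<in> set v" for x
    using that by (simp add: k_def less_Suc_eq_le)
  then have "sort v ! l < k" if "l < length v" for l
    using that nth_mem[of l "sort v"] by simp
  then have "core_from k v = dreams_of v"
    unfolding core_from_def by (auto simp: not_le[symmetric])
  moreover have "{x \<in> set v. x < k} = set v" using k by auto
  ultimately show ?thesis
    using weight_sum_core_from[OF assms, of \<beta> k] sum_subseqs_Pow[OF assms(1), of "\<lambda>u. weight_sum \<beta> (core_from 0 u)"]
    by simp
qed

text \<open>Subwords are split by the choice made for the first letter \<open>x\<close>. Those that
  skip it carry an extra sign and give \<open>- F w\<close>; those that take it give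
  \<open>F (x # w) + F w\<close>.\<close>

lemma moebius_subseqs:
  "(\<Sum>v\<leftarrow>subseqs w. (-1) ^ (length w - length v) * (\<Sum>u\<leftarrow>subseqs v. F u)) = F w"
  for F :: "'c list \<Rightarrow> 'b::comm_ring_1"
proof (induction w arbitrary: F)
  case (Cons x w)
  let ?s = "\<lambda>v. (-1) ^ (length w - length v) :: 'b"
  have len: "length v \<le> length w" if "v \<in> set (subseqs w)" for v
    using that by (rule length_subseqs)
  have "(\<Sum>v\<leftarrow>subseqs w. (-1) ^ (length (x # w) - length v) * (\<Sum>u\<leftarrow>subseqs v. F u)) =
      (\<Sum>v\<leftarrow>subseqs w. - (?s v * (\<Sum>u\<leftarrow>subseqs v. F u)))"
    by (intro arg_cong[of _ _ sum_list] map_cong refl) (simp add: Suc_diff_le len)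
  also have "\<dots> = - (\<Sum>v\<leftarrow>subseqs w. ?s v * (\<Sum>u\<leftarrow>subseqs v. F u))"
    by (simp add: uminus_sum_list_map comp_def)
  finally have 1: "(\<Sum>v\<leftarrow>subseqs w. (-1) ^ (length (x # w) - length v) * (\<Sum>u\<leftarrow>subseqs v. F u)) = - F w"
    by (simp add: Cons.IH)
  have "(\<Sum>v\<leftarrow>subseqs w. ?s v * (\<Sum>u\<leftarrow>subseqs (x # v). F u)) =
      (\<Sum>v\<leftarrow>subseqs w. ?s v * (\<Sum>u\<leftarrow>subseqs v. F (x # u)) + ?s v * (\<Sum>u\<leftarrow>subseqs v. F u))"
    by (simp add: Let_def comp_def distrib_left)
  also have "\<dots> = F (x # w) + F w"
    by (simp add: sum_list_addf Cons.IH[of F] Cons.IH[of "\<lambda>u. F (x # u)"])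
  finally have 2: "(\<Sum>v\<leftarrow>subseqs w. ?s v * (\<Sum>u\<leftarrow>subseqs (x # v). F u)) = F (x # w) + F w" .
  show ?case
    using 1 2 by (simp add: Let_def comp_def del: subseqs.simps(2)) (simp add: Let_def comp_def)
qed simp

section \<open>Paths of pipes\<close>

definition path_state :: "(nat \<times> nat) set \<Rightarrow> nat \<Rightarrow> nat \<Rightarrow> nat \<times> nat \<times> bool" where
  "path_state C j n = (pd_step C ^^ n) (1, j, True)"

abbreviation row :: "nat \<times> nat \<times> bool \<Rightarrow> nat" where "row s \<equiv> fst s"
abbreviation column :: "nat \<times> nat \<times> bool \<Rightarrow> nat" where "column s \<equiv> fst (snd s)"
abbreviation from_top :: "nat \<times> nat \<times> bool \<Rightarrow> bool" where "from_top s \<equiv> snd (snd s)"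

abbreviation tile :: "nat \<times> nat \<times> bool \<Rightarrow> nat \<times> nat" where "tile s \<equiv> (row s, column s)"

text \<open>\<open>pd_step\<close> goes on in column 0 after a pipe has left; this predicate admits
  the times up to and including the first state in column 0.\<close>

definition inside :: "(nat \<times> nat) set \<Rightarrow> nat \<Rightarrow> nat \<Rightarrow> bool" where
  "inside C j n \<longleftrightarrow> (\<forall>n'<n. 0 < column (path_state C j n'))"

definition triangle :: "nat \<Rightarrow> (nat \<times> nat) set" where
  "triangle m = {(i, k). 1 \<le> i \<and> 1 \<le> k \<and> i + k \<le> m}"

lemma path_state_0 [simp]: "path_state C j 0 = (1, j, True)"
  by (simp add: path_state_def)

lemma path_state_Suc: "path_state C j (Suc n) = pd_step C (path_state C j n)"
  by (simp add: path_state_def)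

lemma inside_Suc: "inside C j (Suc n) \<longleftrightarrow> inside C j n \<and> 0 < column (path_state C j n)"
  by (auto simp: inside_def less_Suc_eq)

lemma inside_mono: "inside C j n \<Longrightarrow> n' \<le> n \<Longrightarrow> inside C j n'"
  by (auto simp: inside_def)

lemma pd_step_eq: "pd_step C s = (if tile s \<in> C \<longleftrightarrow> from_top s then (Suc (row s), column s, True)
    else (row s, column s - 1, False))"
  by (cases s) auto

text \<open>A step goes one row down or one column left, so the tile determines the time.
  Antidiagonal tiles are reached from above only and, being bumps, send the pipe left, which keeps
  the path in the staircase.\<close>

lemma path_invariant:
  assumes C: "C \<subseteq> triangle m" and j: "1 \<le> j" "j \<le> m" and "inside C j n"
  shows "1 \<le> row (path_state C j n) \<and> row (path_state C j n) + j = n + 1 + column (path_state C j n) \<and>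
    (if from_top (path_state C j n) then 1 \<le> column (path_state C j n) \<and>
       row (path_state C j n) + column (path_state C j n) \<le> m + 1 \<and> (0 < n \<longrightarrow> 1 < row (path_state C j n))
     else row (path_state C j n) + column (path_state C j n) \<le> m)"
  using assms(4)
proof (induction n)
  case (Suc n)
  obtain i k t where s: "path_state C j n = (i, k, t)" by (metis prod_cases3)
  have "(i, k) \<in> C \<Longrightarrow> i + k \<le> m" using C by (auto simp: triangle_def)
  then show ?case
    using Suc by (auto simp: path_state_Suc s inside_Suc split: if_splits)
qed (use j in simp)

lemma path_row_mono:
  assumes "n \<le> n'"
  shows "row (path_state C j n) \<le> row (path_state C j n')"
  using assms by (induction rule: dec_induct) (auto simp: path_state_Suc pd_step_eq)

lemma exists_exit_time:
  assumes C: "C \<subseteq> triangle m" and j: "1 \<le> j" "j \<le> m"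
  shows "\<exists>L<2 * m + 2. inside C j L \<and> column (path_state C j L) = 0"
proof -
  have "\<not> inside C j (2 * m + 1)"
  proof
    assume "inside C j (2 * m + 1)"
    then show False using path_invariant[OF assms, of "2 * m + 1"] j by (auto split: if_splits)
  qed
  then have ex: "\<exists>n. column (path_state C j n) = 0 \<and> n < 2 * m + 1" by (auto simp: inside_def)
  define L where "L = (LEAST n. column (path_state C j n) = 0)"
  obtain n where n: "column (path_state C j n) = 0" "n < 2 * m + 1" using ex by blast
  have "column (path_state C j L) = 0" unfolding L_def by (rule LeastI, rule n(1))
  moreover have "inside C j L" unfolding inside_def L_def using not_less_Least by blast
  moreover have "L < 2 * m + 1" 
    unfolding L_def using Least_le[of "\<lambda>n. column (path_state C j n) = 0", OF n(1)] n(2) by simp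
  ultimately show ?thesis by (intro exI[of _ L]) simp
qed

lemma pipe_path_eq:
  assumes "L < 2 * m + 2" "inside C j L" "column (path_state C j L) = 0"
  shows "pipe_path C m j = map (path_state C j) [0..<L]"
proof -
  have upt: "[0..<2 * m + 2] = [0..<L] @ L # [Suc L..<2 * m + 2]"
    using assms(1) by (metis le0 less_imp_le_nat upt_add_eq_append upt_conv_Cons le_add_diff_inverse)
  have fun_eq: "(\<lambda>(i, k, t). 0 < k) = (\<lambda>s :: nat \<times> nat \<times> bool. 0 < column s)" by auto
  show ?thesis
    unfolding pipe_path_def path_state_def[symmetric] upt map_append fun_eq
    using assms(2,3) by (subst takeWhile_append2) (auto simp: inside_def)
qed

definition visits :: "(nat \<times> nat) set \<Rightarrow> nat \<Rightarrow> nat \<times> nat \<times> bool \<Rightarrow> bool" where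
  "visits C j s \<longleftrightarrow> (\<exists>n. inside C j n \<and> path_state C j n = s)"

lemma set_pipe_path:
  assumes "C \<subseteq> triangle m" "1 \<le> j" "j \<le> m"
  shows "s \<in> set (pipe_path C m j) \<longleftrightarrow> visits C j s \<and> 0 < column s"
proof -
  obtain L where L: "L < 2 * m + 2" "inside C j L" "column (path_state C j L) = 0"
    using exists_exit_time[OF assms] by blast
  have lt: "n < L" if "inside C j n" "0 < column (path_state C j n)" for n
    using that L(3) by (metis inside_def linorder_neqE_nat less_irrefl)
  have "s \<in> set (pipe_path C m j) \<longleftrightarrow> (\<exists>n<L. s = path_state C j n)"
    using pipe_path_eq[OF L] by auto
  also have "\<dots> \<longleftrightarrow> (\<exists>n. inside C j n \<and> path_state C j n = s) \<and> 0 < column s"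
    using lt L(2) inside_mono[OF L(2)] by (metis inside_def less_imp_le_nat)
  finally show ?thesis by (simp add: visits_def)
qed

lemma exit_row_eqI:
  assumes "C \<subseteq> triangle m" "1 \<le> j" "j \<le> m" "visits C j (i, 0, False)"
  shows "exit_row C m j = i"
proof -
  obtain L where L: "L < 2 * m + 2" "inside C j L" "column (path_state C j L) = 0"
    using exists_exit_time[OF assms(1-3)] by blast
  obtain n where n: "inside C j n" "path_state C j n = (i, 0, False)"
    using assms(4) unfolding visits_def by blast
  have "n = L" using n L by (metis fst_conv snd_conv inside_def linorder_neqE_nat less_irrefl)
  have "exit_row C m j = row (path_state C j L)"
    unfolding exit_row_def path_state_def[symmetric] pipe_path_eq[OF L] by simp
  then show ?thesis using n(2) \<open>n = L\<close> by simp
qed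

lemma traverses_iff:
  assumes "C \<subseteq> triangle m" "1 \<le> j" "j \<le> m" "0 < k"
  shows "traverses C m j (i, k) \<longleftrightarrow> (\<exists>t. visits C j (i, k, t))"
  using set_pipe_path[OF assms(1-3)] assms(4) by (simp add: traverses_def)

text \<open>Position along the antidiagonal on which the tiles with a fixed \<open>row - column\<close> lie: every pipe
  passes one such tile at a time, and the top edge of a tile precedes its right edge.\<close>
definition position :: "nat \<times> nat \<times> bool \<Rightarrow> nat" where
  "position s = (if from_top s then 2 * row s - 1 else 2 * row s)"

text \<open>Pipe \<open>b\<close> reaches a given diagonal \<open>b - a\<close> steps later than
  pipe \<open>a\<close>, so a common tile is visited at times \<open>n\<close> and
  \<open>n + (b - a)\<close>.\<close>

definition crossing_times :: "(nat \<times> nat) set \<Rightarrow> nat \<Rightarrow> nat \<Rightarrow> nat set" where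
  "crossing_times C a b = {n. inside C a (Suc n) \<and> inside C b (Suc (n + (b - a))) \<and>
     tile (path_state C a n) = tile (path_state C b (n + (b - a))) \<and> tile (path_state C a n) \<in> C}"

text \<open>Pipe \<open>a\<close> starts at the least position, the top edge of row 1, where
  \<open>b\<close> cannot be at that time. On different tiles a step preserves the order; on a
  common tile a bump preserves it and a crossing reverses it.\<close>

lemma position_parity:
  assumes C: "C \<subseteq> triangle m" and ab: "1 \<le> a" "a < b" "b \<le> m"
    and "inside C a (Suc n)" "inside C b (Suc (n + (b - a)))"
  shows "position (path_state C a n) \<noteq> position (path_state C b (n + (b - a))) \<and>
    (position (path_state C a n) < position (path_state C b (n + (b - a))) \<longleftrightarrow>
     even (card (crossing_times C a b \<inter> {..<n})))"
  using assms(5,6)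
proof (induction n)
  case 0
  obtain i k t where s: "path_state C b (b - a) = (i, k, t)" by (metis prod_cases3)
  have "inside C b (b - a)" using 0 by (simp add: inside_Suc)
  then have "1 \<le> i \<and> (t \<longrightarrow> 1 < i)"
    using path_invariant[OF C _ ab(3), of "b - a"] ab s by (auto split: if_splits)
  then show ?case by (auto simp: s position_def)
next
  case (Suc n)
  define d where "d = b - a"
  have ins: "inside C a (Suc n)" "inside C b (Suc (n + d))"
    using Suc.prems by (simp_all add: inside_Suc d_def)
  obtain i k t where s: "path_state C a n = (i, k, t)" by (metis prod_cases3)
  obtain i' k' t' where s': "path_state C b (n + d) = (i', k', t')" by (metis prod_cases3)
  have inv: "1 \<le> i" "i + a = n + 1 + k" "1 \<le> i'" "i' + b = n + d + 1 + k'" "0 < k" "0 < k'"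
    using path_invariant[OF C, of a n] path_invariant[OF C, of b "n + d"] ab ins s s'
    by (auto simp: inside_Suc)
  then have eq: "i = i' \<longleftrightarrow> k = k'" and lt: "i < i' \<longleftrightarrow> k < k'" using ab by (auto simp: d_def)
  let ?X = "crossing_times C a b"
  have IH: "position (i, k, t) \<noteq> position (i', k', t')"
    "position (i, k, t) < position (i', k', t') \<longleftrightarrow> even (card (?X \<inter> {..<n}))"
    using Suc.IH ins s s' by (simp_all add: d_def)
  have X: "?X \<inter> {..<Suc n} = (if i = i' \<and> (i, k) \<in> C then insert n (?X \<inter> {..<n}) else ?X \<inter> {..<n})"
    using ins s s' eq by (auto simp: crossing_times_def d_def less_Suc_eq)
  have cX: "card (?X \<inter> {..<Suc n}) = (if i = i' \<and> (i, k) \<in> C then Suc (card (?X \<inter> {..<n})) else card (?X \<inter> {..<n}))"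
    unfolding X by (cases "i = i' \<and> (i, k) \<in> C") simp_all
  have step: "path_state C a (Suc n) = pd_step C (i, k, t)" "path_state C b (Suc n + d) = pd_step C (i', k', t')"
    by (simp_all add: path_state_Suc s s')
  consider "i = i'" "k = k'" | "i < i'" | "i' < i" using eq by linarith
  then have "position (pd_step C (i, k, t)) \<noteq> position (pd_step C (i', k', t')) \<and>
    (position (pd_step C (i, k, t)) < position (pd_step C (i', k', t')) \<longleftrightarrow> even (card (?X \<inter> {..<Suc n})))"
  proof cases
    case 1
    then show ?thesis using IH inv unfolding cX
      by (cases t; cases t') (auto simp: position_def)
  next
    case 2
    have "position (i, k, t) < position (i', k', t')" using 2 by (auto simp: position_def)
    moreover have "position (pd_step C (i, k, t)) < position (pd_step C (i', k', t'))"
      using 2 by (auto simp: position_def pd_step_eq)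
    ultimately show ?thesis using IH 2 unfolding cX by simp
  next
    case 3
    have "position (i', k', t') < position (i, k, t)" using 3 by (auto simp: position_def)
    moreover have "position (pd_step C (i', k', t')) < position (pd_step C (i, k, t))"
      using 3 by (auto simp: position_def pd_step_eq)
    ultimately show ?thesis using IH 3 unfolding cX by simp
  qed
  then show ?case using step by (simp add: d_def)
qed

lemma visits_time:
  assumes "C \<subseteq> triangle m" "1 \<le> j" "j \<le> m" "visits C j (i, k, t)" "0 < k"
  shows "k < i + j" "path_state C j (i + j - 1 - k) = (i, k, t)" "inside C j (Suc (i + j - 1 - k))"
proof -
  obtain n where n: "inside C j n" "path_state C j n = (i, k, t)" using assms(4) by (auto simp: visits_def)
  then have "i + j = n + 1 + k" using path_invariant[OF assms(1-3) n(1)] by simp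
  then show "k < i + j" "path_state C j (i + j - 1 - k) = (i, k, t)" "inside C j (Suc (i + j - 1 - k))"
    using n assms(5) by (auto simp: inside_Suc)
qed

lemma visits_two:
  assumes C: "C \<subseteq> triangle m" and ab: "1 \<le> a" "a < b" "b \<le> m" and k: "0 < k"
    and v: "visits C a (i, k, t)" "visits C b (i, k, t')"
  obtains n where "inside C a (Suc n)" "inside C b (Suc (n + (b - a)))"
    "path_state C a n = (i, k, t)" "path_state C b (n + (b - a)) = (i, k, t')"
proof -
  have "a \<le> m" "1 \<le> b" using ab by simp_all
  note a = visits_time[OF C ab(1) this(1) v(1) k] and b = visits_time[OF C this(2) ab(3) v(2) k]
  have eq: "i + b - 1 - k = i + a - 1 - k + (b - a)" using a(1) ab by simp
  show ?thesis by (rule that[OF a(3) b(3)[unfolded eq] a(2) b(2)[unfolded eq]])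
qed

text \<open>Different pipes have different positions on a diagonal, so they enter a shared tile by
  different edges.\<close>

lemma visits_same_tile:
  assumes C: "C \<subseteq> triangle m" and ab: "1 \<le> a" "a \<le> m" "1 \<le> b" "b \<le> m" and k: "0 < k"
    and v: "visits C a (i, k, t)" "visits C b (i, k, t')"
  shows "a = b \<longleftrightarrow> t = t'"
proof
  assume "a = b"
  then show "t = t'" using visits_time(2)[OF C ab(1,2) v(1) k] visits_time(2)[OF C ab(3,4) v(2) k] by simp
next
  have *: "t \<noteq> t'" if h: "a < b" "1 \<le> a" "b \<le> m" "visits C a (i, k, t)" "visits C b (i, k, t')" for a b t t'
  proof -
    obtain n where "inside C a (Suc n)" "inside C b (Suc (n + (b - a)))"
      "path_state C a n = (i, k, t)" "path_state C b (n + (b - a)) = (i, k, t')"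
      using visits_two[OF C h(2,1,3) k h(4,5)] by blast
    then show ?thesis using position_parity[OF C h(2,1,3), of n]
      by (cases t; cases t') (simp_all add: position_def)
  qed
  assume "t = t'"
  then show "a = b" using *[of a b t t'] *[of b a t' t] ab v by (metis linorder_neqE_nat)
qed

section \<open>Column reading agrees with the paths\<close>

definition tiles :: "(nat \<times> nat) set \<Rightarrow> (nat \<times> nat) set \<Rightarrow> nat \<Rightarrow> nat \<Rightarrow> tile" where
  "tiles C M k i = (if (Suc i, Suc k) \<in> C then Cr else if (Suc i, Suc k) \<in> M then Mk else Bu)"

definition tile_ok :: "(nat \<times> nat) set \<Rightarrow> (nat \<times> nat) set \<Rightarrow> nat \<Rightarrow> nat \<times> nat \<Rightarrow> bool" where
  "tile_ok C M m p \<longleftrightarrow> (\<forall>a\<in>{1..m}. \<forall>b\<in>{1..m}.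
     visits C a (fst p, snd p, True) \<longrightarrow> visits C b (fst p, snd p, False) \<longrightarrow>
     (p \<in> C \<longrightarrow> a < b) \<and> (p \<in> M \<longrightarrow> b < a))"

lemma visits_start: "visits C j (1, j, True)"
  unfolding visits_def by (rule exI[of _ 0]) (simp add: inside_def)

lemma visits_step: "visits C j s \<Longrightarrow> 0 < column s \<Longrightarrow> visits C j (pd_step C s)"
  unfolding visits_def by (metis inside_Suc path_state_Suc)

lemma tile_ok_iff:
  assumes C: "C \<subseteq> triangle m" and k: "0 < k" and ab: "a \<in> {1..m}" "b \<in> {1..m}"
    and v: "visits C a (i, k, True)" "visits C b (i, k, False)"
  shows "tile_ok C M m (i, k) \<longleftrightarrow> ((i, k) \<in> C \<longrightarrow> a < b) \<and> ((i, k) \<in> M \<longrightarrow> b < a)"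
proof -
  have "a' = a" if "a' \<in> {1..m}" "visits C a' (i, k, True)" for a'
    using visits_same_tile[OF C _ _ _ _ k that(2) v(1)] that(1) ab(1) by simp
  moreover have "b' = b" if "b' \<in> {1..m}" "visits C b' (i, k, False)" for b'
    using visits_same_tile[OF C _ _ _ _ k that(2) v(2)] that(1) ab(2) by simp
  ultimately show ?thesis
    unfolding tile_ok_def fst_conv snd_conv using ab v by metis
qed

text \<open>Stated for the part of a column from row \<open>i\<close> downwards, so that the
  induction can pass to row \<open>i + 1\<close>. The equation for \<open>Suc m\<close> puts the
  final bump on the antidiagonal.\<close>

lemma column_visits:
  assumes C: "C \<subseteq> triangle m" and disj: "C \<inter> M = {}" and k: "0 < k"
    and f: "\<And>r. r < length u \<Longrightarrow> f r = tiles C M (k - 1) (i - 1 + r)"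
    and i: "1 \<le> i" "i + length u + k = Suc m" and p: "p \<in> {1..m}" "visits C p (i, k, True)"
    and u: "\<And>r. r < length u \<Longrightarrow> u ! r \<in> {1..m} \<and> visits C (u ! r) (i + r, k, False)"
  shows "(\<forall>r\<le>length u. visits C (col_out p u f ! r) (i + r, k - 1, False)) \<and>
    (\<forall>r\<le>length u. \<exists>a\<in>{1..m}. visits C a (i + r, k, True)) \<and>
    (col_valid p u f \<longleftrightarrow> (\<forall>r<length u. tile_ok C M m (i + r, k)))"
  using f i p u
proof (induction u arbitrary: p f i)
  case Nil
  have "(i, k) \<notin> C" using C Nil by (auto simp: triangle_def)
  then have "visits C p (i, k - 1, False)"
    using visits_step[OF Nil(5)] k by simp
  then show ?case using Nil by auto
next
  case (Cons a u)
  have a: "a \<in> {1..m}" "visits C a (i, k, False)" using Cons.prems(6)[of 0] by simp_all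
  have f0: "f 0 = tiles C M (k - 1) (i - 1)" using Cons.prems(1)[of 0] by simp
  have f0': "f 0 = Cr \<longleftrightarrow> (i, k) \<in> C" "f 0 = Mk \<longleftrightarrow> (i, k) \<in> M"
    using k Cons.prems(2) disj by (auto simp: f0 tiles_def)
  have ok: "tile_ok C M m (i, k) \<longleftrightarrow> ((i, k) \<in> C \<longrightarrow> p < a) \<and> ((i, k) \<in> M \<longrightarrow> a < p)"
    by (rule tile_ok_iff[OF C k Cons.prems(4) a(1) Cons.prems(5) a(2)])
  define q where "q = (if f 0 = Cr then p else a)"
  define z where "z = (if f 0 = Cr then a else p)"
  have out: "col_out p (a # u) f = z # col_out q u (f \<circ> Suc)" by (simp add: q_def z_def)
  have valid: "col_valid p (a # u) f \<longleftrightarrow> tile_ok C M m (i, k) \<and> col_valid q u (f \<circ> Suc)"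
    unfolding ok by (auto simp: q_def f0'[symmetric])
  have z: "visits C z (i, k - 1, False)"
    using visits_step[OF Cons.prems(5)] visits_step[OF a(2)] k by (auto simp: z_def f0'(1))
  have q: "q \<in> {1..m}" "visits C q (Suc i, k, True)"
    using visits_step[OF Cons.prems(5)] visits_step[OF a(2)] k Cons.prems(4) a(1) by (auto simp: q_def f0'(1))
  have IH: "(\<forall>r\<le>length u. visits C (col_out q u (f \<circ> Suc) ! r) (Suc i + r, k - 1, False)) \<and>
    (\<forall>r\<le>length u. \<exists>a\<in>{1..m}. visits C a (Suc i + r, k, True)) \<and>
    (col_valid q u (f \<circ> Suc) \<longleftrightarrow> (\<forall>r<length u. tile_ok C M m (Suc i + r, k)))"
  proof (rule Cons.IH[OF _ _ _ q])
    show "(f \<circ> Suc) r = tiles C M (k - 1) (Suc i - 1 + r)" if "r < length u" for r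
      using Cons.prems(1)[of "Suc r"] Cons.prems(2) that by simp
    show "u ! r \<in> {1..m} \<and> visits C (u ! r) (Suc i + r, k, False)" if "r < length u" for r
      using Cons.prems(6)[of "Suc r"] that by simp
  qed (use Cons.prems(2,3) in simp_all)
  have split: "(\<forall>r\<le>length (a # u). P r) \<longleftrightarrow> P 0 \<and> (\<forall>r\<le>length u. P (Suc r))" for P
    using All_less_Suc2[of "Suc (length u)" P] by (simp add: less_Suc_eq_le)
  have split': "(\<forall>r<length (a # u). P r) \<longleftrightarrow> P 0 \<and> (\<forall>r<length u. P (Suc r))" for P
    by (simp add: All_less_Suc2)
  show ?case
    unfolding split split' valid out using IH z Cons.prems(4,5) by auto
qed

text \<open>The third conjunct provides the two pipes of each tile, so that conditions quantified
  over its pipes are not vacuous.\<close>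

lemma dream_visits:
  assumes C: "C \<subseteq> triangle m" and disj: "C \<inter> M = {}" and "k \<le> m"
  shows "(\<forall>r<m - k. visits C (dream_out [Suc k..<Suc m] (\<lambda>l. tiles C M (k + l)) ! r) (Suc r, k, False)) \<and>
    (dream_valid [Suc k..<Suc m] (\<lambda>l. tiles C M (k + l)) \<longleftrightarrow>
      (\<forall>(i, l)\<in>triangle m. k < l \<longrightarrow> tile_ok C M m (i, l))) \<and>
    (\<forall>(i, l)\<in>triangle m. k < l \<longrightarrow>
      (\<exists>a\<in>{1..m}. visits C a (i, l, True)) \<and> (\<exists>b\<in>{1..m}. visits C b (i, l, False)))"
  using assms(3)
proof (induction "m - k" arbitrary: k)
  case 0
  have "\<not> k < l" if "(i, l) \<in> triangle m" for i l using that 0 by (auto simp: triangle_def)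
  then show ?case using 0 by auto
next
  case (Suc n)
  define u where "u = dream_out [Suc (Suc k)..<Suc m] (\<lambda>l. tiles C M (Suc k + l))"
  have len: "length u = n" using Suc by (simp add: u_def del: upt_Suc)
  have n: "m - Suc k = n" "m - k = Suc n" "k < m" "Suc k \<le> m" using Suc by simp_all
  have IH: "\<forall>r<n. visits C (u ! r) (Suc r, Suc k, False)"
    "dream_valid [Suc (Suc k)..<Suc m] (\<lambda>l. tiles C M (Suc k + l)) \<longleftrightarrow>
      (\<forall>(i, l)\<in>triangle m. Suc k < l \<longrightarrow> tile_ok C M m (i, l))"
    "\<forall>(i, l)\<in>triangle m. Suc k < l \<longrightarrow>
      (\<exists>a\<in>{1..m}. visits C a (i, l, True)) \<and> (\<exists>b\<in>{1..m}. visits C b (i, l, False))"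
    using Suc.hyps(1)[of "Suc k"] n unfolding u_def by simp_all
  have upt: "[Suc k..<Suc m] = Suc k # [Suc (Suc k)..<Suc m]" using n by (simp add: upt_conv_Cons del: upt_Suc)
  have shift: "(\<lambda>l. tiles C M (k + l)) \<circ> Suc = (\<lambda>l. tiles C M (Suc k + l))" by (rule ext) simp
  have set_u: "u ! r \<in> {1..m}" if "r < n" for r
  proof -
    have "u ! r \<in> set u" using that len by simp
    moreover have "set u = {Suc (Suc k)..<Suc m}" by (simp add: u_def set_dream_out del: upt_Suc)
    ultimately show ?thesis by simp
  qed
  have col: "(\<forall>r\<le>length u. visits C (col_out (Suc k) u (tiles C M k) ! r) (1 + r, Suc k - 1, False)) \<and>
    (\<forall>r\<le>length u. \<exists>a\<in>{1..m}. visits C a (1 + r, Suc k, True)) \<and>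
    (col_valid (Suc k) u (tiles C M k) \<longleftrightarrow> (\<forall>r<length u. tile_ok C M m (1 + r, Suc k)))"
    by (rule column_visits[OF C disj]) (use n len IH(1) set_u visits_start in auto)
  have T: "(\<forall>(i, l)\<in>triangle m. k < l \<longrightarrow> P i l) \<longleftrightarrow>
      (\<forall>r<n. P (Suc r) (Suc k)) \<and> (\<forall>(i, l)\<in>triangle m. Suc k < l \<longrightarrow> P i l)" for P
  proof -
    have "P i l" if h: "\<forall>r<n. P (Suc r) (Suc k)" "\<forall>(i, l)\<in>triangle m. Suc k < l \<longrightarrow> P i l"
      "(i, l) \<in> triangle m" "k < l" for i l
    proof (cases "l = Suc k")
      case True
      then obtain r where "i = Suc r" "r < n" using h(3) n by (cases i) (auto simp: triangle_def)
      then show ?thesis using h(1) True by blast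
    next
      case False
      then show ?thesis using h(2-4) by auto
    qed
    moreover have "(Suc r, Suc k) \<in> triangle m" if "r < n" for r using that n by (auto simp: triangle_def)
    ultimately show ?thesis by fastforce
  qed
  have out: "dream_out [Suc k..<Suc m] (\<lambda>l. tiles C M (k + l)) = col_out (Suc k) u (tiles C M k)"
    unfolding upt by (simp add: shift u_def del: upt_Suc)
  have valid: "dream_valid [Suc k..<Suc m] (\<lambda>l. tiles C M (k + l)) \<longleftrightarrow>
      (\<forall>(i, l)\<in>triangle m. Suc k < l \<longrightarrow> tile_ok C M m (i, l)) \<and> (\<forall>r<n. tile_ok C M m (Suc r, Suc k))"
    unfolding upt dream_valid.simps shift IH(2) u_def[symmetric] using col by (simp add: len)
  show ?case
  proof (intro conjI)
    show "\<forall>r<m - k. visits C (dream_out [Suc k..<Suc m] (\<lambda>l. tiles C M (k + l)) ! r) (Suc r, k, False)"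
      unfolding out using col n(2) len by (auto simp: less_Suc_eq_le)
    show "dream_valid [Suc k..<Suc m] (\<lambda>l. tiles C M (k + l)) \<longleftrightarrow>
      (\<forall>(i, l)\<in>triangle m. k < l \<longrightarrow> tile_ok C M m (i, l))"
      unfolding valid T[of "\<lambda>i l. tile_ok C M m (i, l)"] by blast
    show "\<forall>(i, l)\<in>triangle m. k < l \<longrightarrow>
      (\<exists>a\<in>{1..m}. visits C a (i, l, True)) \<and> (\<exists>b\<in>{1..m}. visits C b (i, l, False))"
    proof (subst T, intro conjI allI impI)
      fix r assume "r < n"
      then show "\<exists>a\<in>{1..m}. visits C a (Suc r, Suc k, True)" "\<exists>b\<in>{1..m}. visits C b (Suc r, Suc k, False)"
        using col len IH(1) set_u by auto
    qed (rule IH(3))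
  qed
qed

section \<open>Reducedness and markability by crossing parity\<close>

lemma path_time:
  assumes "C \<subseteq> triangle m" "1 \<le> j" "j \<le> m" "inside C j n"
  shows "row (path_state C j n) + j = n + 1 + column (path_state C j n)"
  using path_invariant[OF assms] by (rule conjunct1[OF conjunct2])

lemma crossing_times_finite:
  assumes C: "C \<subseteq> triangle m" and ab: "1 \<le> a" "a < b" "b \<le> m"
  shows "finite (crossing_times C a b)"
proof (rule finite_subset)
  have "n \<le> 2 * m" if "n \<in> crossing_times C a b" for n
  proof -
    have "inside C a n" using that by (simp add: crossing_times_def inside_Suc)
    then show ?thesis using path_invariant[OF C ab(1), of n] ab by (auto split: if_splits)
  qed
  then show "crossing_times C a b \<subseteq> {..2 * m}" by auto
qed simp

lemma card_common_crossings:
  assumes C: "C \<subseteq> triangle m" and ab: "1 \<le> a" "a < b" "b \<le> m"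
  shows "card {p \<in> C. traverses C m a p \<and> traverses C m b p} = card (crossing_times C a b)"
proof -
  have "bij_betw (\<lambda>n. tile (path_state C a n)) (crossing_times C a b)
      {p \<in> C. traverses C m a p \<and> traverses C m b p}"
  proof (rule bij_betw_imageI)
    show "inj_on (\<lambda>n. tile (path_state C a n)) (crossing_times C a b)"
    proof (rule inj_onI)
      fix n n' assume *: "n \<in> crossing_times C a b" "n' \<in> crossing_times C a b"
        "tile (path_state C a n) = tile (path_state C a n')"
      then have "inside C a n" "inside C a n'" by (auto simp: crossing_times_def inside_Suc)
      note time = this[THEN path_time[OF C ab(1) less_imp_le[OF less_le_trans[OF ab(2,3)]]]]
      have "row (path_state C a n) = row (path_state C a n')"
        "column (path_state C a n) = column (path_state C a n')" using *(3) by simp_all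
      then show "n = n'" using time by linarith
    qed
    show "(\<lambda>n. tile (path_state C a n)) ` crossing_times C a b = {p \<in> C. traverses C m a p \<and> traverses C m b p}"
    proof (intro equalityI subsetI)
      fix p assume "p \<in> (\<lambda>n. tile (path_state C a n)) ` crossing_times C a b"
      then obtain n where n: "n \<in> crossing_times C a b" "p = tile (path_state C a n)" by auto
      obtain i k t where s: "path_state C a n = (i, k, t)" by (metis prod_cases3)
      obtain t' where s': "path_state C b (n + (b - a)) = (i, k, t')"
        using n s by (cases "path_state C b (n + (b - a))") (auto simp: crossing_times_def)
      have "visits C a (i, k, t)" "visits C b (i, k, t')" "0 < k"
        using n s s' by (auto simp: crossing_times_def inside_Suc visits_def)
      then show "p \<in> {p \<in> C. traverses C m a p \<and> traverses C m b p}"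
        using n s ab traverses_iff[OF C] by (auto simp: crossing_times_def)
    next
      fix p assume p: "p \<in> {p \<in> C. traverses C m a p \<and> traverses C m b p}"
      obtain i k where ik: "p = (i, k)" by (cases p)
      have k: "0 < k" using p C ik by (auto simp: triangle_def)
      obtain t t' where v: "visits C a (i, k, t)" "visits C b (i, k, t')"
        using p ik traverses_iff[OF C _ _ k] ab by auto
      obtain n where "inside C a (Suc n)" "inside C b (Suc (n + (b - a)))"
        "path_state C a n = (i, k, t)" "path_state C b (n + (b - a)) = (i, k, t')"
        using visits_two[OF C ab k v] by blast
      then show "p \<in> (\<lambda>n. tile (path_state C a n)) ` crossing_times C a b"
        using p ik by (intro image_eqI[of _ _ n]) (auto simp: crossing_times_def)
    qed
  qed
  from bij_betw_same_card[OF this] show ?thesis by (rule sym)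
qed

lemma crossings_before:
  assumes C: "C \<subseteq> triangle m" and ab: "1 \<le> a" "a < b" "b \<le> m" and k: "0 < k"
    and v: "visits C a (i, k, t)" "visits C b (i, k, t')"
  obtains n where "n \<in> crossing_times C a b \<longleftrightarrow> (i, k) \<in> C"
    "path_state C a n = (i, k, t)" "path_state C b (n + (b - a)) = (i, k, t')"
    "t \<longleftrightarrow> \<not> t'" "t \<longleftrightarrow> even (card (crossing_times C a b \<inter> {..<n}))"
proof -
  obtain n where n: "inside C a (Suc n)" "inside C b (Suc (n + (b - a)))"
    "path_state C a n = (i, k, t)" "path_state C b (n + (b - a)) = (i, k, t')"
    using visits_two[OF C ab k v] by blast
  have "1 \<le> i" using path_invariant[OF C ab(1), of n] n ab by (simp add: inside_Suc)
  then show ?thesis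
    using that[of n] n position_parity[OF C ab n(1,2)]
    by (cases t; cases t') (auto simp: crossing_times_def position_def)
qed

definition crossings_ok :: "(nat \<times> nat) set \<Rightarrow> nat \<Rightarrow> bool" where
  "crossings_ok C m \<longleftrightarrow> (\<forall>(i, k)\<in>C. \<forall>a\<in>{1..m}. \<forall>b\<in>{1..m}.
     visits C a (i, k, True) \<longrightarrow> visits C b (i, k, False) \<longrightarrow> a < b)"

lemma crossings_okD:
  assumes "crossings_ok C m" "(i, k) \<in> C" "a \<in> {1..m}" "b \<in> {1..m}"
    "visits C a (i, k, True)" "visits C b (i, k, False)"
  shows "a < b"
  using assms unfolding crossings_ok_def by blast

lemma crossing_states:
  assumes C: "C \<subseteq> triangle m" and ab: "1 \<le> a" "a < b" "b \<le> m" and n: "n \<in> crossing_times C a b"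
  obtains i k t where "(i, k) \<in> C" "0 < k" "path_state C a n = (i, k, t)"
    "path_state C b (n + (b - a)) = (i, k, \<not> t)" "t \<longleftrightarrow> even (card (crossing_times C a b \<inter> {..<n}))"
    "visits C a (i, k, t)" "visits C b (i, k, \<not> t)"
proof -
  obtain i k t where s: "path_state C a n = (i, k, t)" by (metis prod_cases3)
  obtain i' k' t' where s': "path_state C b (n + (b - a)) = (i', k', t')" by (metis prod_cases3)
  have eq: "i' = i" "k' = k" "(i, k) \<in> C" using n s s' by (auto simp: crossing_times_def)
  have ins: "inside C a (Suc n)" "inside C b (Suc (n + (b - a)))" using n by (auto simp: crossing_times_def)
  then have v: "visits C a (i, k, t)" "visits C b (i, k, t')" "0 < k"
    using s s' eq by (auto simp: visits_def inside_Suc)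
  have i: "0 < i" using C eq(3) by (auto simp: triangle_def)
  have "t' \<longleftrightarrow> \<not> t" "t \<longleftrightarrow> even (card (crossing_times C a b \<inter> {..<n}))"
  proof -
    have "position (i, k, t) = position (i, k, t') \<longleftrightarrow> (t \<longleftrightarrow> t')"
      "position (i, k, t) < position (i, k, t') \<longleftrightarrow> t \<and> \<not> t'"
      using i by (cases t; cases t'; simp add: position_def)+
    moreover have "position (i, k, t) \<noteq> position (i, k, t') \<and> (position (i, k, t) < position (i, k, t') \<longleftrightarrow>
        even (card (crossing_times C a b \<inter> {..<n})))"
      using position_parity[OF C ab ins] unfolding s s' eq .
    ultimately show "t' \<longleftrightarrow> \<not> t" "t \<longleftrightarrow> even (card (crossing_times C a b \<inter> {..<n}))" by blast+
  qed
  with v s s' eq show ?thesis by (intro that[of i k t]) simp_all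
qed

text \<open>The smaller pipe enters a common crossing from above iff the number of earlier common
  crossings is even. A second crossing would have exactly one before it, so it cannot exist if all
  counts are even; conversely an odd count exhibits an earlier crossing, hence two.\<close>

lemma crossings_ok_iff:
  assumes C: "C \<subseteq> triangle m"
  shows "(\<forall>a b. 1 \<le> a \<longrightarrow> a < b \<longrightarrow> b \<le> m \<longrightarrow> card {p \<in> C. traverses C m a p \<and> traverses C m b p} \<le> 1)
    \<longleftrightarrow> crossings_ok C m"
proof (intro iffI allI impI)
  fix a b assume ok: "crossings_ok C m" and ab: "1 \<le> a" "a < b" "b \<le> m"
  let ?N = "crossing_times C a b"
  have fin: "finite ?N" by (rule crossing_times_finite[OF C ab])
  have even: "even (card (?N \<inter> {..<n}))" if n: "n \<in> ?N" for n
  proof (rule ccontr)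
    assume odd: "odd (card (?N \<inter> {..<n}))"
    obtain i k t where s: "(i, k) \<in> C" "t \<longleftrightarrow> even (card (?N \<inter> {..<n}))"
      "visits C a (i, k, t)" "visits C b (i, k, \<not> t)"
      by (rule crossing_states[OF C ab n])
    have "\<not> t" using odd s(2) by blast
    then have "b < a" using crossings_okD[OF ok s(1), of b a] s(3,4) ab by simp
    then show False using ab by simp
  qed
  have "card ?N \<le> 1"
  proof (rule ccontr)
    assume "\<not> card ?N \<le> 1"
    then have ne: "?N \<noteq> {}" by force
    define n where "n = Min ?N"
    have n: "n \<in> ?N" "\<And>n'. n' \<in> ?N \<Longrightarrow> n \<le> n'" using fin ne by (simp_all add: n_def)
    have "card (?N - {n}) \<noteq> 0" using \<open>\<not> card ?N \<le> 1\<close> n(1) fin by simp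
    then have ne': "?N - {n} \<noteq> {}" by force
    define n' where "n' = Min (?N - {n})"
    have n': "n' \<in> ?N" "n' \<noteq> n"
      using Min_in[of "?N - {n}"] fin ne' unfolding n'_def by blast+
    have "n' \<le> n''" if "n'' \<in> ?N" "n'' \<noteq> n" for n''
      unfolding n'_def using fin that by (intro Min_le) simp_all
    then have "?N \<inter> {..<n'} \<subseteq> {n}" by fastforce
    moreover have "n < n'" using n(2)[OF n'(1)] n'(2) by simp
    ultimately have "?N \<inter> {..<n'} = {n}" using n(1) by blast
    then show False using even[OF n'(1)] by simp
  qed
  then show "card {p \<in> C. traverses C m a p \<and> traverses C m b p} \<le> 1"
    by (simp only: card_common_crossings[OF C ab])
next
  assume card: "\<forall>a b. 1 \<le> a \<longrightarrow> a < b \<longrightarrow> b \<le> m \<longrightarrow> card {p \<in> C. traverses C m a p \<and> traverses C m b p} \<le> 1"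
  have "x < y" if h: "(i, k) \<in> C" "x \<in> {1..m}" "y \<in> {1..m}" "visits C x (i, k, True)" "visits C y (i, k, False)"
    for i k x y
  proof (rule ccontr)
    assume nless: "\<not> x < y"
    have k: "0 < k" using h(1) C by (auto simp: triangle_def)
    have "x \<noteq> y" using visits_same_tile[OF C _ _ _ _ k h(4,5)] h(2,3) by simp
    then have ab: "1 \<le> y" "y < x" "x \<le> m" using nless h(2,3) by simp_all
    obtain n where n: "n \<in> crossing_times C y x \<longleftrightarrow> (i, k) \<in> C"
      "False \<longleftrightarrow> even (card (crossing_times C y x \<inter> {..<n}))"
      by (rule crossings_before[OF C ab k h(5,4)])
    then have "crossing_times C y x \<inter> {..<n} \<noteq> {}" by force
    then obtain n' where n': "n' \<in> crossing_times C y x" "n' \<noteq> n" by auto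
    have "card {n, n'} \<le> card (crossing_times C y x)"
      using n(1) h(1) n'(1) by (intro card_mono crossing_times_finite[OF C ab]) simp
    then show False
      using card[rule_format, OF ab] n'(2) unfolding card_common_crossings[OF C ab] by simp
  qed
  then show "crossings_ok C m" unfolding crossings_ok_def by blast
qed

lemma visits_from_right:
  assumes "C \<subseteq> triangle m" "1 \<le> j" "j \<le> m" "visits C j (i, k, False)"
  shows "i + k \<le> m" "1 \<le> i"
proof -
  obtain n where "inside C j n" "path_state C j n = (i, k, False)" using assms(4) by (auto simp: visits_def)
  then show "i + k \<le> m" "1 \<le> i" using path_invariant[OF assms(1-3), of n] by simp_all
qed

text \<open>Two pipes cross at most once, so they have crossed before the tile iff the count is odd,
  that is, iff the larger one comes from above. The smaller one then enters from the right, which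
  excludes the antidiagonal.\<close>

lemma markable_iff:
  assumes C: "C \<subseteq> triangle m" and ok: "crossings_ok C m"
  shows "markable C m (i, k) \<longleftrightarrow> (i, k) \<in> triangle m - C \<and>
    (\<forall>x\<in>{1..m}. \<forall>y\<in>{1..m}. visits C x (i, k, True) \<longrightarrow> visits C y (i, k, False) \<longrightarrow> y < x)"
proof
  assume mark: "markable C m (i, k)"
  have stair: "(i, k) \<in> staircase m" "(i, k) \<notin> C" "0 < k"
    using mark by (auto simp: markable_def staircase_def)
  obtain a b i' k' where ab: "1 \<le> a" "a < b" "b \<le> m"
    and trav: "traverses C m a (i, k)" "traverses C m b (i, k)"
    and q: "(i', k') \<in> C" "i' < i" "traverses C m a (i', k')" "traverses C m b (i', k')"
  proof -
    obtain a b q where *: "1 \<le> a" "a \<le> m" "1 \<le> b" "b \<le> m" "a \<noteq> b"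
      "traverses C m a (i, k)" "traverses C m b (i, k)"
      "q \<in> C" "fst q < i" "traverses C m a q" "traverses C m b q"
      using mark unfolding markable_def fst_conv by blast
    obtain i' k' where q: "q = (i', k')" by (cases q)
    show ?thesis
      using that[of a b i' k'] that[of b a i' k'] * unfolding q fst_conv by (cases "a < b") simp_all
  qed
  have ab': "a \<le> m" "1 \<le> b" using ab by simp_all
  have k': "0 < k'" using q(1) C by (auto simp: triangle_def)
  obtain t t' where v: "visits C a (i, k, t)" "visits C b (i, k, t')"
    using trav traverses_iff[OF C _ _ stair(3)] ab ab' by auto
  obtain s s' where w: "visits C a (i', k', s)" "visits C b (i', k', s')"
    using q traverses_iff[OF C _ _ k'] ab ab' by auto
  obtain n where n: "path_state C a n = (i, k, t)" "t \<longleftrightarrow> \<not> t'"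
      "t \<longleftrightarrow> even (card (crossing_times C a b \<inter> {..<n}))"
    by (rule crossings_before[OF C ab stair(3) v])
  obtain n' where n': "n' \<in> crossing_times C a b \<longleftrightarrow> (i', k') \<in> C" "path_state C a n' = (i', k', s)"
    by (rule crossings_before[OF C ab k' w])
  \<comment> \<open>Rows never decrease along a path, so the crossing in a higher row comes
    earlier.\<close>
  have "n' < n" using path_row_mono[of n n' C a] n(1) n'(2) q(2) by (cases "n \<le> n'") auto
  then have "crossing_times C a b \<inter> {..<n} \<noteq> {}" using n'(1) q(1) by auto
  moreover have "finite (crossing_times C a b)" by (rule crossing_times_finite[OF C ab])
  ultimately have "0 < card (crossing_times C a b \<inter> {..<n})" by (simp add: card_gt_0_iff)
  moreover have "card (crossing_times C a b \<inter> {..<n}) \<le> card (crossing_times C a b)"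
    by (intro card_mono crossing_times_finite[OF C ab]) simp
  moreover have "card (crossing_times C a b) \<le> 1"
    using ok ab unfolding crossings_ok_iff[OF C, symmetric] card_common_crossings[OF C ab, symmetric] by blast
  ultimately have "card (crossing_times C a b \<inter> {..<n}) = 1" by linarith
  then have t: "\<not> t" "t'" using n(2,3) by simp_all
  have "i + k \<le> m" "1 \<le> i" using visits_from_right[OF C ab(1) ab'(1), of i k] v(1) t by simp_all
  then have "(i, k) \<in> triangle m - C" using stair by (simp add: triangle_def)
  moreover have "y < x" if "x \<in> {1..m}" "y \<in> {1..m}" "visits C x (i, k, True)" "visits C y (i, k, False)" for x y
  proof -
    have "x = b" using visits_same_tile[OF C _ _ ab'(2) ab(3) stair(3) that(3) v(2)] that(1) t by simp
    moreover have "y = a" using visits_same_tile[OF C _ _ ab(1) ab'(1) stair(3) that(4) v(1)] that(2) t by simp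
    ultimately show ?thesis using ab by simp
  qed
  ultimately show "(i, k) \<in> triangle m - C \<and>
    (\<forall>x\<in>{1..m}. \<forall>y\<in>{1..m}. visits C x (i, k, True) \<longrightarrow> visits C y (i, k, False) \<longrightarrow> y < x)"
    by blast
next
  assume *: "(i, k) \<in> triangle m - C \<and>
    (\<forall>x\<in>{1..m}. \<forall>y\<in>{1..m}. visits C x (i, k, True) \<longrightarrow> visits C y (i, k, False) \<longrightarrow> y < x)"
  have k: "0 < k" using * by (auto simp: triangle_def)
  obtain x y where xy: "x \<in> {1..m}" "y \<in> {1..m}" "visits C x (i, k, True)" "visits C y (i, k, False)"
    using bspec[OF dream_visits[OF C Int_empty_right le0, THEN conjunct2, THEN conjunct2], of "(i, k)"] * k
    unfolding prod.case by blast
  then have ab: "1 \<le> y" "y < x" "x \<le> m" using * by auto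
  obtain n where n: "path_state C y n = (i, k, False)" "path_state C x (n + (x - y)) = (i, k, True)"
      "False \<longleftrightarrow> even (card (crossing_times C y x \<inter> {..<n}))"
    by (rule crossings_before[OF C ab k xy(4,3)])
  have "crossing_times C y x \<inter> {..<n} \<noteq> {}" using n(3) by force
  then obtain n' where n': "n' \<in> crossing_times C y x" "n' < n" by auto
  obtain i' k' t where s: "(i', k') \<in> C" "0 < k'" "path_state C y n' = (i', k', t)"
      "path_state C x (n' + (x - y)) = (i', k', \<not> t)" "visits C y (i', k', t)" "visits C x (i', k', \<not> t)"
    by (rule crossing_states[OF C ab n'(1)])
  \<comment> \<open>One of the two pipes leaves the earlier crossing downwards; following that one
    makes the inequality strict.\<close>
  have "i' < i"
  proof (cases t)
    case True
    have "row (path_state C y (Suc n')) = Suc i'" using s(1,3) True by (simp add: path_state_Suc)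
    then show ?thesis using path_row_mono[of "Suc n'" n C y] n'(2) n(1) by simp
  next
    case False
    have "row (path_state C x (Suc (n' + (x - y)))) = Suc i'" using s(1,4) False by (simp add: path_state_Suc)
    then show ?thesis using path_row_mono[of "Suc (n' + (x - y))" "n + (x - y)" C x] n'(2) n(2) by simp
  qed
  moreover have "traverses C m y (i', k')" "traverses C m x (i', k')"
    using traverses_iff[OF C _ _ s(2)] ab s(5,6) by auto
  moreover have "traverses C m y (i, k)" "traverses C m x (i, k)"
    using traverses_iff[OF C _ _ k] ab xy by auto
  moreover have "(i, k) \<in> staircase m - C" using * by (auto simp: triangle_def staircase_def)
  ultimately show "markable C m (i, k)"
    unfolding markable_def using ab s(1) by (intro conjI exI[of _ y] exI[of _ x] bexI[of _ "(i', k')"]) auto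
qed

lemma exit_rows_iff:
  assumes C: "C \<subseteq> triangle m" and disj: "C \<inter> M = {}" and \<sigma>: "is_perm \<sigma>" "length \<sigma> = m"
  shows "(\<forall>i\<in>{1..m}. exit_row C m (\<sigma> ! (i - 1)) = i) \<longleftrightarrow> dream_out [1..<Suc m] (tiles C M) = \<sigma>"
proof -
  define u where "u = dream_out [1..<Suc m] (tiles C M)"
  have len: "length u = m" by (simp add: u_def)
  have set: "set u = {1..m}" by (auto simp: u_def set_dream_out)
  have "visits C (u ! r) (Suc r, 0, False)" if "r < m" for r
    using dream_visits[OF C disj, of 0] that by (simp add: u_def del: upt_Suc)
  moreover have range: "u ! r \<in> {1..m}" if "r < m" for r using that len set nth_mem by metis
  ultimately have exit: "exit_row C m (u ! r) = Suc r" if "r < m" for r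
    using exit_row_eqI[OF C] that by simp
  have "\<sigma> = u" if h: "\<forall>i\<in>{1..m}. exit_row C m (\<sigma> ! (i - 1)) = i"
  proof (rule nth_equalityI)
    fix r assume "r < length \<sigma>"
    then have r: "r < m" using \<sigma> by simp
    have "\<sigma> ! r \<in> set u" using r \<sigma> set nth_mem[of r \<sigma>] by (simp add: is_perm_def)
    then obtain r' where r': "r' < m" "\<sigma> ! r = u ! r'" using len by (metis in_set_conv_nth)
    have "exit_row C m (\<sigma> ! r) = Suc r" using h[rule_format, of "Suc r"] r by simp
    then show "\<sigma> ! r = u ! r" using exit[OF r'(1)] r'(2) by simp
  qed (use len \<sigma> in simp)
  moreover have "exit_row C m (u ! (i - 1)) = i" if "i \<in> {1..m}" for i
  proof -
    have "i - 1 < m" "Suc (i - 1) = i" using that by auto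
    then show ?thesis using exit by metis
  qed
  ultimately show ?thesis unfolding u_def[symmetric] by blast
qed

lemma MRPD_iff:
  assumes \<sigma>: "is_perm \<sigma>" "length \<sigma> = m"
  shows "(C, M) \<in> MRPD \<sigma> \<longleftrightarrow> C \<subseteq> triangle m \<and> M \<subseteq> triangle m \<and> C \<inter> M = {} \<and>
    dream_valid [1..<Suc m] (tiles C M) \<and> dream_out [1..<Suc m] (tiles C M) = \<sigma>"
proof (cases "C \<subseteq> triangle m")
  case C: True
  have red: "reduced_pd \<sigma> C \<longleftrightarrow> crossings_ok C m \<and> (\<forall>i\<in>{1..m}. exit_row C m (\<sigma> ! (i - 1)) = i)"
    using C unfolding reduced_pd_def Let_def \<sigma>(2) crossings_ok_iff[OF C, symmetric] triangle_def[symmetric]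
    by blast
  show ?thesis
  proof (cases "M \<subseteq> triangle m \<and> C \<inter> M = {}")
    case M: True
    then have disj: "C \<inter> M = {}" by blast
    have "dream_valid [1..<Suc m] (tiles C M) \<longleftrightarrow> (\<forall>(i, l)\<in>triangle m. 0 < l \<longrightarrow> tile_ok C M m (i, l))"
      using dream_visits[OF C disj, of 0] by simp
    also have "\<dots> \<longleftrightarrow> (\<forall>p\<in>triangle m. tile_ok C M m p)" by (auto simp: triangle_def)
    also have "\<dots> \<longleftrightarrow> crossings_ok C m \<and> (\<forall>p\<in>M. markable C m p)"
    proof -
      define Pc where "Pc i k \<longleftrightarrow> (\<forall>a\<in>{1..m}. \<forall>b\<in>{1..m}.
        visits C a (i, k, True) \<longrightarrow> visits C b (i, k, False) \<longrightarrow> a < b)" for i k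
      define Pm where "Pm i k \<longleftrightarrow> (\<forall>a\<in>{1..m}. \<forall>b\<in>{1..m}.
        visits C a (i, k, True) \<longrightarrow> visits C b (i, k, False) \<longrightarrow> b < a)" for i k
      have tile: "tile_ok C M m (i, k) \<longleftrightarrow> ((i, k) \<in> C \<longrightarrow> Pc i k) \<and> ((i, k) \<in> M \<longrightarrow> Pm i k)" for i k
        unfolding tile_ok_def Pc_def Pm_def fst_conv snd_conv by blast
      have cross: "crossings_ok C m \<longleftrightarrow> (\<forall>(i, k)\<in>C. Pc i k)"
        unfolding crossings_ok_def Pc_def by (rule refl)
      have mark: "markable C m (i, k) \<longleftrightarrow> Pm i k" if "crossings_ok C m" "(i, k) \<in> M" for i k
        unfolding markable_iff[OF C that(1)] Pm_def[symmetric] using that(2) M by blast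
      have "(\<forall>p\<in>triangle m. tile_ok C M m p) \<longleftrightarrow> (\<forall>(i, k)\<in>C. Pc i k) \<and> (\<forall>(i, k)\<in>M. Pm i k)"
      proof (intro iffI conjI ballI)
        fix p assume h: "\<forall>p\<in>triangle m. tile_ok C M m p" "p \<in> C"
        then show "case p of (i, k) \<Rightarrow> Pc i k" using C tile by (cases p) blast
      next
        fix p assume h: "\<forall>p\<in>triangle m. tile_ok C M m p" "p \<in> M"
        then show "case p of (i, k) \<Rightarrow> Pm i k" using M tile by (cases p) blast
      next
        fix p assume h: "(\<forall>(i, k)\<in>C. Pc i k) \<and> (\<forall>(i, k)\<in>M. Pm i k)" "p \<in> triangle m"
        then show "tile_ok C M m p" using tile by (cases p) blast
      qed
      also have "\<dots> \<longleftrightarrow> crossings_ok C m \<and> (\<forall>p\<in>M. markable C m p)"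
      proof -
        have "(case p of (i, k) \<Rightarrow> Pm i k) \<longleftrightarrow> markable C m p" if "crossings_ok C m" "p \<in> M" for p
          using mark[of "fst p" "snd p"] that by (simp add: case_prod_beta)
        then show ?thesis
          unfolding cross[symmetric] by (intro conj_cong[OF refl] ball_cong[OF refl])
      qed
      finally show ?thesis .
    qed
    finally show ?thesis
      using exit_rows_iff[OF C disj \<sigma>] C M red unfolding MRPD_def \<sigma>(2) mem_Collect_eq prod.case by blast
  next
    case False
    have "\<not> (\<forall>p\<in>M. markable C m p)" if "crossings_ok C m"
    proof
      assume h: "\<forall>p\<in>M. markable C m p"
      have "p \<in> triangle m - C" if "p \<in> M" for p
        using h[rule_format, OF that] markable_iff[OF C \<open>crossings_ok C m\<close>, of "fst p" "snd p"]
        unfolding prod.collapse by blast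
      then show False using False by blast
    qed
    then show ?thesis using False red unfolding MRPD_def \<sigma>(2) mem_Collect_eq prod.case by blast
  qed
next
  case False
  then show ?thesis unfolding MRPD_def reduced_pd_def Let_def \<sigma>(2) triangle_def[symmetric] by blast
qed

section \<open>Removability followed along a path\<close>

definition state_ok :: "(nat \<times> nat) set \<Rightarrow> (nat \<times> nat) set \<Rightarrow> nat \<times> nat \<times> bool \<Rightarrow> bool" where
  "state_ok C M s \<longleftrightarrow> tile s \<notin> M \<and>
     (tile s \<in> C \<longrightarrow> 1 < row s \<longrightarrow> (row s - 1, column s) \<in> C \<union> M)"

text \<open>The start is an arbitrary state so that single steps can be stripped off; from a state
  in column 0 the condition is vacuous.\<close>

definition path_ok :: "(nat \<times> nat) set \<Rightarrow> (nat \<times> nat) set \<Rightarrow> nat \<times> nat \<times> bool \<Rightarrow> bool" where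
  "path_ok C M s \<longleftrightarrow> (\<forall>n. (\<forall>n'\<le>n. 0 < column ((pd_step C ^^ n') s)) \<longrightarrow> state_ok C M ((pd_step C ^^ n) s))"

lemma path_ok_rec:
  "path_ok C M s \<longleftrightarrow> (0 < column s \<longrightarrow> state_ok C M s \<and> path_ok C M (pd_step C s))"
proof (cases "0 < column s")
  case True
  have all: "(\<forall>n. P n) \<longleftrightarrow> P 0 \<and> (\<forall>n. P (Suc n))" for P :: "nat \<Rightarrow> bool"
    by (metis not0_implies_Suc)
  have le: "(\<forall>n'\<le>Suc n. 0 < column ((pd_step C ^^ n') s)) \<longleftrightarrow>
      (\<forall>n'\<le>n. 0 < column ((pd_step C ^^ n') (pd_step C s)))" for n
    using True All_less_Suc2[of "Suc n" "\<lambda>n'. 0 < column ((pd_step C ^^ n') s)"]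
    by (simp add: less_Suc_eq_le funpow_swap1)
  show ?thesis
    unfolding path_ok_def by (subst all) (simp add: le True funpow_swap1)
next
  case False
  then have "\<not> (\<forall>n'\<le>n. 0 < column ((pd_step C ^^ n') s))" for n
    by (intro notI) (metis funpow_0 le0)
  then show ?thesis using False unfolding path_ok_def by blast
qed

text \<open>\<open>removable_exit\<close> peels columns from the left, whereas a pipe meets them
  from the right. This version runs in the order of the path; associativity of
  \<open>Option.bind\<close> identifies the two.\<close>

primrec chain_exit :: "(nat \<Rightarrow> nat \<Rightarrow> tile) \<Rightarrow> nat \<Rightarrow> nat \<Rightarrow> nat option" where
  "chain_exit g 0 i = Some i"
| "chain_exit g (Suc k) i = Option.bind (col_exit (g k) i) (chain_exit g k)"

lemma chain_exit_shift:
  "chain_exit g (Suc k) i = Option.bind (chain_exit (g \<circ> Suc) k i) (col_exit (g 0))"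
proof (induction k arbitrary: i)
  case (Suc k)
  have "chain_exit g (Suc (Suc k)) i = Option.bind (col_exit (g (Suc k)) i) (chain_exit g (Suc k))"
    by (simp only: chain_exit.simps)
  also have "\<dots> = Option.bind (col_exit (g (Suc k)) i)
      (\<lambda>i. Option.bind (chain_exit (g \<circ> Suc) k i) (col_exit (g 0)))"
  proof -
    have "chain_exit g (Suc k) = (\<lambda>i. Option.bind (chain_exit (g \<circ> Suc) k i) (col_exit (g 0)))"
      by (rule ext) (rule Suc.IH)
    then show ?thesis by (rule arg_cong)
  qed
  also have "\<dots> = Option.bind (Option.bind (col_exit (g (Suc k)) i) (chain_exit (g \<circ> Suc) k)) (col_exit (g 0))"
    by (rule bind_assoc[symmetric])
  finally show ?case by (simp only: chain_exit.simps comp_def)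
next
  case 0
  then show ?case by (cases "col_exit (g 0) i") simp_all
qed

lemma removable_exit_chain:
  "removable_exit j g = Option.bind (if \<exists>r. g j = drop_col r then Some (THE r. g j = drop_col r) else None)
     (chain_exit g j)"
proof (induction j arbitrary: g)
  case 0
  then show ?case by simp
next
  case (Suc j)
  have "removable_exit (Suc j) g = Option.bind (Option.bind
      (if \<exists>r. g (Suc j) = drop_col r then Some (THE r. g (Suc j) = drop_col r) else None)
      (chain_exit (g \<circ> Suc) j)) (col_exit (g 0))"
    using Suc.IH[of "g \<circ> Suc"] by (simp only: removable_exit.simps comp_def)
  also have "\<dots> = Option.bind
      (if \<exists>r. g (Suc j) = drop_col r then Some (THE r. g (Suc j) = drop_col r) else None)
      (\<lambda>i. Option.bind (chain_exit (g \<circ> Suc) j i) (col_exit (g 0)))"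
    by (rule bind_assoc)
  finally show ?case unfolding chain_exit_shift[symmetric] .
qed

text \<open>The cases of \<open>col_exit\<close> reappear. A crossing is passed if the tile above
  permits it, and a mark ends the chain. A pipe turned down by an unmarked bump may meet neither a
  crossing nor a mark below it, so it meets a second unmarked bump and leaves.\<close>

lemma path_ok_chain:
  assumes disj: "C \<inter> M = {}"
  shows "path_ok C M (Suc i, k, False) \<longleftrightarrow> chain_exit (tiles C M) k i \<noteq> None"
proof (induction k arbitrary: i)
  case 0
  then show ?case by (subst path_ok_rec) simp
next
  case (Suc k)
  let ?f = "tiles C M k"
  have f: "?f i = Cr \<longleftrightarrow> (Suc i, Suc k) \<in> C" "?f i = Mk \<longleftrightarrow> (Suc i, Suc k) \<in> M" for i
    using disj by (auto simp: tiles_def)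
  have f': "?f i = Bu \<longleftrightarrow> (Suc i, Suc k) \<notin> C \<union> M" for i
    by (auto simp: tiles_def)
  show ?case
  proof (cases "?f i")
    case Cr
    have ok: "state_ok C M (Suc i, Suc k, False) \<longleftrightarrow> i = 0 \<or> ?f (i - 1) \<noteq> Bu"
      using Cr f f' disj by (cases i) (auto simp: state_ok_def)
    have "path_ok C M (Suc i, Suc k, False) \<longleftrightarrow>
        state_ok C M (Suc i, Suc k, False) \<and> path_ok C M (Suc i, k, False)"
      using Cr f by (subst path_ok_rec) simp
    then show ?thesis using Cr ok Suc.IH by (simp add: col_exit_def)
  next
    case Mk
    have "\<not> state_ok C M (Suc i, Suc k, False)" using Mk f by (simp add: state_ok_def)
    then have "\<not> path_ok C M (Suc i, Suc k, False)" by (subst path_ok_rec) simp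
    then show ?thesis using Mk by (simp add: col_exit_def)
  next
    case Bu
    have nC: "(Suc i, Suc k) \<notin> C" "(Suc i, Suc k) \<notin> M" using Bu f' by auto
    then have "state_ok C M (Suc i, Suc k, False)" by (simp add: state_ok_def)
    then have 1: "path_ok C M (Suc i, Suc k, False) \<longleftrightarrow> path_ok C M (Suc (Suc i), Suc k, True)"
      using nC by (subst path_ok_rec) simp
    have ok: "state_ok C M (Suc (Suc i), Suc k, True) \<longleftrightarrow> ?f (Suc i) = Bu"
      using nC f' by (auto simp: state_ok_def)
    have "path_ok C M (Suc (Suc i), Suc k, True) \<longleftrightarrow> ?f (Suc i) = Bu \<and> path_ok C M (Suc (Suc i), k, False)"
      using f'[of "Suc i"] by (subst path_ok_rec) (auto simp: ok)
    then show ?thesis using 1 Bu Suc.IH by (simp add: col_exit_def)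
  qed
qed

lemma removable_iff:
  assumes C: "C \<subseteq> triangle m" and M: "M \<subseteq> triangle m" and disj: "C \<inter> M = {}" and j: "j < m"
  shows "removable C M m (Suc j) \<longleftrightarrow> removable_exit j (tiles C M) \<noteq> None"
proof -
  let ?f = "tiles C M j"
  have bound: "(i, Suc j) \<in> C \<union> M \<Longrightarrow> 1 \<le> i \<and> i + Suc j \<le> m" for i
    using C M by (auto simp: triangle_def)
  \<comment> \<open>The pipe starts on top of its own column and falls through consecutive
    crossings.\<close>
  have trav: "traverses C m (Suc j) (Suc i, Suc j)" if "?f = drop_col r" "i \<le> r" for r i
  proof -
    have "visits C (Suc j) (Suc i, Suc j, True)"
      using that(2)
    proof (induction i)
      case 0
      then show ?case using visits_start[of C "Suc j"] by simp
    next
      case (Suc i)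
      have "?f i = Cr" using that(1) Suc by (simp add: drop_col_def)
      then have "(Suc i, Suc j) \<in> C" by (simp add: tiles_def split: if_splits)
      then show ?case using visits_step[OF Suc.IH] Suc.prems by simp
    qed
    then show ?thesis using traverses_iff[OF C, of "Suc j" "Suc j"] j by auto
  qed
  have shape: "(\<exists>r. (\<forall>i. 1 \<le> i \<and> i \<le> r \<longrightarrow> (i, Suc j) \<in> C \<and> traverses C m (Suc j) (i, Suc j)) \<and>
      (\<forall>i. r < i \<and> i \<le> m + 1 - Suc j \<longrightarrow> (i, Suc j) \<notin> C \<and> (i, Suc j) \<notin> M)) \<longleftrightarrow>
      (\<exists>r. ?f = drop_col r)"
  proof (intro iffI; elim exE conjE)
    fix r assume *: "\<forall>i. 1 \<le> i \<and> i \<le> r \<longrightarrow> (i, Suc j) \<in> C \<and> traverses C m (Suc j) (i, Suc j)"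
      "\<forall>i. r < i \<and> i \<le> m + 1 - Suc j \<longrightarrow> (i, Suc j) \<notin> C \<and> (i, Suc j) \<notin> M"
    have "?f i = drop_col r i" for i
    proof (cases "i < r")
      case True
      then have "(Suc i, Suc j) \<in> C" using *(1) by simp
      then show ?thesis using True by (simp add: tiles_def drop_col_def)
    next
      case False
      have "(Suc i, Suc j) \<notin> C \<union> M"
      proof
        assume in_CM: "(Suc i, Suc j) \<in> C \<union> M"
        then have "r < Suc i \<and> Suc i \<le> m + 1 - Suc j" using bound[of "Suc i"] False by simp
        then show False using *(2) in_CM by blast
      qed
      then show ?thesis using False by (simp add: tiles_def drop_col_def)
    qed
    then show "\<exists>r. ?f = drop_col r" by blast
  next
    fix r assume r: "?f = drop_col r"
    have "(i, Suc j) \<in> C \<and> traverses C m (Suc j) (i, Suc j)" if h: "1 \<le> i" "i \<le> r" for i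
    proof -
      obtain i' where i: "i = Suc i'" using h(1) by (cases i) auto
      have "?f i' = Cr" using r h i by (simp add: drop_col_def)
      then have "(i, Suc j) \<in> C" by (simp add: tiles_def i split: if_splits)
      then show ?thesis using trav[OF r, of i'] h i by simp
    qed
    moreover have "(i, Suc j) \<notin> C \<and> (i, Suc j) \<notin> M" if h: "r < i" for i
    proof -
      obtain i' where i: "i = Suc i'" using h by (cases i) auto
      have "?f i' = Bu" using r h i by (simp add: drop_col_def)
      then show ?thesis by (auto simp: tiles_def i split: if_splits)
    qed
    ultimately show "\<exists>r. (\<forall>i. 1 \<le> i \<and> i \<le> r \<longrightarrow> (i, Suc j) \<in> C \<and> traverses C m (Suc j) (i, Suc j)) \<and>
      (\<forall>i. r < i \<and> i \<le> m + 1 - Suc j \<longrightarrow> (i, Suc j) \<notin> C \<and> (i, Suc j) \<notin> M)"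
      by blast
  qed
  have "(\<forall>p\<in>C. traverses C m (Suc j) p \<longrightarrow> 1 < fst p \<longrightarrow> (fst p - 1, snd p) \<in> C \<or> (fst p - 1, snd p) \<in> M) \<and>
      (\<forall>p\<in>M. \<not> traverses C m (Suc j) p) \<longleftrightarrow>
      (\<forall>s. visits C (Suc j) s \<and> 0 < column s \<longrightarrow> state_ok C M s)"
  proof -
    have trav: "traverses C m (Suc j) p \<longleftrightarrow> (\<exists>t. visits C (Suc j) (fst p, snd p, t) \<and> 0 < snd p)" for p
      using set_pipe_path[OF C, of "Suc j"] j by (auto simp: traverses_def)
    show ?thesis unfolding trav state_ok_def by fastforce
  qed
  also have "\<dots> \<longleftrightarrow> path_ok C M (1, Suc j, True)"
  proof -
    have "(\<forall>n'\<le>n. 0 < column ((pd_step C ^^ n') (1, Suc j, True))) \<longleftrightarrow> inside C (Suc j) (Suc n)" for n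
      by (simp only: inside_def path_state_def less_Suc_eq_le)
    then show ?thesis
      unfolding path_ok_def visits_def path_state_def[symmetric] inside_Suc by blast
  qed
  finally have ok: "(\<forall>p\<in>C. traverses C m (Suc j) p \<longrightarrow> 1 < fst p \<longrightarrow>
        (fst p - 1, snd p) \<in> C \<or> (fst p - 1, snd p) \<in> M) \<and>
      (\<forall>p\<in>M. \<not> traverses C m (Suc j) p) \<longleftrightarrow> path_ok C M (1, Suc j, True)" .
  \<comment> \<open>In the starting column every crossing has a crossing above it or lies in the top
    row, and the first bump, in row \<open>Suc r\<close>, turns the pipe left.\<close>
  have down: "path_ok C M (1, Suc j, True) \<longleftrightarrow> path_ok C M (Suc r, j, False)" if r: "?f = drop_col r" for r
  proof -
    have "path_ok C M (1, Suc j, True) \<longleftrightarrow> path_ok C M (Suc i, Suc j, True)" if "i \<le> r" for i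
      using that
    proof (induction i)
      case (Suc i)
      have inC: "(Suc i', Suc j) \<in> C" if "i' < r" for i'
        using fun_cong[OF r, of i'] that by (simp add: tiles_def drop_col_def split: if_splits)
      have "state_ok C M (Suc i, Suc j, True)"
        using inC[of i] inC[of "i - 1"] Suc.prems disj by (cases i) (auto simp: state_ok_def)
      then have "path_ok C M (Suc i, Suc j, True) \<longleftrightarrow> path_ok C M (Suc (Suc i), Suc j, True)"
        using inC[of i] Suc.prems by (subst path_ok_rec) simp
      then show ?case using Suc by simp
    qed simp
    then have "path_ok C M (1, Suc j, True) \<longleftrightarrow> path_ok C M (Suc r, Suc j, True)" by simp
    moreover have nC: "(Suc r, Suc j) \<notin> C" "(Suc r, Suc j) \<notin> M"
      using fun_cong[OF r, of r] by (auto simp: tiles_def drop_col_def split: if_splits)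
    ultimately show ?thesis by (subst (asm) (2) path_ok_rec) (simp add: state_ok_def)
  qed
  show ?thesis
  proof (cases "\<exists>r. ?f = drop_col r")
    case False
    then show ?thesis unfolding removable_def shape by (simp add: removable_exit_chain)
  next
    case True
    then obtain r where r: "?f = drop_col r" by blast
    have "(THE r. ?f = drop_col r) = r" using r by (intro the_equality) auto
    then have "removable_exit j (tiles C M) = chain_exit (tiles C M) j r"
      using True by (simp add: removable_exit_chain)
    then show ?thesis
      unfolding removable_def shape ok down[OF r] path_ok_chain[OF disj] using True by (simp only: simp_thms)
  qed
qed

section \<open>The main theorem\<close>

lemma col_map:
  assumes "\<And>a b. a \<in> A \<Longrightarrow> b \<in> A \<Longrightarrow> \<phi> a < \<phi> b \<longleftrightarrow> a < b"
    and "insert p (set u) \<subseteq> A"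
  shows "col_out (\<phi> p) (map \<phi> u) f = map \<phi> (col_out p u f)"
    "col_valid (\<phi> p) (map \<phi> u) f \<longleftrightarrow> col_valid p u f"
  using assms(2) by (induction u arbitrary: p f) (auto simp: assms(1))

text \<open>Tiles only compare labels, so an order-preserving relabelling changes neither validity
  nor the routes of the pipes.\<close>

lemma dream_map:
  assumes "\<And>a b. a \<in> A \<Longrightarrow> b \<in> A \<Longrightarrow> \<phi> a < \<phi> b \<longleftrightarrow> a < b" and "set xs \<subseteq> A"
  shows "dream_out (map \<phi> xs) g = map \<phi> (dream_out xs g)"
    "dream_valid (map \<phi> xs) g \<longleftrightarrow> dream_valid xs g"
  using assms(2)
  by (induction xs arbitrary: g) (simp_all add: col_map[OF assms(1)] set_dream_out)

definition rank :: "nat list \<Rightarrow> nat \<Rightarrow> nat" where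
  "rank v x = card {y \<in> set v. y \<le> x}"

lemma std_eq: "std v = map (rank v) v"
  by (simp add: std_def rank_def)

lemma rank_less:
  assumes "x \<in> set v" "y \<in> set v"
  shows "rank v x < rank v y \<longleftrightarrow> x < y"
proof -
  have "rank v x < rank v y" if "x < y" "y \<in> set v" for x y
    unfolding rank_def
  proof (rule psubset_card_mono)
    have "y \<in> {z \<in> set v. z \<le> y} - {z \<in> set v. z \<le> x}" using that by simp
    moreover have "{z \<in> set v. z \<le> x} \<subseteq> {z \<in> set v. z \<le> y}" using that by auto
    ultimately show "{z \<in> set v. z \<le> x} \<subset> {z \<in> set v. z \<le> y}" by blast
  qed simp
  moreover have "rank v x \<le> rank v y" if "x \<le> y" for x y
    unfolding rank_def by (intro card_mono) (use that in auto)
  ultimately show ?thesis using assms by (meson leD leI)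
qed

lemma rank_inj: "inj_on (rank v) (set v)"
  using rank_less by (intro inj_onI) (metis less_irrefl linorder_neqE_nat)

lemma is_perm_std:
  assumes "distinct v"
  shows "is_perm (std v)"
proof -
  have "rank v ` set v \<subseteq> {1..length v}"
  proof (rule image_subsetI)
    fix x assume "x \<in> set v"
    then have "0 < rank v x" unfolding rank_def by (auto simp: card_gt_0_iff)
    moreover have "rank v x \<le> card (set v)" unfolding rank_def by (intro card_mono) auto
    ultimately show "rank v x \<in> {1..length v}" using card_length[of v] by simp
  qed
  moreover have "card (rank v ` set v) = length v"
    using assms by (simp add: card_image[OF rank_inj] distinct_card)
  ultimately have "rank v ` set v = {1..length v}" by (intro card_subset_eq) simp_all
  then show ?thesis
    using assms rank_inj by (simp add: is_perm_def std_eq distinct_map)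
qed

lemma length_std [simp]: "length (std v) = length v"
  by (simp add: std_def)

lemma sort_perm:
  assumes "is_perm w"
  shows "sort w = [1..<Suc (length w)]"
proof (rule sorted_distinct_set_unique)
  have "set w = {1..length w}" "distinct w" using assms unfolding is_perm_def by blast+
  then show "set (sort w) = set [1..<Suc (length w)]" "distinct (sort w)"
    by (simp_all only: set_sort set_upt atLeastLessThanSuc_atLeastAtMost distinct_sort)
qed (simp_all del: upt_Suc)

lemma std_perm:
  assumes "is_perm w"
  shows "std w = w"
proof -
  have "{y \<in> set w. y \<le> x} = {1..x}" if "x \<in> set w" for x
    using assms that by (auto simp: is_perm_def)
  then show ?thesis by (simp add: std_def map_idI)
qed

lemma sort_std:
  assumes "distinct v"
  shows "sort (std v) = map (rank v) (sort v)"
proof (rule sorted_distinct_set_unique)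
  have "sorted_wrt (\<lambda>x y. rank v x < rank v y) (sort v)"
    using strict_sorted_sort[OF assms] by (rule sorted_wrt_mono_rel[rotated]) (simp add: rank_less)
  then have "sorted_wrt (<) (map (rank v) (sort v))" by (simp add: sorted_wrt_map)
  then show "sorted (map (rank v) (sort v))" "distinct (map (rank v) (sort v))"
    by (simp_all add: strict_sorted_iff)
  show "distinct (sort (std v))" using is_perm_std[OF assms] by (simp add: is_perm_def)
  show "set (sort (std v)) = set (map (rank v) (sort v))" by (simp add: std_eq)
qed simp

lemma dreams_of_std:
  assumes "distinct v"
  shows "dreams_of (std v) = dreams_of v"
proof -
  have "map (rank v) (dream_out (sort v) g) = map (rank v) v \<longleftrightarrow> dream_out (sort v) g = v" for g
    using rank_inj by (intro inj_on_map_eq_map) (simp add: set_dream_out)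
  then show ?thesis
    unfolding dreams_of_def sort_std[OF assms]
    using dream_map[of "set v" "rank v" "sort v", OF rank_less] by (simp add: std_eq)
qed

lemma core_from_std:
  assumes "distinct v"
  shows "core_from 0 (std v) = core_from 0 v"
  unfolding core_from_def dreams_of_std[OF assms] by simp

lemma Upsilon_eq:
  assumes "is_perm w"
  shows "Upsilon \<beta> w = weight_sum \<beta> (dreams_of w)"
proof (cases "length w")
  case 0
  then have "dreams_of w = {\<lambda>_ _. Bu}" by (auto simp: dreams_of_def dreams_0)
  then show ?thesis using 0 by (simp add: Upsilon_def weight_sum_def marks_def)
next
  case (Suc N)
  show ?thesis
    unfolding Upsilon_eq_hecke[OF assms Suc] hecke_groth_ones weight_sum_def
    by (simp only: dreams_of_def sort_perm[OF assms] Suc)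
qed

lemma marks_tiles:
  assumes "C \<inter> M = {}" "M \<subseteq> triangle m"
  shows "marks (tiles C M) = card M"
proof -
  have "bij_betw (\<lambda>(k, i). (Suc i, Suc k)) {(k, i). tiles C M k i = Mk} M"
    by (rule bij_betw_byWitness[of _ "\<lambda>(i, k). (k - 1, i - 1)"])
       (use assms in \<open>auto simp: tiles_def triangle_def split: if_splits\<close>)
  from bij_betw_same_card[OF this] show ?thesis by (simp add: marks_def)
qed

lemma CMRPD_bij:
  assumes \<sigma>: "is_perm \<sigma>"
  shows "bij_betw (\<lambda>(C, M). tiles C M) (CMRPD \<sigma>) (core_from 0 \<sigma>)"
proof -
  define m where "m = length \<sigma>"
  define crosses where "crosses g = {(i, k). 1 \<le> i \<and> 1 \<le> k \<and> g (k - 1) (i - 1) = Cr}" for g :: "nat \<Rightarrow> nat \<Rightarrow> tile"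
  define marked where "marked g = {(i, k). 1 \<le> i \<and> 1 \<le> k \<and> g (k - 1) (i - 1) = Mk}" for g :: "nat \<Rightarrow> nat \<Rightarrow> tile"
  note MRPD = MRPD_iff[OF \<sigma> m_def[symmetric]]
  have core: "g \<in> core_from 0 \<sigma> \<longleftrightarrow> g \<in> dreams m \<and> dream_valid [1..<Suc m] g \<and>
      dream_out [1..<Suc m] g = \<sigma> \<and> (\<forall>j<m. removable_exit j g = None)" for g
    unfolding core_from_def dreams_of_def sort_perm[OF \<sigma>] m_def by auto
  have cmrpd: "(C, M) \<in> CMRPD \<sigma> \<longleftrightarrow> (C \<subseteq> triangle m \<and> M \<subseteq> triangle m \<and> C \<inter> M = {}) \<and> tiles C M \<in> core_from 0 \<sigma>"
    for C M
  proof -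
    have "tiles C M \<in> dreams m" if "C \<subseteq> triangle m" "M \<subseteq> triangle m"
      using that by (auto simp: dreams_def tiles_def triangle_def)
    moreover have "(\<exists>j\<in>{1..m}. removable C M m j) \<longleftrightarrow> \<not> (\<forall>j<m. removable_exit j (tiles C M) = None)"
      if "C \<subseteq> triangle m" "M \<subseteq> triangle m" "C \<inter> M = {}"
    proof -
      have "(\<exists>j\<in>{1..m}. removable C M m j) \<longleftrightarrow> (\<exists>j<m. removable C M m (Suc j))"
        unfolding image_Suc_lessThan[symmetric] by auto
      then show ?thesis using removable_iff[OF that] by blast
    qed
    ultimately show ?thesis unfolding CMRPD_def core m_def[symmetric] by (auto simp: MRPD simp del: upt_Suc)
  qed
  have inverse: "tiles (crosses g) (marked g) = g" for g
  proof (intro ext)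
    fix k i show "tiles (crosses g) (marked g) k i = g k i"
      by (cases "g k i") (auto simp: tiles_def crosses_def marked_def)
  qed
  show ?thesis
  proof (rule bij_betw_byWitness[of _ "\<lambda>g. (crosses g, marked g)"])
    show "\<forall>P\<in>CMRPD \<sigma>. (crosses (case P of (C, M) \<Rightarrow> tiles C M), marked (case P of (C, M) \<Rightarrow> tiles C M)) = P"
    proof
      fix P assume "P \<in> CMRPD \<sigma>"
      then obtain C M where P: "P = (C, M)" "C \<subseteq> triangle m" "M \<subseteq> triangle m" "C \<inter> M = {}"
        using cmrpd by (cases P) auto
      have "crosses (tiles C M) = C" "marked (tiles C M) = M"
        using P(2-4) by (auto simp: crosses_def marked_def tiles_def triangle_def split: if_splits)
      then show "(crosses (case P of (C, M) \<Rightarrow> tiles C M), marked (case P of (C, M) \<Rightarrow> tiles C M)) = P"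
        by (simp add: P(1))
    qed
    show "\<forall>g\<in>core_from 0 \<sigma>. (case (crosses g, marked g) of (C, M) \<Rightarrow> tiles C M) = g"
      by (simp add: inverse)
    show "(\<lambda>(C, M). tiles C M) ` CMRPD \<sigma> \<subseteq> core_from 0 \<sigma>"
      using cmrpd by auto
    show "(\<lambda>g. (crosses g, marked g)) ` core_from 0 \<sigma> \<subseteq> CMRPD \<sigma>"
    proof (rule image_subsetI)
      fix g assume g: "g \<in> core_from 0 \<sigma>"
      then have "g \<in> dreams m" using core by blast
      then have Bu: "g k i = Bu" if "m \<le> Suc (k + i)" for k i using that by (simp add: dreams_def)
      have "i + k \<le> m" if "1 \<le> i" "1 \<le> k" "g (k - 1) (i - 1) \<noteq> Bu" for i k
      proof -
        have "\<not> m \<le> Suc ((k - 1) + (i - 1))" using Bu that(3) by blast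
        then show ?thesis using that(1,2) by linarith
      qed
      then have "crosses g \<subseteq> triangle m" "marked g \<subseteq> triangle m"
        by (auto simp: crosses_def marked_def triangle_def)
      moreover have "crosses g \<inter> marked g = {}" by (auto simp: crosses_def marked_def)
      ultimately show "(crosses g, marked g) \<in> CMRPD \<sigma>" using g by (simp add: cmrpd inverse)
    qed
  qed
qed

lemma CMRPD_sum:
  assumes \<sigma>: "is_perm \<sigma>"
  shows "(\<Sum>(C, M)\<in>CMRPD \<sigma>. \<beta> ^ card M) = weight_sum \<beta> (core_from 0 \<sigma>)"
proof -
  have "card M = marks (tiles C M)" if "(C, M) \<in> CMRPD \<sigma>" for C M
  proof -
    have "C \<inter> M = {}" "M \<subseteq> triangle (length \<sigma>)"
      using that MRPD_iff[OF \<sigma> refl] by (auto simp: CMRPD_def)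
    then show ?thesis by (simp add: marks_tiles)
  qed
  then have "(\<Sum>(C, M)\<in>CMRPD \<sigma>. \<beta> ^ card M) = (\<Sum>P\<in>CMRPD \<sigma>. \<beta> ^ marks (case P of (C, M) \<Rightarrow> tiles C M))"
    by (intro sum.cong) auto
  then show ?thesis
    unfolding weight_sum_def using sum.reindex_bij_betw[OF CMRPD_bij[OF \<sigma>], of "\<lambda>g. \<beta> ^ marks g"] by simp
qed

text \<open>For the empty word the constant \<open>Bu\<close> is the only dream; it has no marks and
  matches the convention that the coefficient is 1.\<close>

lemma d_coef_eq:
  assumes \<sigma>: "is_perm \<sigma>"
  shows "d_coef \<beta> \<sigma> = weight_sum \<beta> (core_from 0 \<sigma>)"
proof (cases "\<sigma> = []")
  case True
  then have "core_from 0 \<sigma> = {\<lambda>_ _. Bu}" by (auto simp: core_from_def dreams_of_def dreams_0)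
  then show ?thesis using True by (simp add: d_coef_def weight_sum_def marks_def)
next
  case False
  then show ?thesis using CMRPD_sum[OF \<sigma>] by (simp add: d_coef_def)
qed

theorem theorem3p9:
  fixes w :: "nat list" and \<beta> :: "'a::comm_ring_1"
  assumes "is_perm w" and "avoids_1423 w"
  shows "c_coef \<beta> w = d_coef \<beta> w \<and>
         c_coef \<beta> w = (\<Sum>(C, M) \<in> CMRPD w. \<beta> ^ card M) \<and>
         Upsilon \<beta> w = (\<Sum>v \<leftarrow> subseqs w. d_coef \<beta> (std v))"
proof -
  let ?core = "\<lambda>v. weight_sum \<beta> (core_from 0 v)"
  have dist: "distinct v" if "v \<in> set (subseqs w)" for v
    using assms(1) that distinct_subseqs by (auto simp: is_perm_def)
  have ups: "Upsilon \<beta> (std v) = (\<Sum>u\<leftarrow>subseqs v. ?core u)" if "v \<in> set (subseqs w)" for v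
    using weight_sum_dreams_of[OF dist[OF that] avoids_1423_subseqs[OF assms(2) that], of \<beta>]
    by (simp add: Upsilon_eq[OF is_perm_std[OF dist[OF that]]] dreams_of_std[OF dist[OF that]])
  have d: "d_coef \<beta> (std v) = ?core v" if "v \<in> set (subseqs w)" for v
    using d_coef_eq[OF is_perm_std[OF dist[OF that]], of \<beta>] core_from_std[OF dist[OF that]] by simp
  have w: "w \<in> set (subseqs w)" using filter_in_subseqs[of "\<lambda>_. True" w] by simp
  have "c_coef \<beta> w = (\<Sum>v\<leftarrow>subseqs w. (-1) ^ (length w - length v) * (\<Sum>u\<leftarrow>subseqs v. ?core u))"
    unfolding c_coef_def by (intro arg_cong[of _ _ sum_list] map_cong refl) (simp add: ups)
  also have "\<dots> = ?core w" by (rule moebius_subseqs)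
  finally have "c_coef \<beta> w = ?core w" .
  moreover have "Upsilon \<beta> w = (\<Sum>v\<leftarrow>subseqs w. d_coef \<beta> (std v))"
  proof -
    have "(\<Sum>u\<leftarrow>subseqs w. ?core u) = (\<Sum>v\<leftarrow>subseqs w. d_coef \<beta> (std v))"
      by (intro arg_cong[of _ _ sum_list] map_cong refl) (simp add: d)
    then show ?thesis using ups[OF w] by (simp add: std_perm[OF assms(1)])
  qed
  ultimately show ?thesis using d_coef_eq[OF assms(1), of \<beta>] CMRPD_sum[OF assms(1), of \<beta>] by simp
qed

end
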